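(* Let $L$ be a field of characteristic 2 and let $\alpha\in L$, $\alpha\neq 0$, be algebraic over $\mathbb{Z}/2$. Write $\alpha=\lambda^{2}+\lambda$ with $\lambda$ in an algebraic closure of $L$, let $m$ be the degree of $\lambda$ over $\mathbb{Z}/2$, and let $Q=2^{m-1}$. Then $N_{6Q-5}\cap X$ is a 1-dimensional $L$-vector space.
   Context: $P=z^{4}+xyz^{2}+(x^{3}+y^{3})z\in L[x,y,z]$ and $g_\alpha=P+\alpha x^{2}y^{2}$. Since $\alpha\ne 0$, $\lambda\notin\mathbb{Z}/2$ and $Q\ge 2$. $O$ is the graded $L$-algebra $L[x,y,z]/(x^{4Q},y^{4Q},z^{4Q})$, with degree $j$ component $O_j$. $N_{6Q-5}$ is the kernel of the map $O_{6Q-5}\to O_{6Q-1}$ given by multiplication by $g_\alpha$. For integers $i,j\ge 0$, $[i,j]=x^{i}y^{j}+x^{j}y^{i}$. $X\subset O_{6Q-5}$ is the $L$-subspace spanned by the $[i,j]P^{k}$ with $i+j+4k=6Q-5$ and $k=0,1,\ldots,Q-1$. *)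

theory Defs
  imports
    "HOL-Algebra.Algebraic_Closure_Type"
    "HOL-Algebra.Finite_Extensions"
    "HOL-Algebra.QuotRing"
    "HOL-Library.Poly_Mapping"
    "HOL-Library.Product_Plus"
begin

text \<open>
  The polynomial ring \<open>L[x,y,z]\<close> is the monoid algebra of the additive monoid of exponent
  triples: the monomial \<open>x\<^sup>a y\<^sup>b z\<^sup>c\<close> has key \<open>(a, b, c)\<close>.
\<close>

type_synonym 'a poly3 = "(nat \<times> nat \<times> nat) \<Rightarrow>\<^sub>0 'a"

definition var_x :: "'a::field poly3" where "var_x = Poly_Mapping.single (1, 0, 0) 1"
definition var_y :: "'a::field poly3" where "var_y = Poly_Mapping.single (0, 1, 0) 1"
definition var_z :: "'a::field poly3" where "var_z = Poly_Mapping.single (0, 0, 1) 1"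

definition const3 :: "'a::field \<Rightarrow> 'a poly3"
  where "const3 c = Poly_Mapping.single (0, 0, 0) c"

definition homogeneous3 :: "nat \<Rightarrow> 'a::field poly3 set"
  where "homogeneous3 d = {p. \<forall>(a, b, c) \<in> Poly_Mapping.keys p. a + b + c = d}"

definition P_poly :: "'a::field poly3"
  where "P_poly = var_z ^ 4 + var_x * var_y * var_z ^ 2 + (var_x ^ 3 + var_y ^ 3) * var_z"

definition g_poly :: "'a::field \<Rightarrow> 'a poly3"
  where "g_poly \<alpha> = P_poly + const3 \<alpha> * var_x ^ 2 * var_y ^ 2"

text \<open>The symbol \<open>[i,j]\<close>; in characteristic 2 it vanishes for \<open>i = j\<close>.\<close>

definition sym_pair :: "nat \<Rightarrow> nat \<Rightarrow> 'a::field poly3"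
  where "sym_pair i j = var_x ^ i * var_y ^ j + var_x ^ j * var_y ^ i"

definition O_ideal :: "nat \<Rightarrow> 'a::field poly3 set"
  where "O_ideal Q =
    Idl\<^bsub>ring_of_type_algebra\<^esub> {var_x ^ (4 * Q), var_y ^ (4 * Q), var_z ^ (4 * Q)}"

definition O_ring :: "nat \<Rightarrow> 'a::field poly3 set ring"
  where "O_ring Q = ring_of_type_algebra Quot O_ideal Q"

definition to_O :: "nat \<Rightarrow> 'a::field poly3 \<Rightarrow> 'a poly3 set"
  where "to_O Q p = O_ideal Q +>\<^bsub>ring_of_type_algebra\<^esub> p"

text \<open>
  The image of \<open>L\<close> in \<open>O\<close>. For \<open>Q > 0\<close> the structure map \<open>L \<rightarrow> O\<close> is injective, so
  \<open>L\<close>-linear notions in \<open>O\<close> are those over this subfield.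
\<close>

definition O_scalars :: "nat \<Rightarrow> 'a::field poly3 set set"
  where "O_scalars Q = to_O Q ` range const3"

definition O_component :: "nat \<Rightarrow> nat \<Rightarrow> 'a::field poly3 set set"
  where "O_component Q j = to_O Q ` homogeneous3 j"

definition N_space :: "'a::field \<Rightarrow> nat \<Rightarrow> 'a poly3 set set"
  where "N_space \<alpha> Q =
    {u \<in> O_component Q (6 * Q - 5). to_O Q (g_poly \<alpha>) \<otimes>\<^bsub>O_ring Q\<^esub> u = \<zero>\<^bsub>O_ring Q\<^esub>}"

definition X_generators :: "nat \<Rightarrow> 'a::field poly3 set set"
  where "X_generators Q =
    {to_O Q (sym_pair i j * P_poly ^ k) | i j k. i + j + 4 * k = 6 * Q - 5 \<and> k < Q}"

text \<open>\<open>ring.Span\<close> takes a list of vectors, so the span of a set is the union over lists from it.\<close>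

definition X_space :: "nat \<Rightarrow> 'a::field poly3 set set"
  where "X_space Q = (\<Union>us \<in> lists (X_generators Q). ring.Span (O_ring Q) (O_scalars Q) us)"

text \<open>In characteristic 2 the prime field \<open>\<int>/2\<close> is \<open>{0, 1}\<close>.\<close>

definition algebraic_over_F2 :: "'a::field \<Rightarrow> bool"
  where "algebraic_over_F2 a \<longleftrightarrow> (ring.algebraic ring_of_type_algebra over {0, 1}) a"

text \<open>The degree of the minimal polynomial.\<close>

definition degree_over_F2 :: "'a::field \<Rightarrow> nat"
  where "degree_over_F2 a = Polynomials.degree (ring.Irr ring_of_type_algebra {0, 1} a)"

end

theory Submission
  imports Defs
begin

text \<open>
Write \<open>c = \<alpha> x\<^sup>2 y\<^sup>2\<close>, so that \<open>g\<^sub>\<alpha> = P + c\<close>. Since \<open>P\<close> is monic of degree \<open>4\<close> in \<open>z\<close>, an element of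
\<open>X\<close> is a sum of \<open>s\<^sub>k P ^ k\<close> over \<open>k < Q\<close> with coefficients \<open>s\<^sub>k\<close> that are unique modulo \<open>x ^ (4 Q)\<close> and
\<open>y ^ (4 Q)\<close>, and multiplication by \<open>g\<^sub>\<alpha>\<close> is multiplication by \<open>Y + c\<close> for \<open>Y = P\<close>, except that it
produces \<open>P ^ Q\<close>. The polynomial \<open>P\<close> is additive in \<open>z\<close>. Repeated squaring therefore writes
\<open>z ^ (4 Q)\<close>, which is zero in \<open>O\<close>, as \<open>w (P) + V z\<^sup>2 + U z\<close> with an additive polynomial \<open>w\<close> of degree \<open>Q\<close>
and with \<open>U\<close>, \<open>V\<close> free of \<open>z\<close> (\<open>var_z_frobenius_power\<close>). Dividing \<open>w (Y) + w (c)\<close> by \<open>Y + c\<close> gives a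
cofactor \<open>\<Phi>\<close> with \<open>g\<^sub>\<alpha> \<Phi> (P) = z ^ (4 Q) + w (c) + V z\<^sup>2 + U z\<close> (\<open>g_poly_mult_cofactor\<close>). It follows that
the kernel elements in \<open>X\<close> are the products \<open>s \<Phi> (P)\<close>, where \<open>s\<close> is a palindromic form of degree
\<open>2 Q - 1\<close> such that \<open>s w (c)\<close>, \<open>s U\<close> and \<open>s V\<close> lie in the ideal of \<open>x ^ (4 Q)\<close> and \<open>y ^ (4 Q)\<close>
(\<open>kernel_P_combination\<close>). It remains to show that these \<open>s\<close> form a line.

At \<open>y = 1\<close> and \<open>x = t\<close>, the conditions on \<open>s U\<close> and \<open>s V\<close> say that \<open>1 + t\<^sup>3\<close> divides \<open>s\<close>
(\<open>coefficient_conditions\<close>). The form \<open>w (c)\<close> becomes \<open>H (t\<^sup>2)\<close> for a polynomial \<open>H\<close>, and the condition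
on \<open>s w (c)\<close> becomes a Pade problem for the even part \<open>S\<close> of \<open>s\<close>: there is \<open>u\<close> such that \<open>S\<close> and \<open>u\<close> have
degree less than \<open>Q\<close> and \<open>S H + u\<close> is divisible by \<open>t ^ (2 Q)\<close>.

Let \<open>H\<^sub>n\<close> be this polynomial with \<open>2 ^ n\<close> in place of \<open>2 Q\<close>. The pairs \<open>(S, u)\<close> at level \<open>n\<close> form a
lattice of rank two, and \<open>H\<^sub>n\<^sub>+\<^sub>1 = \<alpha> t A\<^sub>n\<^sub>+\<^sub>1 + H\<^sub>n\<^sup>2\<close>, where \<open>(1 + t\<^sup>3) A\<^sub>n\<^sub>+\<^sub>1\<close> is \<open>1\<close> or \<open>t\<close> up to high
powers of \<open>t\<close>. So the lattice at level \<open>n + 1\<close> is found inside the Frobenius twist of the lattice at level \<open>n\<close>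
by conditions at the cube roots of unity. They can be solved explicitly as long as
\<open>T\<^sub>n = \<alpha> + \<alpha>\<^sup>2 + \<dots> + \<alpha> ^ (2 ^ (n - 1))\<close> is not zero: the new basis has determinant
\<open>T\<^sub>n\<^sub>+\<^sub>1 t ^ (2 ^ (n + 1))\<close> and vectors of degree about \<open>2 ^ n\<close> (\<open>lattice_basis_Suc\<close>). Here the choice
of \<open>Q\<close> enters. Since \<open>\<alpha> = \<lambda>\<^sup>2 + \<lambda>\<close>, the sum \<open>T\<^sub>n\<close> is \<open>\<lambda> ^ (2 ^ n) + \<lambda>\<close>, so it vanishes for \<open>n = m\<close>
and for no smaller positive \<open>n\<close> (\<open>trace_sum_degree\<close>). At level \<open>m\<close>, where \<open>2 ^ m = 2 Q\<close>, the vanishing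
shortens one vector to degree at most \<open>Q - 2\<close>, and the multiples of it by \<open>a + b t\<close> are all the vectors of degree
less than \<open>Q\<close> (\<open>minimal_syzygy\<close>). Finally, divisibility of \<open>s\<close> by \<open>1 + t\<^sup>3\<close> forces \<open>b = 0\<close>
(\<open>unique_palindromic_solution\<close>), which leaves one dimension.
\<close>

section \<open>Remainders of powers of \<open>z\<close>, in one variable\<close>

definition tvar :: "'a::field poly" where "tvar = [:0, 1:]"
text \<open>
  The variable \<open>y\<close> is set to \<open>1\<close> wherever one-variable polynomials occur: \<open>tvar\<close> stands for \<open>x\<close>
  and \<open>cub\<close> for \<open>x\<^sup>3 + y\<^sup>3\<close>.
\<close>

definition cub :: "'a::field poly" where "cub = 1 + tvar ^ 3"

text \<open>
  The coefficient of \<open>z\<^sup>2\<close> in the remainder of \<open>z ^ (2 ^ n)\<close> modulo \<open>P\<close>. The coefficient of \<open>z\<close>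
  in the same remainder is \<open>cub\<close> times the square of the preceding value.
\<close>

fun frob_rem :: "nat \<Rightarrow> 'a::field poly" where
  "frob_rem 0 = 0"
| "frob_rem (Suc 0) = 1"
| "frob_rem (Suc (Suc n)) = tvar * frob_rem (Suc n) ^ 2 + cub ^ 2 * frob_rem n ^ 4"

text \<open>
  Unfolded, this is the sum of \<open>(\<alpha> t frob_rem (n - i)) ^ (2 ^ i)\<close> over \<open>i < n\<close>. With \<open>t\<^sup>2\<close> in place
  of \<open>t\<close> it is the part free of \<open>z\<close> in the remainder of \<open>z ^ (2 ^ (n + 1))\<close> modulo \<open>g\<^sub>\<alpha>\<close>.
\<close>

fun obstruction :: "'a::field \<Rightarrow> nat \<Rightarrow> 'a poly" where
  "obstruction \<alpha> 0 = 0"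
| "obstruction \<alpha> (Suc n) = smult \<alpha> (tvar * frob_rem (Suc n)) + obstruction \<alpha> n ^ 2"

text \<open>
  For \<open>\<alpha> = \<lambda>\<^sup>2 + \<lambda>\<close> the sum telescopes to \<open>\<lambda> ^ (2 ^ n) + \<lambda>\<close>, so it vanishes exactly when
  \<open>\<lambda>\<close> lies in the field with \<open>2 ^ n\<close> elements.
\<close>

definition trace_sum :: "'a::field \<Rightarrow> nat \<Rightarrow> 'a" where
  "trace_sum \<alpha> n = (\<Sum>i<n. \<alpha> ^ (2 ^ i))"

text \<open>
  Modulo \<open>t ^ (2 ^ n)\<close>, the product of \<open>t\<close>, \<open>cub\<close> and \<open>frob_rem n\<close> is \<open>t ^ eps n\<close>.
\<close>

definition eps :: "nat \<Rightarrow> nat" where "eps n = (if even n then 2 else 1)"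

lemma char2_add_self: "CHAR('b::comm_ring_1) = 2 \<Longrightarrow> (x::'b) + x = 0"
  by (metis add.right_inverse uminus_CHAR_2)

lemma char2_power_add:
  assumes "CHAR('b::comm_ring_1) = 2"
  shows "((x::'b) + y) ^ (2 ^ n) = x ^ (2 ^ n) + y ^ (2 ^ n)"
  using freshmans_dream'[of "2 ^ n" n x y] assms by simp

lemma char2_power2_add:
  assumes "CHAR('b::comm_ring_1) = 2"
  shows "((x::'b) + y)\<^sup>2 = x\<^sup>2 + y\<^sup>2"
  using char2_power_add[OF assms, of x y 1] by simp

lemma char2_power4_add:
  assumes "CHAR('b::comm_ring_1) = 2"
  shows "((x::'b) + y) ^ 4 = x ^ 4 + y ^ 4"
  using char2_power_add[OF assms, of x y 2] by simp

lemma tvar_power: "tvar ^ n = monom 1 n"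
  by (simp add: tvar_def monom_altdef)

lemma degree_tvar_power [simp]: "degree (tvar ^ n :: 'a::field poly) = n"
  by (simp add: tvar_power degree_monom_eq)

lemma tvar_neq_0 [simp]: "tvar \<noteq> 0"
  by (simp add: tvar_def)

lemma degree_tvar [simp]: "degree (tvar :: 'a::field poly) = 1"
  by (simp add: tvar_def)

lemma degree_cub [simp]: "degree (cub :: 'a::field poly) = 3"
  unfolding cub_def by (subst degree_add_eq_right) auto

lemma cub_neq_0 [simp]: "cub \<noteq> 0"
  by (metis degree_0 degree_cub zero_neq_numeral)

context
  fixes ty :: "'a::field itself"
  assumes char2: "CHAR('a) = 2"
begin

lemma poly_add_self [simp]: "(p::'a poly) + p = 0"
  by (rule char2_add_self) (simp add: char2)

lemma poly_add_self_left [simp]: "(p::'a poly) + (p + q) = q"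
  by (simp flip: add.assoc)

lemma fld_add_self [simp]: "(c::'a) + c = 0"
  by (rule char2_add_self) (simp add: char2)

lemma fld_add_self_left [simp]: "(c::'a) + (c + d) = d"
  by (simp flip: add.assoc)

lemmas char2_cancel = poly_add_self poly_add_self_left fld_add_self fld_add_self_left

lemmas poly_power2_add = char2_power2_add[where 'b = "'a poly", unfolded semiring_char_poly, OF char2]
lemmas poly_power4_add = char2_power4_add[where 'b = "'a poly", unfolded semiring_char_poly, OF char2]
lemmas poly_power_add = char2_power_add[where 'b = "'a poly", unfolded semiring_char_poly, OF char2]

lemma poly_eq_iff_add: "(p::'a poly) = q \<longleftrightarrow> p + q = 0"
  by (metis add.assoc add.right_neutral poly_add_self)

lemma fld_eq_iff_add: "(p::'a) = q \<longleftrightarrow> p + q = 0"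
  by (metis add.assoc add.right_neutral fld_add_self)

text \<open>
  \<open>cub\<close> is a unit modulo any power of \<open>t\<close>, because \<open>cub ^ (2 ^ k) = 1 + t ^ (3 * 2 ^ k)\<close>.
\<close>

lemma dvd_tvar_power_cub:
  assumes "tvar ^ k dvd cub * (p::'a poly)"
  shows "tvar ^ k dvd p"
proof -
  have "k \<le> 3 * 2 ^ k"
    by (metis le_add1 le_trans less_exp less_imp_le mult_Suc numeral_3_eq_3)
  then have 1: "tvar ^ k dvd (tvar ^ (3 * 2 ^ k) :: 'a poly)"
    by (rule le_imp_power_dvd)
  have "(cub::'a poly) ^ (2 ^ k) = 1 + tvar ^ (3 * 2 ^ k)"
    unfolding cub_def poly_power_add by (simp add: power_mult)
  moreover have "tvar ^ k dvd cub ^ (2 ^ k - 1) * (cub * p)"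
    using assms by simp
  moreover have "cub ^ (2 ^ k - 1) * (cub * p) = cub ^ (2 ^ k) * p"
    by (metis mult.assoc power_minus_mult zero_less_numeral zero_less_power)
  ultimately have "tvar ^ k dvd p + tvar ^ (3 * 2 ^ k) * p"
    by (simp add: algebra_simps)
  with 1 show ?thesis
    by (meson dvd_add_left_iff dvd_mult2)
qed

lemma cub_dvd_tvar_power_add_1: "(cub::'a poly) dvd tvar ^ (3 * k) + 1"
proof (induction k)
  case (Suc k)
  have "tvar ^ (3 * Suc k) + 1 = tvar ^ 3 * (tvar ^ (3 * k) + 1) + (cub::'a poly)"
    by (simp add: cub_def algebra_simps power_add power3_eq_cube)
  with Suc show ?case by simp
qed simp

lemma cub_dvd_tvar_power_add:
  assumes "i mod 3 = j mod 3"
  shows "(cub::'a poly) dvd tvar ^ i + tvar ^ j"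
proof -
  have *: "cub dvd tvar ^ i + (tvar ^ (i mod 3) :: 'a poly)" for i
  proof -
    have "tvar ^ i + tvar ^ (i mod 3) = tvar ^ (i mod 3) * (tvar ^ (3 * (i div 3)) + (1 :: 'a poly))"
      by (simp add: distrib_left flip: power_add)
    then show ?thesis using cub_dvd_tvar_power_add_1 by simp
  qed
  have "tvar ^ i + tvar ^ j = (tvar ^ i + tvar ^ (i mod 3)) + (tvar ^ j + (tvar ^ (j mod 3) :: 'a poly))"
    using assms by (simp add: algebra_simps)
  then show ?thesis using * by (metis dvd_add)
qed

text \<open>
  \<open>t\<close> is a unit modulo \<open>cub\<close>, because its cube is \<open>1\<close> there.
\<close>

lemma cub_dvd_tvar_power_mult:
  assumes "cub dvd tvar ^ k * (p::'a poly)"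
  shows "cub dvd p"
proof -
  have "cub dvd tvar ^ (2 * k) * (tvar ^ k * p)"
    using assms by simp
  moreover have "tvar ^ (2 * k) * (tvar ^ k * p) = (tvar ^ (3 * k) + 1) * p + p"
    by (simp add: algebra_simps flip: power_add mult.assoc)
  ultimately show ?thesis
    using cub_dvd_tvar_power_add_1 by (metis dvd_add_right_iff dvd_mult2)
qed

text \<open>
  Multiplied by \<open>cub\<^sup>2\<close>, the defining recursion becomes a recursion for the products
  \<open>cub * frob_rem n\<close> alone, and it exchanges the two closed forms.
\<close>

lemma cub_mult_frob_rem:
  "cub * frob_rem n =
    (if even n then tvar ^ (2 ^ n) + tvar else tvar ^ (2 ^ n + 1) + (1 :: 'a poly))"
proof (induction n rule: frob_rem.induct)
  case 2
  then show ?case by (simp add: cub_def eval_nat_numeral)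
next
  case (3 n)
  define z where "z = (tvar::'a poly) ^ (2 ^ n)"
  have z: "tvar ^ (2 ^ Suc n) = z ^ 2" "tvar ^ (2 ^ Suc (Suc n)) = z ^ 4"
    by (simp_all add: z_def mult.commute flip: power_mult)
  have "cub * (cub * frob_rem (Suc (Suc n)))
      = tvar * (cub * frob_rem (Suc n)) ^ 2 + (cub * frob_rem n) ^ 4"
    by (simp add: algebra_simps power2_eq_square power4_eq_xxxx)
  also have "\<dots> = cub * (if even n then z ^ 4 + tvar else z ^ 4 * tvar + 1)"
  proof (cases "even n")
    case True
    then have "cub * frob_rem (Suc n) = z\<^sup>2 * tvar + 1" "cub * frob_rem n = z + tvar"
      using 3 by (simp_all add: z_def mult.commute flip: power_mult)
    then show ?thesis
      using True by (simp only: poly_power2_add poly_power4_add)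
        (simp add: cub_def eval_nat_numeral algebra_simps)
  next
    case False
    then have "cub * frob_rem (Suc n) = z\<^sup>2 + tvar" "cub * frob_rem n = z * tvar + 1"
      using 3 by (simp_all add: z_def mult.commute flip: power_mult)
    then show ?thesis
      using False by (simp only: poly_power2_add poly_power4_add)
        (simp add: cub_def eval_nat_numeral algebra_simps)
  qed
  finally have "cub * frob_rem (Suc (Suc n)) = (if even n then z ^ 4 + tvar else z ^ 4 * tvar + 1)"
    by (simp only: mult_left_cancel[OF cub_neq_0])
  then show ?case
    by (simp only: z(2) power_add power_one_right even_Suc not_not)
qed simp

lemma cub_mult_obstruction:
  obtains r where "cub * obstruction \<alpha> (Suc j)
    = smult \<alpha> (tvar ^ eps (Suc j)) + cub * obstruction \<alpha> j ^ 2 + tvar ^ (2 ^ Suc j) * (r :: 'a poly)"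
proof -
  have "cub * obstruction \<alpha> (Suc j)
    = smult \<alpha> (tvar * (cub * frob_rem (Suc j))) + cub * obstruction \<alpha> j ^ 2"
    by (simp add: algebra_simps)
  moreover have "tvar * (cub * frob_rem (Suc j) :: 'a poly)
     = tvar ^ eps (Suc j) + tvar ^ (2 ^ Suc j) * (if even (Suc j) then tvar else tvar ^ 2)"
    unfolding cub_mult_frob_rem eps_def
    by (cases "even (Suc j)") (simp_all only: if_True if_False distrib_left power_add
        power_one_right power2_eq_square mult_1_right mult_1_left ac_simps)
  ultimately show ?thesis
    by (intro that[of "smult \<alpha> (if even (Suc j) then tvar else tvar ^ 2)"])
       (simp only: smult_add_right mult_smult_right ac_simps)
qed

lemma trace_sum_Suc: "trace_sum (\<alpha>::'a) (Suc n) = \<alpha> + trace_sum \<alpha> n ^ 2"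
proof -
  have "trace_sum \<alpha> n ^ 2 = (\<Sum>i<n. (\<alpha> ^ (2 ^ i)) ^ 2)"
    unfolding trace_sum_def
    by (rule freshmans_dream_sum) (simp_all only: char2 two_is_prime_nat)
  also have "\<dots> = (\<Sum>i<n. \<alpha> ^ (2 ^ Suc i))"
    by (intro sum.cong refl) (metis power_Suc2 power_mult)
  finally show ?thesis
    by (simp only: trace_sum_def sum.lessThan_Suc_shift power_0 power_one_right)
qed

end

section \<open>Pade approximants and their Frobenius recursion\<close>

text \<open>
  Thus \<open>u / S\<close> is a Pade approximant of the obstruction, to order \<open>2 ^ n\<close>.
\<close>

definition syzygy :: "'a::field \<Rightarrow> nat \<Rightarrow> 'a poly \<Rightarrow> 'a poly \<Rightarrow> bool" where
  "syzygy \<alpha> n S u \<longleftrightarrow> tvar ^ (2 ^ n) dvd S * obstruction \<alpha> n + u"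

text \<open>
  For fixed \<open>n\<close> the pairs \<open>(S, u)\<close> with \<open>syzygy \<alpha> n S u\<close> form a lattice of rank two over \<open>L[t]\<close>
  whose determinant is \<open>t ^ (2 ^ n)\<close>. By the condition on \<open>S1 * u2 + S2 * u1\<close>, two of its vectors are
  a basis as soon as the trace sum is nonzero. The residues of \<open>S1\<close> and \<open>S2\<close> at the cube roots
  of unity are normalised because the step to level \<open>j + 1\<close> is decided there.
\<close>

definition lattice_basis ::
    "'a::field \<Rightarrow> nat \<Rightarrow> 'a poly \<Rightarrow> 'a poly \<Rightarrow> 'a poly \<Rightarrow> 'a poly \<Rightarrow> bool" where
  "lattice_basis \<alpha> j S1 u1 S2 u2 \<longleftrightarrow>
     syzygy \<alpha> j S1 u1 \<and> syzygy \<alpha> j S2 u2 \<and>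
     cub dvd S1 + tvar ^ eps j \<and> cub dvd S2 + 1 \<and>
     S1 * u2 + S2 * u1 = smult (trace_sum \<alpha> j) (tvar ^ (2 ^ j)) \<and>
     (\<forall>p\<in>{S1, u1, S2, u2}. degree p \<le> 2 ^ (j - 1))"

context
  fixes ty :: "'a::field itself"
  assumes char2: "CHAR('a) = 2"
begin

declare char2_cancel [OF char2, simp]

lemma square_dvd_of_dvd:
  assumes "(d::'a poly) dvd x + y"
  shows "d\<^sup>2 dvd x\<^sup>2 + y\<^sup>2"
  using dvd_power_same[OF assms, of 2] by (simp add: poly_power2_add[OF char2])

lemma syzygy_square:
  assumes "syzygy (\<alpha>::'a) j S u"
  shows "tvar ^ (2 ^ Suc j) dvd S\<^sup>2 * (obstruction \<alpha> j)\<^sup>2 + u\<^sup>2"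
proof -
  have "(tvar ^ (2 ^ j))\<^sup>2 dvd (S * obstruction \<alpha> j)\<^sup>2 + u\<^sup>2"
    using assms unfolding syzygy_def by (rule square_dvd_of_dvd)
  moreover have "(tvar ^ (2 ^ j))\<^sup>2 = (tvar::'a poly) ^ (2 ^ Suc j)"
    by (simp add: mult.commute flip: power_mult)
  ultimately show ?thesis by (simp only: power_mult_distrib)
qed

text \<open>
  Multiplied by \<open>cub\<close>, the recursion of the obstruction reads
  \<open>cub H\<^sub>j\<^sub>+\<^sub>1 = \<alpha> t ^ eps (j + 1) + cub H\<^sub>j\<^sup>2\<close> modulo \<open>t ^ (2 ^ (j + 1))\<close>, where \<open>H\<^sub>j\<close> is the
  obstruction at level \<open>j\<close>. Up to factors \<open>cub\<close>,
  which are units for powers of \<open>t\<close>, the lattice at level \<open>j + 1\<close> is therefore the Frobenius twist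
  of the lattice at level \<open>j\<close> after a shear of \<open>u\<close>.
\<close>

lemma syzygy_Suc_iff:
  assumes b: "cub * u + smult \<alpha> (tvar ^ eps (Suc j)) * S = (b::'a poly)"
  shows "syzygy \<alpha> (Suc j) S u \<longleftrightarrow> tvar ^ (2 ^ Suc j) dvd (cub * S) * (obstruction \<alpha> j)\<^sup>2 + b"
proof -
  obtain r where r: "cub * obstruction \<alpha> (Suc j) = smult \<alpha> (tvar ^ eps (Suc j))
      + cub * obstruction \<alpha> j ^ 2 + tvar ^ (2 ^ Suc j) * (r :: 'a poly)"
    using cub_mult_obstruction[OF char2] by blast
  have "cub * (S * obstruction \<alpha> (Suc j) + u) = S * (cub * obstruction \<alpha> (Suc j)) + cub * u"
    by (simp only: distrib_left ac_simps)
  also have "\<dots> = ((cub * S) * (obstruction \<alpha> j)\<^sup>2 + b) + tvar ^ (2 ^ Suc j) * (S * r)"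
    unfolding r b[symmetric] by (simp only: distrib_left ac_simps)
  finally have *: "cub * (S * obstruction \<alpha> (Suc j) + u)
      = ((cub * S) * (obstruction \<alpha> j)\<^sup>2 + b) + tvar ^ (2 ^ Suc j) * (S * r)" .
  have "syzygy \<alpha> (Suc j) S u \<longleftrightarrow> tvar ^ (2 ^ Suc j) dvd cub * (S * obstruction \<alpha> (Suc j) + u)"
    unfolding syzygy_def using dvd_tvar_power_cub[OF char2] by (metis dvd_mult)
  then show ?thesis
    unfolding * by (metis dvd_add_left_iff dvd_triv_left)
qed

lemma frobenius_determinant:
  assumes "lattice_basis (\<alpha>::'a) j S1 u1 S2 u2"
  shows "S1\<^sup>2 * u2\<^sup>2 + S2\<^sup>2 * u1\<^sup>2 = smult ((trace_sum \<alpha> j)\<^sup>2) (tvar ^ (2 ^ Suc j))"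
proof -
  have "(S1 * u2 + S2 * u1)\<^sup>2 = (smult (trace_sum \<alpha> j) (tvar ^ (2 ^ j)))\<^sup>2"
    using assms by (simp add: lattice_basis_def)
  then show ?thesis
    by (simp only: poly_power2_add[OF char2] power_mult_distrib smult_power)
       (simp add: mult.commute flip: power_mult)
qed

text \<open>
  Squaring improves the normalisation of \<open>S1\<close> and \<open>S2\<close> from \<open>cub\<close> to \<open>cub\<^sup>2\<close>, which determines the
  quotient \<open>S\<close> modulo \<open>cub\<close>. The \<open>u\<close>-components are not normalised, but the determinant expresses
  \<open>u1\<^sup>2\<close> through \<open>u2\<^sup>2\<close> modulo \<open>cub\<close>, and the hypothesis on \<open>f\<close> and \<open>g\<close> makes \<open>u2\<^sup>2\<close> cancel.
\<close>

lemma lattice_combination_mod_cub: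
  assumes B: "lattice_basis (\<alpha>::'a) j S1 u1 S2 u2"
    and R: "f * tvar ^ (2 * eps j) + g = cub * R"
  obtains S where "f * S1\<^sup>2 + g * S2\<^sup>2 = cub * S" "cub dvd S + R"
    "cub dvd (f * u1\<^sup>2 + g * u2\<^sup>2) + f * smult ((trace_sum \<alpha> j)\<^sup>2) (tvar ^ (2 ^ Suc j))"
proof -
  have "cub\<^sup>2 dvd S1\<^sup>2 + (tvar ^ eps j)\<^sup>2" "cub\<^sup>2 dvd S2\<^sup>2 + 1\<^sup>2"
    using B by (auto simp only: lattice_basis_def intro!: square_dvd_of_dvd)
  then obtain c1 c2 where c: "S1\<^sup>2 + (tvar ^ eps j)\<^sup>2 = cub\<^sup>2 * c1" "S2\<^sup>2 + 1\<^sup>2 = cub\<^sup>2 * c2"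
    by (auto elim!: dvdE)
  define a1 b1 a2 b2 where ab: "a1 = S1\<^sup>2" "b1 = u1\<^sup>2" "a2 = S2\<^sup>2" "b2 = u2\<^sup>2"
  define d where "d = smult ((trace_sum \<alpha> j)\<^sup>2) (tvar ^ (2 ^ Suc j))"
  define x where "x = (tvar::'a poly) ^ (2 * eps j)"
  have a: "a1 = x + cub\<^sup>2 * c1" "a2 = 1 + cub\<^sup>2 * c2"
    unfolding ab c[symmetric] x_def by (simp_all add: algebra_simps flip: power_mult)
  have D: "d = a1 * b2 + a2 * b1"
    unfolding ab d_def by (rule frobenius_determinant[OF B, symmetric])
  have b1: "b1 = d + x * b2 + cub * (cub * c1 * b2 + cub * c2 * b1)"
    unfolding D a by (simp add: algebra_simps power2_eq_square)
  have g: "g = f * x + cub * R"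
    unfolding R[symmetric] x_def by simp
  show ?thesis
  proof (rule that[of "R + cub * (f * c1 + g * c2)", folded ab d_def])
    show "f * a1 + g * a2 = cub * (R + cub * (f * c1 + g * c2))"
      unfolding a g by (simp add: algebra_simps power2_eq_square)
    show "cub dvd (f * b1 + g * b2) + f * d"
      by (subst b1, unfold g) (simp add: algebra_simps)
    show "cub dvd R + cub * (f * c1 + g * c2) + R"
      by (simp add: algebra_simps)
  qed
qed

text \<open>
  A combination of the squared basis vectors descends to a vector of the next level under two
  divisibilities by \<open>cub\<close>, one for each component.
\<close>

lemma lattice_lift:
  assumes B: "lattice_basis (\<alpha>::'a) j S1 u1 S2 u2"
    and R: "f * tvar ^ (2 * eps j) + g = cub * R"
    and cond: "cub dvd f * smult ((trace_sum \<alpha> j)\<^sup>2) (tvar ^ (2 ^ Suc j))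
      + smult \<alpha> (tvar ^ eps (Suc j)) * R"
  obtains S u where "cub * S = f * S1\<^sup>2 + g * S2\<^sup>2"
    "cub * u = f * u1\<^sup>2 + g * u2\<^sup>2 + smult \<alpha> (tvar ^ eps (Suc j)) * S"
    "cub dvd S + R" "syzygy \<alpha> (Suc j) S u"
proof -
  define d where "d = smult ((trace_sum \<alpha> j)\<^sup>2) (tvar ^ (2 ^ Suc j))"
  define e where "e = smult \<alpha> (tvar ^ eps (Suc j))"
  obtain S where S: "f * S1\<^sup>2 + g * S2\<^sup>2 = cub * S" "cub dvd S + R"
    "cub dvd (f * u1\<^sup>2 + g * u2\<^sup>2) + f * d"
    unfolding d_def using lattice_combination_mod_cub[OF B R] by blast
  have "cub dvd ((f * u1\<^sup>2 + g * u2\<^sup>2) + f * d) + (f * d + e * R) + e * (S + R)"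
    by (rule dvd_add[OF dvd_add[OF S(3)] dvd_mult[OF S(2)]]) (use cond in \<open>simp only: d_def e_def\<close>)
  also have "\<dots> = (f * u1\<^sup>2 + g * u2\<^sup>2) + e * S"
    by (simp add: algebra_simps)
  finally obtain u where u: "(f * u1\<^sup>2 + g * u2\<^sup>2) + e * S = cub * u" ..
  have "tvar ^ (2 ^ Suc j) dvd f * (S1\<^sup>2 * (obstruction \<alpha> j)\<^sup>2 + u1\<^sup>2) + g * (S2\<^sup>2 * (obstruction \<alpha> j)\<^sup>2 + u2\<^sup>2)"
    using B by (intro dvd_add dvd_mult syzygy_square) (auto simp: lattice_basis_def)
  also have "\<dots> = (cub * S) * (obstruction \<alpha> j)\<^sup>2 + (f * u1\<^sup>2 + g * u2\<^sup>2)"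
    unfolding S(1)[symmetric] by (simp add: algebra_simps)
  finally have "syzygy \<alpha> (Suc j) S u"
    by (subst syzygy_Suc_iff[of _ _ _ _ "f * u1\<^sup>2 + g * u2\<^sup>2"])
       (simp_all add: e_def[symmetric] u[symmetric] algebra_simps)
  then show ?thesis
    using that[of S u] S u by (simp add: e_def)
qed

text \<open>
  Conversely every short vector of level \<open>j + 1\<close> arises from such a combination. The coefficients
  come from Cramer's rule, and both determinants in it are divisible by \<open>t ^ (2 ^ (j + 1))\<close>; comparing
  degrees leaves quadratic \<open>f\<close> and \<open>g\<close>.
\<close>

lemma lattice_coordinates:
  assumes B: "lattice_basis (\<alpha>::'a) j S1 u1 S2 u2" and j: "j \<ge> 1"
    and T: "trace_sum \<alpha> j \<noteq> 0"
    and s: "syzygy \<alpha> (Suc j) S u" and deg: "degree S < 2 ^ j" "degree u < 2 ^ j"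
  obtains f g R where "cub * S = f * S1\<^sup>2 + g * S2\<^sup>2"
    "degree f \<le> 2" "degree g \<le> 2" "f * tvar ^ (2 * eps j) + g = cub * R"
    "cub dvd f * smult ((trace_sum \<alpha> j)\<^sup>2) (tvar ^ (2 ^ Suc j))
      + smult \<alpha> (tvar ^ eps (Suc j)) * R"
proof -
  define d where "d = smult ((trace_sum \<alpha> j)\<^sup>2) (tvar ^ (2 ^ Suc j) :: 'a poly)"
  define e where "e = smult \<alpha> (tvar ^ eps (Suc j) :: 'a poly)"
  define a b where "a = cub * S" and "b = cub * u + e * S"
  define h where "h = (obstruction \<alpha> j)\<^sup>2"
  have d0: "d \<noteq> 0" using T by (simp add: d_def)
  have ddvd: "d dvd p" if "tvar ^ (2 ^ Suc j) dvd p" for p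
    using that T by (simp add: d_def smult_dvd_iff)
  have dd: "degree d = 2 * 2 ^ j"
    using T by (simp add: d_def)
  have D: "a1 * b2 + a2 * b1 = d" if "a1 = S1\<^sup>2" "b1 = u1\<^sup>2" "a2 = S2\<^sup>2" "b2 = u2\<^sup>2" for a1 b1 a2 b2
    unfolding that d_def by (rule frobenius_determinant[OF B])
  have M: "d dvd a * h + b"
    unfolding a_def b_def h_def using s unfolding e_def by (intro ddvd) (simp add: syzygy_Suc_iff)
  have deg_ab: "degree a < 2 ^ j + 3" "degree b < 2 ^ j + 3"
  proof -
    have *: "degree (cub * p) < 2 ^ j + 3" if "degree p < 2 ^ j" for p :: "'a poly"
      using degree_mult_le[of cub p] that by simp
    show "degree a < 2 ^ j + 3" using * deg by (simp add: a_def)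
    have "degree e \<le> 2" unfolding e_def by (rule order.trans[OF degree_smult_le]) (simp add: eps_def)
    then have "degree (e * S) < 2 ^ j + 3"
      using degree_mult_le[of e S] deg by linarith
    then show "degree b < 2 ^ j + 3"
      unfolding b_def using *[OF deg(2)] by (intro degree_add_less)
  qed
  have ex: "\<exists>q. a * p\<^sup>2 + b * r\<^sup>2 = d * q \<and> degree q \<le> 2"
    if "syzygy \<alpha> j r p" "degree p \<le> 2 ^ (j - 1)" "degree r \<le> 2 ^ (j - 1)" for p r
  proof -
    have "d dvd (a * h + b) * r\<^sup>2 + a * (r\<^sup>2 * h + p\<^sup>2)"
      by (rule dvd_add[OF dvd_mult2[OF M] dvd_mult[OF ddvd[OF syzygy_square[OF that(1), folded h_def]]]])
    also have "\<dots> = a * p\<^sup>2 + b * r\<^sup>2"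
      by (simp add: algebra_simps)
    finally obtain q where q: "a * p\<^sup>2 + b * r\<^sup>2 = d * q" ..
    have sq: "degree (x * y\<^sup>2) < 2 * 2 ^ j + 3"
      if "degree x < 2 ^ j + 3" "degree y \<le> 2 ^ (j - 1)" for x y :: "'a poly"
    proof -
      have "2 * 2 ^ (j - 1) = (2::nat) ^ j" using j by (cases j) auto
      moreover have "degree (y\<^sup>2) \<le> 2 * degree y"
        by (metis degree_power_le mult.commute)
      ultimately show ?thesis
        using that degree_mult_le[of x "y\<^sup>2"] by linarith
    qed
    have "degree (d * q) < 2 * 2 ^ j + 3"
      unfolding q[symmetric] using sq[OF deg_ab(1) that(2)] sq[OF deg_ab(2) that(3)]
      by (intro degree_add_less)
    then have "degree q \<le> 2"
      using d0 dd by (cases "q = 0") (auto simp: degree_mult_eq)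
    with q show ?thesis by blast
  qed
  \<comment> \<open>Cramer's rule for \<open>(a, b)\<close> in the squared basis, whose determinant is \<open>d\<close>.\<close>
  obtain f where f: "a * u2\<^sup>2 + b * S2\<^sup>2 = d * f" "degree f \<le> 2"
    using ex[of S2 u2] B by (auto simp: lattice_basis_def)
  obtain g where g: "a * u1\<^sup>2 + b * S1\<^sup>2 = d * g" "degree g \<le> 2"
    using ex[of S1 u1] B by (auto simp: lattice_basis_def)
  have "d * (f * S1\<^sup>2 + g * S2\<^sup>2) = d * a"
  proof -
    have "d * (f * S1\<^sup>2 + g * S2\<^sup>2) = (a * u2\<^sup>2 + b * S2\<^sup>2) * S1\<^sup>2 + (a * u1\<^sup>2 + b * S1\<^sup>2) * S2\<^sup>2"
      unfolding f g by (simp add: algebra_simps)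
    also have "\<dots> = (S1\<^sup>2 * u2\<^sup>2 + S2\<^sup>2 * u1\<^sup>2) * a"
      by (simp add: algebra_simps)
    finally show ?thesis using D by simp
  qed
  then have fa: "cub * S = f * S1\<^sup>2 + g * S2\<^sup>2" using d0 by (simp add: a_def)
  have "d * (f * u1\<^sup>2 + g * u2\<^sup>2) = d * b"
  proof -
    have "d * (f * u1\<^sup>2 + g * u2\<^sup>2) = (a * u2\<^sup>2 + b * S2\<^sup>2) * u1\<^sup>2 + (a * u1\<^sup>2 + b * S1\<^sup>2) * u2\<^sup>2"
      unfolding f g by (simp add: algebra_simps)
    also have "\<dots> = (S1\<^sup>2 * u2\<^sup>2 + S2\<^sup>2 * u1\<^sup>2) * b"
      by (simp add: algebra_simps)
    finally show ?thesis using D by simp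
  qed
  then have fb: "cub * u + e * S = f * u1\<^sup>2 + g * u2\<^sup>2" using d0 by (simp add: b_def)
  have "cub dvd f * tvar ^ (2 * eps j) + g"
  proof -
    have "cub\<^sup>2 dvd S1\<^sup>2 + (tvar ^ eps j)\<^sup>2" "cub\<^sup>2 dvd S2\<^sup>2 + 1\<^sup>2"
      using B by (auto simp only: lattice_basis_def intro!: square_dvd_of_dvd)
    then have "cub dvd S1\<^sup>2 + (tvar ^ eps j)\<^sup>2" "cub dvd S2\<^sup>2 + 1"
      by (auto simp: power2_eq_square intro: dvd_mult_left)
    then have "cub dvd f * (S1\<^sup>2 + (tvar ^ eps j)\<^sup>2) + g * (S2\<^sup>2 + 1) + cub * S"
      by (meson dvd_add dvd_mult dvd_triv_left)
    also have "\<dots> = f * tvar ^ (2 * eps j) + g"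
      unfolding fa by (simp add: algebra_simps flip: power_mult)
    finally show ?thesis .
  qed
  then obtain R where R: "f * tvar ^ (2 * eps j) + g = cub * R" ..
  obtain S' where S': "f * S1\<^sup>2 + g * S2\<^sup>2 = cub * S'" "cub dvd S' + R"
    "cub dvd (f * u1\<^sup>2 + g * u2\<^sup>2) + f * d"
    unfolding d_def using lattice_combination_mod_cub[OF B R] by blast
  have "S' = S" using S'(1) fa by simp
  then have "cub dvd ((f * u1\<^sup>2 + g * u2\<^sup>2) + f * d) + e * (S + R) + cub * u"
    using S' by (meson dvd_add dvd_mult dvd_triv_left)
  also have "\<dots> = f * d + e * R"
    unfolding fb[symmetric] by (simp add: algebra_simps)
  finally show ?thesis
    using that[of f g R] fa f g R by (simp add: d_def e_def)
qed

end

lemma two_power_mod_3: "(2::nat) ^ n mod 3 = (if even n then 1 else 2)"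
proof (induction n)
  case (Suc n)
  have "2 ^ Suc n mod 3 = 2 * (2 ^ n mod 3) mod (3::nat)"
    by (simp add: mod_mult_right_eq)
  with Suc show ?case by simp
qed simp

context
  fixes ty :: "'a::field itself"
  assumes char2: "CHAR('a) = 2"
begin

declare char2_cancel [OF char2, simp]

text \<open>
  The determinant of two lifted vectors is the determinant of the coefficients \<open>f\<close>, \<open>g\<close>, \<open>f'\<close>, \<open>g'\<close>
  times the squared old determinant, divided by \<open>cub\<^sup>2\<close>; the shears cancel.
\<close>

lemma lattice_basis_step:
  assumes B: "lattice_basis (\<alpha>::'a) j S1 u1 S2 u2" and j: "j \<ge> 1"
    and R: "f * tvar ^ (2 * eps j) + g = cub * R"
    and cond: "cub dvd f * smult ((trace_sum \<alpha> j)\<^sup>2) (tvar ^ (2 ^ Suc j))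
      + smult \<alpha> (tvar ^ eps (Suc j)) * R"
    and R': "f' * tvar ^ (2 * eps j) + g' = cub * R'"
    and cond': "cub dvd f' * smult ((trace_sum \<alpha> j)\<^sup>2) (tvar ^ (2 ^ Suc j))
      + smult \<alpha> (tvar ^ eps (Suc j)) * R'"
    and "cub dvd R + tvar ^ eps (Suc j)" "cub dvd R' + 1"
    and det: "smult ((trace_sum \<alpha> j)\<^sup>2) (f * g' + f' * g) = smult (trace_sum \<alpha> (Suc j)) (cub\<^sup>2)"
    and deg: "degree f \<le> 3" "degree g \<le> 3" "degree f' \<le> 3" "degree g' \<le> 3"
  shows "\<exists>S1 u1 S2 u2. lattice_basis \<alpha> (Suc j) S1 u1 S2 u2"
proof -
  obtain S u where S: "cub * S = f * S1\<^sup>2 + g * S2\<^sup>2"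
    "cub * u = f * u1\<^sup>2 + g * u2\<^sup>2 + smult \<alpha> (tvar ^ eps (Suc j)) * S"
    "cub dvd S + R" "syzygy \<alpha> (Suc j) S u"
    using lattice_lift[OF char2 B R cond] by blast
  obtain S' u' where S': "cub * S' = f' * S1\<^sup>2 + g' * S2\<^sup>2"
    "cub * u' = f' * u1\<^sup>2 + g' * u2\<^sup>2 + smult \<alpha> (tvar ^ eps (Suc j)) * S'"
    "cub dvd S' + R'" "syzygy \<alpha> (Suc j) S' u'"
    using lattice_lift[OF char2 B R' cond'] by blast
  have dsq: "degree (x * p\<^sup>2 + y * q\<^sup>2) \<le> 3 + 2 ^ j"
    if "degree x \<le> 3" "degree y \<le> 3" "degree p \<le> 2 ^ (j - 1)" "degree q \<le> 2 ^ (j - 1)"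
    for x y p q :: "'a poly"
  proof -
    have "2 * 2 ^ (j - 1) = (2::nat) ^ j" using j by (cases j) auto
    moreover have "degree (p\<^sup>2) \<le> 2 * degree p" "degree (q\<^sup>2) \<le> 2 * degree q"
      by (metis degree_power_le mult.commute)+
    ultimately have "degree (x * p\<^sup>2) \<le> 3 + 2 ^ j" "degree (y * q\<^sup>2) \<le> 3 + 2 ^ j"
      using that degree_mult_le[of x "p\<^sup>2"] degree_mult_le[of y "q\<^sup>2"] by linarith+
    then show ?thesis by (rule degree_add_le)
  qed
  have dcub: "degree p \<le> 2 ^ j" if "degree (cub * p) \<le> 3 + 2 ^ j" for p :: "'a poly"
    using that by (cases "p = 0") (simp_all add: degree_mult_eq)
  have de: "degree (smult \<alpha> (tvar ^ eps (Suc j)) * p) \<le> 3 + 2 ^ j"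
    if "degree p \<le> 2 ^ j" for p :: "'a poly"
  proof -
    have "degree (smult \<alpha> (tvar ^ eps (Suc j))) \<le> 2"
      by (rule order.trans[OF degree_smult_le]) (simp add: eps_def)
    with that show ?thesis
      using degree_mult_le[of "smult \<alpha> (tvar ^ eps (Suc j))" p] by linarith
  qed
  have bd: "degree S1 \<le> 2 ^ (j - 1)" "degree S2 \<le> 2 ^ (j - 1)"
    "degree u1 \<le> 2 ^ (j - 1)" "degree u2 \<le> 2 ^ (j - 1)"
    using B unfolding lattice_basis_def by auto
  have dS: "degree S \<le> 2 ^ j"
    by (rule dcub) (unfold S(1), rule dsq[OF deg(1,2) bd(1,2)])
  have dS': "degree S' \<le> 2 ^ j"
    by (rule dcub) (unfold S'(1), rule dsq[OF deg(3,4) bd(1,2)])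
  have "degree u \<le> 2 ^ j"
    by (rule dcub) (unfold S(2), rule degree_add_le[OF dsq[OF deg(1,2) bd(3,4)] de[OF dS]])
  moreover have "degree u' \<le> 2 ^ j"
    by (rule dcub) (unfold S'(2), rule degree_add_le[OF dsq[OF deg(3,4) bd(3,4)] de[OF dS']])
  moreover have "cub dvd (S + R) + (R + tvar ^ eps (Suc j))" "cub dvd (S' + R') + (R' + 1)"
    using S S' assms by (meson dvd_add)+
  then have "cub dvd S + tvar ^ eps (Suc j)" "cub dvd S' + 1"
    by (simp_all add: algebra_simps)
  moreover have "S * u' + S' * u = smult (trace_sum \<alpha> (Suc j)) (tvar ^ (2 ^ Suc j))"
  proof -
    define e where "e = smult \<alpha> (tvar ^ eps (Suc j))"
    define T where "T = [:(trace_sum \<alpha> j)\<^sup>2:]"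
    define x where "x = (tvar :: 'a poly) ^ (2 ^ Suc j)"
    have D: "S1\<^sup>2 * u2\<^sup>2 + S2\<^sup>2 * u1\<^sup>2 = T * x"
      unfolding T_def x_def using frobenius_determinant[OF char2 B] by simp
    have "cub\<^sup>2 * (S * u' + S' * u)
      = (cub * S) * (cub * u' + e * S') + (cub * S') * (cub * u + e * S)"
      by (simp add: algebra_simps power2_eq_square)
    also have "\<dots> = (f * S1\<^sup>2 + g * S2\<^sup>2) * (f' * u1\<^sup>2 + g' * u2\<^sup>2)
        + (f' * S1\<^sup>2 + g' * S2\<^sup>2) * (f * u1\<^sup>2 + g * u2\<^sup>2)"
      unfolding S(1,2) S'(1,2) e_def[symmetric] by (simp add: add.assoc)
    also have "\<dots> = (f * g' + f' * g) * (S1\<^sup>2 * u2\<^sup>2 + S2\<^sup>2 * u1\<^sup>2)"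
      by (simp add: algebra_simps)
    also have "\<dots> = smult ((trace_sum \<alpha> j)\<^sup>2) (f * g' + f' * g) * x"
      unfolding D T_def by (simp add: algebra_simps)
    also have "\<dots> = cub\<^sup>2 * smult (trace_sum \<alpha> (Suc j)) x"
      unfolding det by simp
    finally show ?thesis unfolding x_def
      by (metis cub_neq_0 mult_left_cancel power_not_zero)
  qed
  ultimately have "lattice_basis \<alpha> (Suc j) S u S' u'"
    using dS dS' S(4) S'(4) by (simp add: lattice_basis_def)
  then show ?thesis by blast
qed

text \<open>
  The coefficients of the two lifted vectors, as they are used in the step below with
  \<open>D = \<alpha> / T\<^sub>j\<^sup>2\<close>, where \<open>T\<^sub>j\<close> is the trace sum; then \<open>1 + D = T\<^sub>j\<^sub>+\<^sub>1 / T\<^sub>j\<^sup>2\<close>. The first four identities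
  and the ninth serve an odd new level, the others an even one.
\<close>

lemma lattice_step_identities:
  fixes D K x :: "'a poly"
  shows
    "(1 + (1 + D) * tvar ^ 3) * tvar ^ (2 * 2) + D * tvar ^ 1
      = cub * (tvar + (1 + D) * tvar * cub)"
    "(1 + (1 + D) * tvar ^ 3) * (K * x) + K * D * tvar ^ 1 * (tvar + (1 + D) * tvar * cub)
      = (K * D * x + K * D * tvar ^ 2) + cub * (K * (1 + D) * x + K * D * (1 + D) * tvar ^ 2)"
    "D * tvar ^ 2 * tvar ^ (2 * 2) + ((1 + D) + tvar ^ 3) = cub * (1 + D * cub)"
    "D * tvar ^ 2 * (K * x) + K * D * tvar ^ 1 * (1 + D * cub)
      = (K * D * tvar ^ 2 * x + K * D * tvar ^ 2 * tvar ^ 2) + cub * (K * D * tvar + K * D * D * tvar)"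
    "((1 + D) + tvar ^ 3) * tvar ^ (2 * 1) + D * tvar ^ 2 = cub * tvar ^ 2"
    "((1 + D) + tvar ^ 3) * (K * x) + K * D * tvar ^ 2 * tvar ^ 2
      = (K * D * x + K * D * tvar ^ 1) + cub * (K * x + K * D * tvar)"
    "D * tvar ^ 1 * tvar ^ (2 * 1) + (1 + (1 + D) * tvar ^ 3) = cub * 1"
    "D * tvar ^ 1 * (K * x) + K * D * tvar ^ 2 * 1 = K * D * tvar * x + K * D * tvar * tvar ^ 1"
    "(1 + (1 + D) * tvar ^ 3) * ((1 + D) + tvar ^ 3) + D * tvar ^ 2 * (D * tvar ^ 1)
      = (1 + D) * cub\<^sup>2"
    "((1 + D) + tvar ^ 3) * (1 + (1 + D) * tvar ^ 3) + D * tvar ^ 1 * (D * tvar ^ 2)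
      = (1 + D) * cub\<^sup>2"
  by (simp add: cub_def eval_nat_numeral algebra_simps)+

lemma lattice_basis_Suc:
  assumes B: "lattice_basis (\<alpha>::'a) j S1 u1 S2 u2" and j: "j \<ge> 1"
    and T: "trace_sum \<alpha> j \<noteq> 0"
  shows "\<exists>S1 u1 S2 u2. lattice_basis \<alpha> (Suc j) S1 u1 S2 u2"
proof -
  define k where "k = (trace_sum \<alpha> j)\<^sup>2"
  have k: "k \<noteq> 0" using T by (simp add: k_def)
  define C D K where "C = [:1 + \<alpha> / k:]" and "D = [:\<alpha> / k:]" and "K = [:k:]"
  have sK: "smult k p = K * p" for p by (simp add: K_def)
  have KD: "smult \<alpha> p = K * D * p" for p using k by (simp add: K_def D_def)
  have "trace_sum \<alpha> (Suc j) = k * (1 + \<alpha> / k)"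
    unfolding trace_sum_Suc[OF char2] k_def[symmetric] using k by (simp add: field_simps)
  then have KC: "smult (trace_sum \<alpha> (Suc j)) p = K * C * p" for p
    by (simp add: K_def C_def mult.commute)
  have C: "C = 1 + D" by (simp add: C_def D_def one_pCons)
  have [simp]: "degree C = 0" "degree D = 0" by (simp_all add: C_def D_def)
  define x where "x = (tvar::'a poly) ^ (2 ^ Suc j)"
  have dx: "cub dvd p * x + p * tvar ^ (if even j then 2 else 1)" for p
  proof -
    have "cub dvd x + tvar ^ (if even j then 2 else 1)"
      unfolding x_def using two_power_mod_3[of "Suc j"]
      by (intro cub_dvd_tvar_power_add[OF char2]) simp
    then show ?thesis by (simp flip: distrib_left)
  qed
  have deg: "degree (p * tvar ^ i) \<le> 3" if "degree p = 0" "i \<le> 3" for p :: "'a poly" and i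
    using that degree_mult_le[of p "tvar ^ i"] by simp
  have deg': "degree (p + q * tvar ^ i) \<le> 3"
    if "degree p = 0" "degree q = 0" "i \<le> 3" for p q :: "'a poly" and i
    using that deg by (intro degree_add_le) auto
  note ids = lattice_step_identities[of D, folded C]
  show ?thesis
  proof (cases "even j")
    case True
    then have e: "eps j = 2" "eps (Suc j) = 1" by (simp_all add: eps_def)
    show ?thesis
    proof (rule lattice_basis_step[OF B j, unfolded e, folded k_def x_def, unfolded KD KC sK,
          OF ids(1) _ ids(3)])
      show "cub dvd (1 + C * tvar ^ 3) * (K * x) + K * D * tvar ^ 1 * (tvar + C * tvar * cub)"
        unfolding ids(2) by (rule dvd_add) (use dx[of "K * D"] True in simp_all)
      show "cub dvd D * tvar ^ 2 * (K * x) + K * D * tvar ^ 1 * (1 + D * cub)"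
        unfolding ids(4) by (rule dvd_add) (use dx[of "K * D * tvar ^ 2"] True in simp_all)
      show "cub dvd tvar + C * tvar * cub + tvar ^ 1"
        by (simp add: add.left_commute[of tvar] add.commute[of tvar] add.assoc)
      show "cub dvd 1 + D * cub + 1"
        by (simp add: add.commute[of 1] add.assoc)
      show "K * ((1 + C * tvar ^ 3) * (C + tvar ^ 3) + D * tvar ^ 2 * (D * tvar ^ 1))
        = K * C * cub\<^sup>2"
        unfolding ids(9) by (simp only: mult.assoc)
    qed (intro degree_add_le deg; simp add: deg[of C 0] deg[of 1 3, simplified] deg[of 1 0, simplified])+
  next
    case False
    then have e: "eps j = 1" "eps (Suc j) = 2" by (simp_all add: eps_def)
    show ?thesis
    proof (rule lattice_basis_step[OF B j, unfolded e, folded k_def x_def, unfolded KD KC sK,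
          OF ids(5) _ ids(7)])
      show "cub dvd (C + tvar ^ 3) * (K * x) + K * D * tvar ^ 2 * tvar ^ 2"
        unfolding ids(6) by (rule dvd_add) (use dx[of "K * D"] False in simp_all)
      show "cub dvd D * tvar ^ 1 * (K * x) + K * D * tvar ^ 2 * 1"
        unfolding ids(8) using dx[of "K * D * tvar"] False by (simp only: if_False)
      show "cub dvd tvar ^ 2 + (tvar ^ 2 :: 'a poly)" by simp
      show "cub dvd 1 + (1 :: 'a poly)" by simp
      show "K * ((C + tvar ^ 3) * (1 + C * tvar ^ 3) + D * tvar ^ 1 * (D * tvar ^ 2))
        = K * C * cub\<^sup>2"
        unfolding ids(10) by (simp only: mult.assoc)
    qed (intro degree_add_le deg; simp add: deg[of C 0] deg[of 1 3, simplified] deg[of 1 0, simplified])+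
  qed
qed

lemma lattice_basis_exists:
  assumes "j \<ge> 1" "\<And>i. 1 \<le> i \<Longrightarrow> i < j \<Longrightarrow> trace_sum (\<alpha>::'a) i \<noteq> 0"
  shows "\<exists>S1 u1 S2 u2. lattice_basis \<alpha> j S1 u1 S2 u2"
  using assms
proof (induction j rule: nat_induct_at_least)
  case base
  have "lattice_basis \<alpha> 1 tvar 0 1 (smult \<alpha> tvar)"
    by (simp add: lattice_basis_def syzygy_def eps_def trace_sum_def power2_eq_square dvd_smult)
  then show ?case by blast
next
  case (Suc j)
  then obtain S1 u1 S2 u2 where "lattice_basis \<alpha> j S1 u1 S2 u2" by auto
  then show ?case
    by (rule lattice_basis_Suc) (use Suc in auto)
qed

end

section \<open>The first vanishing trace sum\<close>

lemma cub_dvd_small: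
  assumes "cub dvd (p::'a::field poly)" "degree p < 3"
  shows "p = 0"
  using assms dvd_imp_degree_le[of cub p] by (cases "p = 0") auto

lemma quadratic_poly_eq: "[:a, b, c:] = [:a:] + [:b:] * tvar + [:c:] * (tvar ^ 2 :: 'a::field poly)"
  by (simp add: tvar_def power2_eq_square)

lemma degree_le_2_cases:
  assumes "degree (p::'a::field poly) \<le> 2"
  obtains a b c where "p = [:a, b, c:]"
proof
  show "p = [:coeff p 0, coeff p 1, coeff p 2:]"
    using assms by (intro poly_eqI) (auto simp: coeff_pCons coeff_eq_0 numeral_2_eq_2 split: nat.splits)
qed

context
  fixes ty :: "'a::field itself"
  assumes char2: "CHAR('a) = 2"
begin

declare char2_cancel [OF char2, simp]

text \<open>
  If the trace sum of the new level vanishes, then \<open>\<alpha>\<close> is the square \<open>k\<close> of the preceding one.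
  Modulo \<open>cub\<close> the first divisibility determines \<open>g\<close> from \<open>f\<close>, and the second one then removes one of
  the three coefficients of \<open>f\<close>.
\<close>

lemma small_coordinates_odd:
  assumes al: "\<alpha> = (k::'a)" "k \<noteq> 0" and deg: "degree f \<le> 2" "degree g \<le> 2"
    and R: "f * tvar ^ 4 + g = cub * R"
    and x: "cub dvd x + tvar ^ 2"
    and cond: "cub dvd f * smult k x + smult \<alpha> (tvar ^ 1) * R"
  obtains a b where "f = [:a, b:]" "g = [:a, b:] * tvar"
proof -
  obtain a b c where f: "f = [:a, b, c:]" using degree_le_2_cases[OF deg(1)] .
  define A B C where "A = [:a:]" "B = [:b:]" "C = [:c:]"
  have F: "f = A + B * tvar + C * tvar ^ 2"
    unfolding f A_B_C_def by (rule quadratic_poly_eq)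
  have q: "[:c, a, b:] = C + A * tvar + B * tvar ^ 2"
    unfolding A_B_C_def by (rule quadratic_poly_eq)
  have *: "f * tvar ^ 4 + [:c, a, b:] = cub * (f * tvar + C)"
    unfolding q F
    by (simp add: cub_def eval_nat_numeral algebra_simps)
  have "(f * tvar ^ 4 + g) + (f * tvar ^ 4 + [:c, a, b:]) = cub * (R + f * tvar + C)"
    unfolding R * by (simp only: distrib_left add.assoc)
  then have "cub dvd (f * tvar ^ 4 + g) + (f * tvar ^ 4 + [:c, a, b:])" by simp
  then have "cub dvd g + [:c, a, b:]" by (simp add: algebra_simps)
  moreover have "degree (g + [:c, a, b:]) < 3"
    using deg by (intro degree_add_less) (auto split: if_splits)
  ultimately have "g + [:c, a, b:] = 0" by (rule cub_dvd_small)
  then have g: "g = [:c, a, b:]" by (metis poly_eq_iff_add[OF char2])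
  have R: "R = f * tvar + C"
    using R * g by (metis cub_neq_0 mult_left_cancel)
  have "f * smult k x + smult \<alpha> (tvar ^ 1) * R
      = smult k (f * (x + tvar ^ 2)) + smult (k * c) tvar"
    unfolding R al(1) A_B_C_def by (simp add: smult_add_right algebra_simps power2_eq_square)
  then have "cub dvd smult (k * c) tvar"
    using cond x by (metis dvd_add_right_iff dvd_mult dvd_smult)
  then have "smult (k * c) tvar = (0 :: 'a poly)"
    by (rule cub_dvd_small) (rule le_less_trans[OF degree_smult_le], simp)
  then have "c = 0" using al by simp
  then show ?thesis
    using f g by (intro that[of a b]) (auto simp: tvar_def)
qed

lemma small_coordinates_even:
  assumes al: "\<alpha> = (k::'a)" "k \<noteq> 0" and deg: "degree f \<le> 2" "degree g \<le> 2"
    and R: "f * tvar ^ 2 + g = cub * R"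
    and x: "cub dvd x + tvar"
    and cond: "cub dvd f * smult k x + smult \<alpha> (tvar ^ 2) * R"
  obtains a b where "f = [:a, b:] * tvar" "g = [:a, b:]"
proof -
  obtain a b c where f: "f = [:a, b, c:]" using degree_le_2_cases[OF deg(1)] .
  define A B C where "A = [:a:]" "B = [:b:]" "C = [:c:]"
  have F: "f = A + B * tvar + C * tvar ^ 2"
    unfolding f A_B_C_def by (rule quadratic_poly_eq)
  have q: "[:b, c, a:] = B + C * tvar + A * tvar ^ 2"
    unfolding A_B_C_def by (rule quadratic_poly_eq)
  have *: "f * tvar ^ 2 + [:b, c, a:] = cub * (B + C * tvar)"
    unfolding q F
    by (simp add: cub_def eval_nat_numeral algebra_simps)
  have "(f * tvar ^ 2 + g) + (f * tvar ^ 2 + [:b, c, a:]) = cub * (R + (B + C * tvar))"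
    unfolding R * by (simp only: distrib_left add.assoc)
  then have "cub dvd (f * tvar ^ 2 + g) + (f * tvar ^ 2 + [:b, c, a:])" by simp
  then have "cub dvd g + [:b, c, a:]" by (simp add: algebra_simps)
  moreover have "degree (g + [:b, c, a:]) < 3"
    using deg by (intro degree_add_less) (auto split: if_splits)
  ultimately have "g + [:b, c, a:] = 0" by (rule cub_dvd_small)
  then have g: "g = [:b, c, a:]" by (metis poly_eq_iff_add[OF char2])
  have R: "R = B + C * tvar"
    using R * g by (metis cub_neq_0 mult_left_cancel)
  have "f * smult k x + smult \<alpha> (tvar ^ 2) * R
      = smult k (f * (x + tvar)) + smult k (A * tvar)"
    unfolding R al(1) F by (simp add: smult_add_right algebra_simps power2_eq_square)
  then have "cub dvd smult k (A * tvar)"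
    using cond x by (metis dvd_add_right_iff dvd_mult dvd_smult)
  then have "smult k (A * tvar) = 0"
    by (rule cub_dvd_small) (auto simp: A_B_C_def tvar_def intro: le_less_trans[OF degree_smult_le])
  then have "a = 0" using al by (simp add: A_B_C_def)
  then show ?thesis
    using f g by (intro that[of b c]) (auto simp: tvar_def)
qed

text \<open>
  At the first level where the trace sum vanishes, the coefficient \<open>1 + D\<close> of
  \<open>lattice_step_identities\<close> is zero. The coefficients of one lifted vector then drop from degree \<open>3\<close>
  to degree \<open>1\<close>, and the vector itself becomes shorter by the same amount. The coordinates of any
  other vector of degree less than \<open>2 ^ j\<close> are multiples of these coefficients, by
  \<open>small_coordinates_odd\<close> and \<open>small_coordinates_even\<close>.
\<close>

lemma minimal_syzygy:
  assumes j: "j \<ge> 1" and T: "\<And>i. 1 \<le> i \<Longrightarrow> i \<le> j \<Longrightarrow> trace_sum (\<alpha>::'a) i \<noteq> 0"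
    and T0: "trace_sum \<alpha> (Suc j) = 0"
  obtains S u where "syzygy \<alpha> (Suc j) S u" "degree S \<le> 2 ^ j - 2" "degree u \<le> 2 ^ j - 2"
    "cub dvd S + tvar ^ (if even j then 1 else 0)"
    "\<And>S' u'. syzygy \<alpha> (Suc j) S' u' \<Longrightarrow> degree S' < 2 ^ j \<Longrightarrow> degree u' < 2 ^ j
      \<Longrightarrow> \<exists>a b. S' = [:a, b:] * S"
proof -
  obtain S1 u1 S2 u2 where B: "lattice_basis \<alpha> j S1 u1 S2 u2"
    using lattice_basis_exists[OF char2 j, of \<alpha>] T by auto
  have Tj: "trace_sum \<alpha> j \<noteq> 0" using T j by simp
  define k where "k = (trace_sum \<alpha> j)\<^sup>2"
  have k: "k \<noteq> 0" using Tj by (simp add: k_def)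
  have al: "\<alpha> = k"
    using T0 unfolding trace_sum_Suc[OF char2] k_def[symmetric] by (metis fld_eq_iff_add[OF char2])
  define x where "x = (tvar::'a poly) ^ (2 ^ Suc j)"
  \<comment> \<open>For \<open>D = 1\<close> the two lifts in \<open>lattice_step_identities\<close> are proportional; these are the coefficients of the shorter one.\<close>
  define f g where "f = (if even j then 1 else tvar :: 'a poly)"
    and "g = (if even j then tvar else 1 :: 'a poly)"
  have x: "cub dvd x + tvar ^ (if even j then 2 else 1)"
    unfolding x_def using two_power_mod_3[of "Suc j"]
    by (intro cub_dvd_tvar_power_add[OF char2]) simp
  have "f * tvar ^ (2 * eps j) + g = cub * g"
    by (cases "even j")
      (simp_all add: f_def g_def eps_def cub_def algebra_simps
        power2_eq_square power3_eq_cube power4_eq_xxxx)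
  moreover have "cub dvd f * smult ((trace_sum \<alpha> j)\<^sup>2) (tvar ^ (2 ^ Suc j))
      + smult \<alpha> (tvar ^ eps (Suc j)) * g"
  proof -
    have "f * smult k x + smult \<alpha> (tvar ^ eps (Suc j)) * g
      = smult k (f * (x + tvar ^ (if even j then 2 else 1)))"
      by (subst al) (simp add: f_def g_def eps_def algebra_simps power2_eq_square smult_add_right)
    then show ?thesis unfolding k_def[symmetric] x_def[symmetric]
      using x by (simp add: dvd_smult)
  qed
  ultimately obtain S u where S: "cub * S = f * S1\<^sup>2 + g * S2\<^sup>2"
    "cub * u = f * u1\<^sup>2 + g * u2\<^sup>2 + smult \<alpha> (tvar ^ eps (Suc j)) * S"
    "cub dvd S + g" "syzygy \<alpha> (Suc j) S u"
    using lattice_lift[OF char2 B] by blast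
  have two: "(2::nat) \<le> 2 ^ j" using j by (cases j) auto
  have dsq: "degree (f * p\<^sup>2 + g * q\<^sup>2) \<le> 1 + 2 ^ j"
    if "degree p \<le> 2 ^ (j - 1)" "degree q \<le> 2 ^ (j - 1)" for p q :: "'a poly"
  proof -
    have "2 * 2 ^ (j - 1) = (2::nat) ^ j" using j by (cases j) auto
    moreover have "degree (p\<^sup>2) \<le> 2 * degree p" "degree (q\<^sup>2) \<le> 2 * degree q"
      by (metis degree_power_le mult.commute)+
    moreover have "degree f \<le> 1" "degree g \<le> 1" by (simp_all add: f_def g_def)
    ultimately have "degree (f * p\<^sup>2) \<le> 1 + 2 ^ j" "degree (g * q\<^sup>2) \<le> 1 + 2 ^ j"
      using that degree_mult_le[of f "p\<^sup>2"] degree_mult_le[of g "q\<^sup>2"] by linarith+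
    then show ?thesis by (rule degree_add_le)
  qed
  have dcub: "degree p \<le> 2 ^ j - 2" if "degree (cub * p) \<le> 1 + 2 ^ j" for p :: "'a poly"
    using that two by (cases "p = 0") (simp_all add: degree_mult_eq)
  have bd: "degree S1 \<le> 2 ^ (j - 1)" "degree S2 \<le> 2 ^ (j - 1)"
    "degree u1 \<le> 2 ^ (j - 1)" "degree u2 \<le> 2 ^ (j - 1)"
    using B unfolding lattice_basis_def by auto
  have dS: "degree S \<le> 2 ^ j - 2"
    by (rule dcub) (unfold S(1), rule dsq[OF bd(1,2)])
  have "degree (smult \<alpha> (tvar ^ eps (Suc j)) * S) \<le> 1 + 2 ^ j"
  proof -
    have "degree (smult \<alpha> (tvar ^ eps (Suc j))) \<le> 2"
      by (rule order.trans[OF degree_smult_le]) (simp add: eps_def)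
    with dS two show ?thesis
      using degree_mult_le[of "smult \<alpha> (tvar ^ eps (Suc j))" S] by linarith
  qed
  then have du: "degree u \<le> 2 ^ j - 2"
    by (intro dcub) (unfold S(2), rule degree_add_le[OF dsq[OF bd(3,4)]])
  have "\<exists>a b. S' = [:a, b:] * S"
    if s: "syzygy \<alpha> (Suc j) S' u'" and d: "degree S' < 2 ^ j" "degree u' < 2 ^ j" for S' u'
  proof -
    obtain f' g' R where fg: "cub * S' = f' * S1\<^sup>2 + g' * S2\<^sup>2"
      "degree f' \<le> 2" "degree g' \<le> 2" "f' * tvar ^ (2 * eps j) + g' = cub * R"
      "cub dvd f' * smult k x + smult \<alpha> (tvar ^ eps (Suc j)) * R"
      unfolding k_def x_def using lattice_coordinates[OF char2 B j Tj s d] by blast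
    have "\<exists>a b. f' = [:a, b:] * f \<and> g' = [:a, b:] * g"
    proof (cases "even j")
      case True
      then have "eps j = 2" "eps (Suc j) = 1" by (simp_all add: eps_def)
      with fg x True small_coordinates_odd[OF al k fg(2,3), of R x] show ?thesis
        unfolding f_def g_def by simp metis
    next
      case False
      then have "eps j = 1" "eps (Suc j) = 2" by (simp_all add: eps_def)
      with fg x False small_coordinates_even[OF al k fg(2,3), of R x] show ?thesis
        unfolding f_def g_def by simp metis
    qed
    then obtain a b where "f' = [:a, b:] * f" "g' = [:a, b:] * g" by blast
    then have "cub * S' = cub * ([:a, b:] * S)"
      unfolding fg(1) by (simp only: mult.left_commute[of cub] S(1) distrib_left mult.assoc)
    then have "S' = [:a, b:] * S"
      by (simp only: mult_left_cancel[OF cub_neq_0])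
    then show ?thesis by blast
  qed
  moreover have "g = tvar ^ (if even j then 1 else 0)" by (simp add: g_def)
  ultimately show ?thesis
    using that[OF S(4) dS du] S(3) by simp
qed

end

section \<open>Homogenisation and palindromic polynomials\<close>

text \<open>
  The form of degree \<open>d\<close> attached to \<open>f\<close>, evaluated at \<open>(u, v)\<close>. With \<open>(u, v) = (1, t)\<close> it reverses
  the coefficients, with \<open>(u, v) = (x, y)\<close> it is homogenisation proper; one proof of
  multiplicativity covers both.
\<close>

definition homogenize :: "('a::field \<Rightarrow> 'b::comm_ring_1) \<Rightarrow> 'b \<Rightarrow> 'b \<Rightarrow> nat \<Rightarrow> 'a poly \<Rightarrow> 'b" where
  "homogenize \<phi> u v d f = (\<Sum>i\<le>d. \<phi> (coeff f i) * u ^ i * v ^ (d - i))"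

locale coefficient_hom =
  fixes \<phi> :: "'a::field \<Rightarrow> 'b::comm_ring_1" and u v :: 'b
  assumes hom_add: "\<phi> (a + b) = \<phi> a + \<phi> b" and hom_mult: "\<phi> (a * b) = \<phi> a * \<phi> b"
begin

lemma hom_0: "\<phi> 0 = 0"
  using hom_add[of 0 0] by simp

lemma homogenize_add: "homogenize \<phi> u v d (f + g) = homogenize \<phi> u v d f + homogenize \<phi> u v d g"
  by (simp add: homogenize_def hom_add algebra_simps sum.distrib)

lemma homogenize_0: "homogenize \<phi> u v d 0 = 0"
  by (simp add: homogenize_def hom_0)

lemma homogenize_sum: "homogenize \<phi> u v d (sum F A) = (\<Sum>x\<in>A. homogenize \<phi> u v d (F x))"
  by (induction A rule: infinite_finite_induct) (simp_all add: homogenize_add homogenize_0)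

lemma homogenize_smult: "homogenize \<phi> u v d (smult c f) = \<phi> c * homogenize \<phi> u v d f"
  by (simp add: homogenize_def hom_mult sum_distrib_left mult.assoc)

lemma homogenize_monom:
  assumes "i \<le> d"
  shows "homogenize \<phi> u v d (monom c i) = \<phi> c * u ^ i * v ^ (d - i)"
proof -
  have "homogenize \<phi> u v d (monom c i) = (\<Sum>k\<le>d. if k = i then \<phi> c * u ^ i * v ^ (d - i) else 0)"
    unfolding homogenize_def by (intro sum.cong) (auto simp: hom_0)
  then show ?thesis using assms by simp
qed

lemma homogenize_mult:
  assumes "degree f \<le> d" "degree g \<le> e"
  shows "homogenize \<phi> u v (d + e) (f * g) = homogenize \<phi> u v d f * homogenize \<phi> u v e g"
proof -
  have "f * g = (\<Sum>i\<le>d. monom (coeff f i) i) * (\<Sum>k\<le>e. monom (coeff g k) k)"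
    using assms by (simp add: poly_as_sum_of_monoms')
  also have "\<dots> = (\<Sum>i\<le>d. \<Sum>k\<le>e. monom (coeff f i * coeff g k) (i + k))"
    by (simp add: sum_product mult_monom)
  finally have "homogenize \<phi> u v (d + e) (f * g)
      = (\<Sum>i\<le>d. \<Sum>k\<le>e. \<phi> (coeff f i * coeff g k) * u ^ (i + k) * v ^ (d + e - (i + k)))"
    by (simp add: homogenize_sum homogenize_monom)
  also have "\<dots> = (\<Sum>i\<le>d. \<Sum>k\<le>e. (\<phi> (coeff f i) * u ^ i * v ^ (d - i)) *
      (\<phi> (coeff g k) * u ^ k * v ^ (e - k)))"
  proof (intro sum.cong refl)
    fix i k assume "i \<in> {..d}" "k \<in> {..e}"
    then have "d + e - (i + k) = (d - i) + (e - k)" by auto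
    then show "\<phi> (coeff f i * coeff g k) * u ^ (i + k) * v ^ (d + e - (i + k))
      = (\<phi> (coeff f i) * u ^ i * v ^ (d - i)) * (\<phi> (coeff g k) * u ^ k * v ^ (e - k))"
      by (simp add: hom_mult power_add ac_simps)
  qed
  finally show ?thesis
    by (simp add: homogenize_def sum_product)
qed

end

definition reverse_poly :: "nat \<Rightarrow> 'a::field poly \<Rightarrow> 'a poly" where
  "reverse_poly = homogenize (\<lambda>c. [:c:]) 1 tvar"

interpretation reverse: coefficient_hom "\<lambda>c::'a::field. [:c:]" 1 tvar
  by standard auto

lemma coeff_reverse_poly:
  "coeff (reverse_poly d f) i = (if i \<le> d then coeff f (d - i) else 0)"
proof -
  have "coeff (reverse_poly d f) i = (\<Sum>k\<le>d. coeff f k * (if d - k = i then 1 else 0))"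
    unfolding reverse_poly_def homogenize_def coeff_sum
    by (intro sum.cong) (auto simp: tvar_power)
  also have "\<dots> = (\<Sum>k\<le>d. if k = d - i then (if i \<le> d then coeff f (d - i) else 0) else 0)"
    by (intro sum.cong) auto
  finally show ?thesis by simp
qed

lemmas reverse_poly_mult = reverse.homogenize_mult[folded reverse_poly_def]
lemmas reverse_poly_add = reverse.homogenize_add[folded reverse_poly_def]

definition palindromic :: "nat \<Rightarrow> 'a::field poly \<Rightarrow> bool" where
  "palindromic d f \<longleftrightarrow> degree f \<le> d \<and> reverse_poly d f = f"

lemma palindromic_iff:
  "palindromic d f \<longleftrightarrow> degree f \<le> d \<and> (\<forall>i\<le>d. coeff f i = coeff f (d - i))"
proof -
  have "reverse_poly d f = f \<longleftrightarrow> (\<forall>i\<le>d. coeff f i = coeff f (d - i))" if d: "degree f \<le> d"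
  proof
    assume "reverse_poly d f = f"
    then show "\<forall>i\<le>d. coeff f i = coeff f (d - i)"
      by (metis coeff_reverse_poly)
  next
    assume R: "\<forall>i\<le>d. coeff f i = coeff f (d - i)"
    show "reverse_poly d f = f"
    proof (rule poly_eqI)
      fix i
      show "coeff (reverse_poly d f) i = coeff f i"
      proof (cases "i \<le> d")
        case True
        then show ?thesis using R by (simp only: coeff_reverse_poly if_True)
      next
        case False
        then show ?thesis using d by (simp add: coeff_reverse_poly coeff_eq_0)
      qed
    qed
  qed
  then show ?thesis unfolding palindromic_def by blast
qed

lemma palindromic_mult:
  assumes "palindromic d f" "palindromic e g"
  shows "palindromic (d + e) (f * g)"
  using assms degree_mult_le[of f g] reverse_poly_mult[of f d g e] by (simp add: palindromic_def)

lemma palindromic_add: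
  "palindromic d f \<Longrightarrow> palindromic d g \<Longrightarrow> palindromic d (f + g)"
  by (simp add: palindromic_def reverse_poly_add degree_add_le)

lemma palindromic_0 [simp]: "palindromic d 0"
  by (simp add: palindromic_iff)

lemma palindromic_1 [simp]: "palindromic 0 1"
  unfolding palindromic_iff by simp

lemma palindromic_smult: "palindromic d f \<Longrightarrow> palindromic d (smult c f)"
  unfolding palindromic_iff by (metis coeff_smult degree_smult_le order.trans)

lemma palindromic_sum:
  "(\<And>x. x \<in> A \<Longrightarrow> palindromic d (F x)) \<Longrightarrow> palindromic d (sum F A)"
  by (induction A rule: infinite_finite_induct) (auto intro: palindromic_add)

lemma palindromic_power: "palindromic d f \<Longrightarrow> palindromic (n * d) (f ^ n)"
  by (induction n) (auto intro: palindromic_mult)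

lemma palindromic_tvar: "palindromic 2 tvar"
  by (auto simp: palindromic_iff tvar_def coeff_pCons split: nat.splits)

lemma palindromic_cub: "palindromic 3 cub"
proof -
  have "coeff cub i = (if i = 0 \<or> i = 3 then 1 else 0 :: 'a)" for i
    by (simp add: cub_def tvar_power)
  then show ?thesis by (auto simp: palindromic_iff)
qed

lemma palindromic_frob_rem: "palindromic (2 ^ n - 2) (frob_rem n)"
proof (induction n rule: frob_rem.induct)
  case (3 n)
  have "palindromic (2 + 2 * (2 ^ Suc n - 2)) (tvar * frob_rem (Suc n) ^ 2 :: 'a poly)"
    using 3 by (intro palindromic_mult palindromic_tvar palindromic_power)
  moreover have "2 + 2 * (2 ^ Suc n - 2) = 2 ^ Suc (Suc n) - (2::nat)"
    using one_le_power[of "2::nat" n] unfolding power_Suc by arith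
  moreover have "palindromic (2 ^ Suc (Suc n) - 2) (cub ^ 2 * frob_rem n ^ 4 :: 'a poly)"
  proof (cases n)
    case (Suc k)
    have "palindromic (2 * 3 + 4 * (2 ^ n - 2)) (cub ^ 2 * frob_rem n ^ 4 :: 'a poly)"
      using 3 by (intro palindromic_mult palindromic_cub palindromic_power)
    moreover have "2 * 3 + 4 * (2 ^ n - 2) = 2 ^ Suc (Suc n) - (2::nat)"
      using one_le_power[of "2::nat" k] unfolding Suc power_Suc by arith
    ultimately show ?thesis by simp
  qed simp
  ultimately show ?case by (simp add: palindromic_add)
qed simp_all

lemma palindromic_obstruction: "palindromic (2 ^ n) (obstruction \<alpha> n)"
proof (induction n)
  case (Suc n)
  have "palindromic (2 + (2 ^ Suc n - 2)) (smult \<alpha> (tvar * frob_rem (Suc n)))"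
    by (intro palindromic_smult palindromic_mult palindromic_tvar palindromic_frob_rem)
  moreover have "2 + (2 ^ Suc n - 2) = (2::nat) ^ Suc n"
    using one_le_power[of "2::nat" n] unfolding power_Suc by arith
  moreover have "palindromic (2 ^ Suc n) (obstruction \<alpha> n ^ 2)"
    using palindromic_power[OF Suc, of 2] by simp
  ultimately show ?case by (simp add: palindromic_add del: power_Suc)
qed simp

definition at_square :: "'a::field poly \<Rightarrow> 'a poly" where
  "at_square p = pcompose p (tvar ^ 2)"

lemma at_square_add: "at_square (p + q) = at_square p + at_square q"
  by (simp add: at_square_def pcompose_add)

lemma at_square_mult: "at_square (p * q) = at_square p * at_square q"
  by (simp add: at_square_def pcompose_mult)

lemma at_square_tvar: "at_square tvar = tvar ^ 2"
  by (simp add: at_square_def tvar_def pcompose_pCons)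

lemma at_square_1: "at_square 1 = 1"
  by (simp only: at_square_def one_pCons pcompose_const)

lemma at_square_power: "at_square (p ^ n) = at_square p ^ n"
  by (induction n) (simp_all add: at_square_mult at_square_1)

lemma at_square_cub: "at_square cub = 1 + tvar ^ 6"
  by (simp add: cub_def at_square_add at_square_power at_square_tvar at_square_1 flip: power_mult)

lemma coeff_at_square: "coeff (at_square p) i = (if even i then coeff p (i div 2) else 0)"
proof (induction p arbitrary: i)
  case (pCons a p)
  have "at_square (pCons a p) = [:a:] + monom 1 2 * at_square p"
    by (simp add: at_square_def pcompose_pCons tvar_power)
  then have *: "coeff (at_square (pCons a p)) i
      = coeff [:a:] i + (if i < 2 then 0 else coeff (at_square p) (i - 2))"
    by (simp add: coeff_monom_mult)
  show ?case
    unfolding * pCons.IH by (auto simp: coeff_pCons less_2_cases_iff elim!: evenE oddE split: nat.splits)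
qed (simp add: at_square_def)

text \<open>
  A palindromic polynomial of odd degree \<open>2 * Q - 1\<close> is determined by its even part \<open>p (t\<^sup>2)\<close>: its odd
  part carries the reversed coefficients of \<open>p\<close>.
\<close>

definition interleave :: "nat \<Rightarrow> 'a::field poly \<Rightarrow> 'a poly" where
  "interleave Q p = at_square p + tvar * at_square (reverse_poly (Q - 1) p)"

lemma coeff_tvar_mult: "coeff (tvar * p) i = (if i = 0 then 0 else coeff p (i - 1))"
  using coeff_monom_mult[of 1 1 p i] tvar_power[of 1, where 'a = 'a] by auto

lemma coeff_interleave:
  "coeff (interleave Q p) (2 * i) = coeff p i"
  "coeff (interleave Q p) (2 * i + 1) = (if i \<le> Q - 1 then coeff p (Q - 1 - i) else 0)"
  by (auto simp: interleave_def coeff_tvar_mult coeff_at_square coeff_reverse_poly)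

lemma palindromic_interleave:
  assumes "degree p < Q"
  shows "palindromic (2 * Q - 1) (interleave Q p)"
proof -
  have z: "coeff p i = 0" if "i \<ge> Q" for i using that assms by (simp add: coeff_eq_0)
  have "coeff (interleave Q p) i = 0" if "i > 2 * Q - 1" for i
    using that by (cases "even i") (auto elim!: evenE oddE simp: coeff_interleave z simp del: One_nat_def)
  then have "degree (interleave Q p) \<le> 2 * Q - 1"
    by (intro degree_le) simp
  moreover have "coeff (interleave Q p) i = coeff (interleave Q p) (2 * Q - 1 - i)" if i: "i \<le> 2 * Q - 1" for i
  proof (cases "even i")
    case True
    then obtain k where k: "i = 2 * k" ..
    then have "2 * Q - 1 - i = 2 * (Q - 1 - k) + 1" "k \<le> Q - 1" using i assms by auto
    then show ?thesis unfolding k by (simp add: coeff_interleave del: One_nat_def)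
  next
    case False
    then obtain k where k: "i = 2 * k + 1" by (elim oddE)
    then have "2 * Q - 1 - i = 2 * (Q - 1 - k)" "k \<le> Q - 1" using i assms by auto
    then show ?thesis unfolding k by (simp add: coeff_interleave del: One_nat_def)
  qed
  ultimately show ?thesis unfolding palindromic_iff by blast
qed

lemma palindromic_is_interleave:
  assumes s: "palindromic (2 * Q - 1) s" and Q: "Q \<ge> 1"
  obtains p where "s = interleave Q p" "degree p < Q"
proof
  define p where "p = (\<Sum>i<Q. monom (coeff s (2 * i)) i)"
  have p: "coeff p i = (if i < Q then coeff s (2 * i) else 0)" for i
    by (simp add: p_def coeff_sum)
  have "degree p \<le> Q - 1" by (intro degree_le) (auto simp: p)
  then show "degree p < Q" using Q by simp
  have sz: "coeff s i = 0" if "i > 2 * Q - 1" for i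
    using s that unfolding palindromic_iff by (metis coeff_eq_0 le_less_trans)
  have sp: "coeff s i = coeff s (2 * Q - 1 - i)" if "i \<le> 2 * Q - 1" for i
    using s that unfolding palindromic_iff by blast
  show "s = interleave Q p"
  proof (rule poly_eqI)
    fix i
    show "coeff s i = coeff (interleave Q p) i"
    proof (cases "even i")
      case True
      then obtain k where k: "i = 2 * k" ..
      show ?thesis unfolding k coeff_interleave p using sz[of "2 * k"] Q by auto
    next
      case False
      then obtain k where k: "i = 2 * k + 1" by (elim oddE)
      show ?thesis
      proof (cases "k \<le> Q - 1")
        case True
        then have "2 * Q - 1 - i = 2 * (Q - 1 - k)" "i \<le> 2 * Q - 1" "Q - 1 - k < Q" using k Q by auto
        then have "coeff s i = coeff p (Q - 1 - k)" using sp[of i] by (simp add: p)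
        then show ?thesis unfolding k coeff_interleave using True by simp
      next
        case False
        then show ?thesis unfolding k coeff_interleave using sz[of "2 * k + 1"] by simp
      qed
    qed
  qed
qed

text \<open>
  The even coefficients of the product are those of \<open>p * H\<close>, and the odd ones are the same
  coefficients in reverse order, since \<open>H\<close> is palindromic. The reversal maps the range from \<open>Q\<close> to
  \<open>2 * Q - 1\<close> to itself.
\<close>

lemma interleave_mult_at_square:
  assumes p: "degree p < Q" and H: "palindromic (2 * Q) H"
  shows "(\<forall>c. 2 * Q \<le> c \<and> c < 4 * Q \<longrightarrow> coeff (interleave Q p * at_square H) c = 0)
    \<longleftrightarrow> (\<forall>c. Q \<le> c \<and> c < 2 * Q \<longrightarrow> coeff (p * H) c = 0)" (is "?L \<longleftrightarrow> ?R")
proof -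
  have eq: "interleave Q p * at_square H = at_square (p * H) + tvar * at_square (reverse_poly (Q - 1) p * H)"
    by (simp add: interleave_def at_square_mult algebra_simps)
  have even: "coeff (interleave Q p * at_square H) (2 * c) = coeff (p * H) c" for c
    unfolding eq by (auto simp: coeff_tvar_mult coeff_at_square)
  have rev: "reverse_poly (Q - 1) p * H = reverse_poly ((Q - 1) + 2 * Q) (p * H)"
    using assms reverse_poly_mult[of p "Q - 1" H "2 * Q"] by (simp add: palindromic_def)
  have odd: "coeff (interleave Q p * at_square H) (2 * c + 1) = coeff (p * H) ((Q - 1) + 2 * Q - c)"
    if "c < 2 * Q" for c
    unfolding eq rev using that by (simp add: coeff_tvar_mult coeff_at_square coeff_reverse_poly)
  show ?thesis
  proof
    assume L: ?L
    show ?R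
    proof (intro allI impI)
      fix c assume "Q \<le> c \<and> c < 2 * Q"
      then have "coeff (interleave Q p * at_square H) (2 * c) = 0" using L by simp
      then show "coeff (p * H) c = 0" unfolding even .
    qed
  next
    assume R: ?R
    show ?L
    proof (intro allI impI)
      fix c assume c: "2 * Q \<le> c \<and> c < 4 * Q"
      show "coeff (interleave Q p * at_square H) c = 0"
      proof (cases "even c")
        case True
        then obtain k where "c = 2 * k" ..
        then show ?thesis using c R even by auto
      next
        case False
        then obtain k where k: "c = 2 * k + 1" by (elim oddE)
        have "Q \<le> k" "k < 2 * Q" using c k by presburger+
        moreover from this have "Q \<le> (Q - 1) + 2 * Q - k" "(Q - 1) + 2 * Q - k < 2 * Q" by simp_all
        ultimately have "coeff (p * H) ((Q - 1) + 2 * Q - k) = 0" using R by blast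
        then show ?thesis unfolding k using odd[OF \<open>k < 2 * Q\<close>] by simp
      qed
    qed
  qed
qed

context
  fixes ty :: "'a::field itself"
  assumes char2: "CHAR('a) = 2"
begin

declare char2_cancel [OF char2, simp]

lemma cub_dvd_at_square:
  assumes "cub dvd (p::'a poly)"
  shows "cub dvd at_square p"
proof -
  have "at_square (cub :: 'a poly) = cub * cub"
    unfolding at_square_cub by (simp add: cub_def algebra_simps eval_nat_numeral)
  with assms show ?thesis by (auto simp: at_square_mult elim!: dvdE)
qed

text \<open>
  Reversal is multiplicative and fixes \<open>cub\<close>, so a congruence modulo \<open>cub\<close> may be reversed.
\<close>

lemma cub_dvd_reverse:
  assumes S: "cub dvd (S::'a poly) + tvar ^ i" and "degree S \<le> d" "i \<le> d"
  shows "cub dvd reverse_poly d S + tvar ^ (d - i)"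
proof -
  obtain k where k: "S + tvar ^ i = cub * k" using S ..
  then have S: "S = tvar ^ i + cub * k"
    by (metis add.commute poly_add_self_left[OF char2])
  have rt: "reverse_poly d (tvar ^ i) = (tvar ^ (d - i) :: 'a poly)"
    unfolding tvar_power[of i] reverse_poly_def reverse.homogenize_monom[OF \<open>i \<le> d\<close>] by simp
  have *: "reverse_poly d S + tvar ^ (d - i) = reverse_poly d (cub * k)"
    unfolding S reverse_poly_add rt by (simp add: algebra_simps)
  show ?thesis
  proof (cases "k = 0")
    case True
    then show ?thesis unfolding * by (simp add: reverse_poly_def reverse.homogenize_0)
  next
    case False
    have "degree (cub * k) \<le> d"
      unfolding k[symmetric] using assms by (intro degree_add_le) auto
    then have "3 + degree k \<le> d" using False by (simp add: degree_mult_eq)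
    then have "reverse_poly (3 + (d - 3)) (cub * k) = reverse_poly 3 cub * reverse_poly (d - 3) k"
      by (intro reverse_poly_mult) auto
    moreover have "3 + (d - 3) = d" using \<open>3 + degree k \<le> d\<close> by simp
    ultimately show ?thesis
      unfolding * using palindromic_cub[where 'a = 'a] by (simp add: palindromic_def)
  qed
qed

text \<open>
  By \<open>interleave_mult_at_square\<close> the condition on coefficients says that the even part of the
  solution is the \<open>S\<close>-component of a vector of degree less than \<open>Q\<close>, hence \<open>(a + b t) S\<close> with \<open>S\<close> from
  \<open>minimal_syzygy\<close>. Modulo \<open>cub\<close>, the interleaved polynomial is \<open>b t (1 + t)\<close> up to a power of
  \<open>t\<close>, so that \<open>cub\<close> divides it only for \<open>b = 0\<close>.
\<close>

lemma unique_palindromic_solution: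
  assumes j: "j \<ge> 1" and T: "\<And>i. 1 \<le> i \<Longrightarrow> i \<le> j \<Longrightarrow> trace_sum (\<alpha>::'a) i \<noteq> 0"
    and T0: "trace_sum \<alpha> (Suc j) = 0" and Q: "Q = 2 ^ j"
  defines "solution \<equiv> \<lambda>s. palindromic (2 * Q - 1) s \<and> cub dvd s \<and>
    (\<forall>c. 2 * Q \<le> c \<and> c < 4 * Q \<longrightarrow> coeff (s * at_square (obstruction \<alpha> (Suc j))) c = 0)"
  obtains s where "s \<noteq> 0" "solution s" "\<And>s'. solution s' \<Longrightarrow> \<exists>a. s' = smult a s"
proof -
  \<comment> \<open>The residue of the minimal vector modulo \<open>cub\<close> is \<open>t ^ \<delta>\<close>; reversal in degree \<open>Q - 2\<close> preserves it, as \<open>Q - 2\<close> is congruent to \<open>2 \<delta>\<close> modulo \<open>3\<close>.\<close>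
  define \<delta> where "\<delta> = (if even j then 1 else 0 :: nat)"
  obtain S u where S: "syzygy \<alpha> (Suc j) S u" "degree S \<le> Q - 2" "degree u \<le> Q - 2"
    "cub dvd S + tvar ^ \<delta>"
    and uniq: "\<And>S' u'. syzygy \<alpha> (Suc j) S' u' \<Longrightarrow> degree S' < Q \<Longrightarrow> degree u' < Q
      \<Longrightarrow> \<exists>a b. S' = [:a, b:] * S"
    unfolding \<delta>_def Q using minimal_syzygy[OF char2 j T T0] by blast
  define H where "H = obstruction \<alpha> (Suc j)"
  have H: "palindromic (2 * Q) H"
    unfolding H_def Q using palindromic_obstruction[of "Suc j" \<alpha>] by simp
  have Q2: "Q \<ge> 2" unfolding Q using j by (cases j) auto
  have tQ: "2 ^ Suc j = 2 * Q" by (simp add: Q)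
  have Q3: "Q mod 3 = (if even j then 1 else 2)" unfolding Q by (rule two_power_mod_3)
  have "\<delta> \<le> Q - 2"
  proof (cases "Q = 2")
    case True
    then show ?thesis using Q3 by (auto simp: \<delta>_def split: if_splits)
  next
    case False
    then show ?thesis using Q2 by (auto simp: \<delta>_def)
  qed
  define \<rho> where "\<rho> = reverse_poly (Q - 2) S"
  have "cub dvd \<rho> + tvar ^ (Q - 2 - \<delta>)"
    unfolding \<rho>_def using S \<open>\<delta> \<le> Q - 2\<close> by (intro cub_dvd_reverse) auto
  moreover have "(Q - 2 - \<delta>) mod 3 = \<delta> mod 3"
  proof (cases "even j")
    case True
    then have "Q mod 3 = 1" and "\<delta> = 1" using Q3 by (simp_all add: \<delta>_def)
    moreover have "Q = 3 * (Q div 3) + Q mod 3" by simp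
    ultimately have "Q - 2 - \<delta> = 1 + (Q div 3 - 1) * 3" using Q2 by linarith
    then show ?thesis unfolding \<open>\<delta> = 1\<close> by (metis mod_mult_self1)
  next
    case False
    then have "Q mod 3 = 2" and "\<delta> = 0" using Q3 by (simp_all add: \<delta>_def)
    moreover have "Q = 3 * (Q div 3) + Q mod 3" by simp
    ultimately have "Q - 2 - \<delta> = 0 + (Q div 3) * 3" by linarith
    then show ?thesis unfolding \<open>\<delta> = 0\<close> by (metis mod_mult_self1)
  qed
  then have "cub dvd tvar ^ (Q - 2 - \<delta>) + (tvar ^ \<delta> :: 'a poly)"
    by (rule cub_dvd_tvar_power_add[OF char2])
  ultimately have "cub dvd (\<rho> + tvar ^ (Q - 2 - \<delta>)) + (tvar ^ (Q - 2 - \<delta>) + tvar ^ \<delta>)"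
    by (rule dvd_add)
  then have \<rho>: "cub dvd \<rho> + tvar ^ \<delta>" by (simp add: algebra_simps)
  have dS: "cub dvd at_square S + tvar ^ (2 * \<delta>)" "cub dvd at_square \<rho> + tvar ^ (2 * \<delta>)"
    using cub_dvd_at_square[OF S(4)] cub_dvd_at_square[OF \<rho>]
    by (simp_all add: at_square_add at_square_power at_square_tvar flip: power_mult)
  have il: "interleave Q ([:a, b:] * S)
      = (smult a 1 + smult b (tvar ^ 2)) * at_square S + tvar * (smult b 1 + smult a (tvar ^ 2)) * at_square \<rho>" for a b
  proof -
    have "reverse_poly (1 + (Q - 2)) ([:a, b:] * S) = reverse_poly 1 [:a, b:] * \<rho>"
      unfolding \<rho>_def using S by (intro reverse_poly_mult) auto
    moreover have "1 + (Q - 2) = Q - 1" using Q2 by simp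
    moreover have "reverse_poly 1 [:a, b:] = [:b, a:]"
      by (rule poly_eqI) (auto simp: coeff_reverse_poly coeff_pCons split: nat.splits)
    ultimately have "reverse_poly (Q - 1) ([:a, b:] * S) = [:b, a:] * \<rho>" by simp
    moreover have "at_square [:x, y:] = smult x 1 + smult y (tvar ^ 2)" for x y :: 'a
      by (simp add: at_square_def pcompose_pCons)
    ultimately show ?thesis
      unfolding interleave_def by (simp only: at_square_mult mult.assoc)
  qed
  have cub_il: "cub dvd interleave Q ([:a, b:] * S) \<longleftrightarrow> b = 0" for a b
  proof -
    define e where "e = tvar ^ (2 * \<delta>) * (smult b (tvar * (1 + tvar)) + smult a cub)"
    have "interleave Q ([:a, b:] * S) + e =
      (smult a 1 + smult b (tvar ^ 2)) * (at_square S + tvar ^ (2 * \<delta>))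
       + tvar * (smult b 1 + smult a (tvar ^ 2)) * (at_square \<rho> + tvar ^ (2 * \<delta>))"
      unfolding il e_def cub_def
      by (simp add: algebra_simps power2_eq_square power3_eq_cube smult_add_right)
    then have "cub dvd interleave Q ([:a, b:] * S) + e"
      using dS by (metis dvd_add dvd_mult)
    then have "cub dvd interleave Q ([:a, b:] * S) \<longleftrightarrow> cub dvd e"
      by (metis dvd_add_right_iff dvd_add_left_iff)
    also have "\<dots> \<longleftrightarrow> cub dvd smult b (tvar * (1 + tvar)) + smult a cub"
      unfolding e_def using cub_dvd_tvar_power_mult[OF char2] by (metis dvd_mult)
    also have "\<dots> \<longleftrightarrow> cub dvd smult b (tvar * (1 + tvar))"
      by (rule dvd_add_left_iff) (simp add: dvd_smult)
    also have "\<dots> \<longleftrightarrow> b = 0"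
    proof
      have "degree (tvar * (1 + tvar) :: 'a poly) = 2"
        by (simp add: tvar_def one_pCons)
      moreover assume "cub dvd smult b (tvar * (1 + tvar))"
      ultimately have "smult b (tvar * (1 + tvar)) = 0"
        by (intro cub_dvd_small) (auto intro: le_less_trans[OF degree_smult_le])
      then show "b = 0" using \<open>degree (tvar * (1 + tvar) :: 'a poly) = 2\<close> by auto
    qed simp
    finally show ?thesis .
  qed
  have syz: "syzygy \<alpha> (Suc j) p u' \<longleftrightarrow> (\<forall>i<2 * Q. coeff (p * H) i = coeff u' i)" for p u'
    unfolding syzygy_def tvar_power monom_1_dvd_iff' tQ H_def
    by (simp add: fld_eq_iff_add[OF char2, symmetric])
  show ?thesis
  proof (rule that[of "interleave Q S"])
    have "S \<noteq> 0"
    proof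
      assume "S = 0"
      then have "cub dvd tvar ^ \<delta> * (1 :: 'a poly)" using S(4) by simp
      then have "cub dvd (1 :: 'a poly)" by (rule cub_dvd_tvar_power_mult[OF char2])
      then show False using cub_dvd_small[of 1] by simp
    qed
    then show "interleave Q S \<noteq> 0"
      using coeff_interleave(1)[of Q S] by (metis coeff_0 poly_eqI)
    have dS: "degree S < Q" using S(2) Q2 by simp
    have "coeff (S * H) c = 0" if "Q \<le> c" "c < 2 * Q" for c
      using S(1,3) that Q2 unfolding syz by (simp add: coeff_eq_0)
    then have "\<forall>c. 2 * Q \<le> c \<and> c < 4 * Q \<longrightarrow> coeff (interleave Q S * at_square H) c = 0"
      by (subst interleave_mult_at_square[OF dS H]) auto
    moreover have "cub dvd interleave Q S" using cub_il[of 1 0] by simp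
    ultimately show "solution (interleave Q S)"
      unfolding solution_def H_def using palindromic_interleave[OF dS] by simp
    fix s assume s: "solution s"
    then obtain p where p: "s = interleave Q p" "degree p < Q"
      unfolding solution_def using palindromic_is_interleave[of Q s] Q2 by auto
    have z: "coeff (p * H) c = 0" if "Q \<le> c" "c < 2 * Q" for c
      using s interleave_mult_at_square[OF p(2) H] that unfolding solution_def p(1) H_def by auto
    define u' where "u' = (\<Sum>i<Q. monom (coeff (p * H) i) i)"
    have u': "coeff u' i = (if i < Q then coeff (p * H) i else 0)" for i
      by (simp add: u'_def coeff_sum)
    have "degree u' \<le> Q - 1" by (intro degree_le) (auto simp: u')
    then have "degree u' < Q" using Q2 by simp
    moreover have "syzygy \<alpha> (Suc j) p u'"
      unfolding syz u' using z by auto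
    ultimately obtain a b where ab: "p = [:a, b:] * S"
      using uniq p(2) by blast
    have "b = 0" using s cub_il[of a b] unfolding solution_def p(1) ab by blast
    then have "p = smult a S" using ab by simp
    then have "s = smult a (interleave Q S)"
      unfolding p(1) interleave_def reverse_poly_def
      by (simp only: reverse.homogenize_smult) (simp add: at_square_def pcompose_smult smult_add_right)
    then show "\<exists>a. s = smult a (interleave Q S)" ..
  qed
qed

end

section \<open>The truncated polynomial ring and \<open>P\<close>-adic expansions\<close>

abbreviation (input) type_ring :: "'a::comm_ring_1 ring" where
  "type_ring \<equiv> ring_of_type_algebra"

lemma type_ring_simps:
  "carrier type_ring = UNIV" "a \<otimes>\<^bsub>type_ring\<^esub> b = a * b" "a \<oplus>\<^bsub>type_ring\<^esub> b = a + b"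
  "\<one>\<^bsub>type_ring\<^esub> = 1" "\<zero>\<^bsub>type_ring\<^esub> = 0"
  by (simp_all add: ring_of_type_algebra_def)

lemma ring_type_ring: "ring (type_ring :: 'a::comm_ring_1 ring)"
  by (rule ring_from_type_algebra)

lemma type_ring_uminus: "\<ominus>\<^bsub>type_ring\<^esub> a = - (a :: 'a::comm_ring_1)"
proof -
  interpret ring "type_ring :: 'a ring" by (rule ring_type_ring)
  show ?thesis by (rule minus_equality) (simp_all add: type_ring_simps)
qed

lemma var_x_power: "var_x ^ i = Poly_Mapping.single (i, 0, 0) (1 :: 'a::field)"
  by (induction i) (simp_all add: var_x_def mult_single flip: zero_prod_def)

lemma var_y_power: "var_y ^ i = Poly_Mapping.single (0, i, 0) (1 :: 'a::field)"
  by (induction i) (simp_all add: var_y_def mult_single flip: zero_prod_def)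

lemma var_z_power: "var_z ^ i = Poly_Mapping.single (0, 0, i) (1 :: 'a::field)"
  by (induction i) (simp_all add: var_z_def mult_single flip: zero_prod_def)

lemma monomial_eq_single:
  "const3 a * var_x ^ i * var_y ^ j * var_z ^ k = Poly_Mapping.single (i, j, k) a"
  by (simp add: const3_def var_x_power var_y_power var_z_power mult_single)

text \<open>
  The ideal generated by \<open>x ^ N\<close>, \<open>y ^ N\<close> and \<open>z ^ N\<close>, described by the monomials that do not occur.
\<close>

definition trunc_ideal :: "nat \<Rightarrow> 'a::field poly3 set" where
  "trunc_ideal N = {p. \<forall>a<N. \<forall>b<N. \<forall>c<N. Poly_Mapping.lookup p (a, b, c) = 0}"

lemma trunc_ideal_add: "p \<in> trunc_ideal N \<Longrightarrow> q \<in> trunc_ideal N \<Longrightarrow> p + q \<in> trunc_ideal N"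
  by (simp add: trunc_ideal_def lookup_add)

lemma trunc_ideal_uminus: "p \<in> trunc_ideal N \<Longrightarrow> - p \<in> trunc_ideal N"
  by (simp add: trunc_ideal_def)

lemma trunc_ideal_0 [simp]: "0 \<in> trunc_ideal N"
  by (simp add: trunc_ideal_def)

lemma trunc_ideal_diff: "p \<in> trunc_ideal N \<Longrightarrow> q \<in> trunc_ideal N \<Longrightarrow> p - q \<in> trunc_ideal N"
  by (simp add: trunc_ideal_def lookup_minus)

lemma trunc_ideal_mult:
  assumes "p \<in> trunc_ideal N"
  shows "q * p \<in> trunc_ideal N"
proof -
  have "Poly_Mapping.lookup (q * p) (a, b, c) = 0" if *: "a < N" "b < N" "c < N" for a b c
  proof (rule ccontr)
    assume "Poly_Mapping.lookup (q * p) (a, b, c) \<noteq> 0"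
    then have "(a, b, c) \<in> Poly_Mapping.keys (q * p)" by (simp add: in_keys_iff)
    then obtain k a' b' c' where "(a', b', c') \<in> Poly_Mapping.keys p" "(a, b, c) = k + (a', b', c')"
      using keys_mult[of q p] by fast
    moreover from this have "a' \<le> a" "b' \<le> b" "c' \<le> c" by (cases k; simp)+
    ultimately show False
      using assms * by (auto simp: trunc_ideal_def in_keys_iff)
  qed
  then show ?thesis by (simp add: trunc_ideal_def)
qed

lemma trunc_ideal_mult_right: "p \<in> trunc_ideal N \<Longrightarrow> p * q \<in> trunc_ideal N"
  by (subst mult.commute) (rule trunc_ideal_mult)

lemma poly_mapping_eq_sum_single:
  "p = (\<Sum>k\<in>Poly_Mapping.keys p. Poly_Mapping.single k (Poly_Mapping.lookup p k))"
proof (rule poly_mapping_eqI)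
  fix i
  have "(\<Sum>k\<in>Poly_Mapping.keys p. Poly_Mapping.lookup (Poly_Mapping.single k (Poly_Mapping.lookup p k)) i)
    = (\<Sum>k\<in>Poly_Mapping.keys p. if k = i then Poly_Mapping.lookup p i else 0)"
    by (intro sum.cong) (auto simp: lookup_single)
  then show "Poly_Mapping.lookup p i =
      Poly_Mapping.lookup (\<Sum>k\<in>Poly_Mapping.keys p. Poly_Mapping.single k (Poly_Mapping.lookup p k)) i"
    by (simp add: lookup_sum in_keys_iff)
qed

lemma ideal_trunc_ideal: "ideal (trunc_ideal N :: 'a::field poly3 set) type_ring"
proof (rule idealI[OF ring_type_ring])
  interpret R: ring "type_ring :: 'a poly3 ring" by (rule ring_type_ring)
  show "subgroup (trunc_ideal N :: 'a poly3 set) (add_monoid type_ring)"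
  proof (rule R.add.subgroupI)
    show "(trunc_ideal N :: 'a poly3 set) \<noteq> {}" using trunc_ideal_0 by blast
  qed (simp_all add: type_ring_simps type_ring_uminus trunc_ideal_add trunc_ideal_uminus)
qed (simp_all add: type_ring_simps trunc_ideal_mult trunc_ideal_mult_right)

lemma O_ideal_eq: "(O_ideal Q :: 'a::field poly3 set) = trunc_ideal (4 * Q)"
proof
  interpret ring "type_ring :: 'a poly3 ring" by (rule ring_type_ring)
  let ?G = "{var_x ^ (4 * Q), var_y ^ (4 * Q), var_z ^ (4 * Q)} :: 'a poly3 set"
  have "?G \<subseteq> trunc_ideal (4 * Q)"
    by (auto simp: trunc_ideal_def var_x_power var_y_power var_z_power lookup_single)
  then show "O_ideal Q \<subseteq> (trunc_ideal (4 * Q) :: 'a poly3 set)"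
    unfolding O_ideal_def by (intro genideal_minimal ideal_trunc_ideal)
  interpret I: ideal "O_ideal Q :: 'a poly3 set" "type_ring"
    unfolding O_ideal_def by (rule genideal_ideal) (simp add: type_ring_simps)
  have gen: "?G \<subseteq> O_ideal Q"
    unfolding O_ideal_def by (rule genideal_self) (simp add: type_ring_simps)
  have mult: "q * p \<in> O_ideal Q" if "p \<in> O_ideal Q" for p q :: "'a poly3"
    using I.I_l_closed[OF that, of q] by (simp add: type_ring_simps)
  have add: "sum f A \<in> O_ideal Q" if "\<And>k. k \<in> A \<Longrightarrow> f k \<in> O_ideal Q" for f :: "nat \<times> nat \<times> nat \<Rightarrow> 'a poly3" and A
    using that
  proof (induction A rule: infinite_finite_induct)
    case (insert x F)
    then show ?case using I.a_closed[of "f x" "sum f F"] by (simp add: type_ring_simps)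
  qed (use I.zero_closed in \<open>simp_all add: type_ring_simps\<close>)
  show "trunc_ideal (4 * Q) \<subseteq> (O_ideal Q :: 'a poly3 set)"
  proof
    fix p :: "'a poly3" assume p: "p \<in> trunc_ideal (4 * Q)"
    have "Poly_Mapping.single k (Poly_Mapping.lookup p k) \<in> O_ideal Q" if k: "k \<in> Poly_Mapping.keys p" for k
    proof -
      obtain a b c where abc: "k = (a, b, c)" by (cases k)
      define v where "v = Poly_Mapping.lookup p k"
      from k p have "4 * Q \<le> a \<or> 4 * Q \<le> b \<or> 4 * Q \<le> c"
        unfolding abc trunc_ideal_def in_keys_iff by (metis (mono_tags, lifting) mem_Collect_eq not_le)
      then have "\<exists>q. \<exists>g\<in>?G. Poly_Mapping.single k v = q * g"
      proof (elim disjE)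
        assume "4 * Q \<le> a"
        then have "Poly_Mapping.single k v = Poly_Mapping.single (a - 4 * Q, b, c) v * var_x ^ (4 * Q)"
          by (simp add: abc var_x_power mult_single)
        then show ?thesis by blast
      next
        assume "4 * Q \<le> b"
        then have "Poly_Mapping.single k v = Poly_Mapping.single (a, b - 4 * Q, c) v * var_y ^ (4 * Q)"
          by (simp add: abc var_y_power mult_single)
        then show ?thesis by blast
      next
        assume "4 * Q \<le> c"
        then have "Poly_Mapping.single k v = Poly_Mapping.single (a, b, c - 4 * Q) v * var_z ^ (4 * Q)"
          by (simp add: abc var_z_power mult_single)
        then show ?thesis by blast
      qed
      then show ?thesis using gen mult unfolding v_def by auto
    qed
    then have "(\<Sum>k\<in>Poly_Mapping.keys p. Poly_Mapping.single k (Poly_Mapping.lookup p k)) \<in> O_ideal Q"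
      by (rule add)
    then show "p \<in> O_ideal Q" by (simp flip: poly_mapping_eq_sum_single)
  qed
qed

lemma ring_O_ring: "ring (O_ring Q)"
  unfolding O_ring_def O_ideal_eq by (rule ideal.quotient_is_ring[OF ideal_trunc_ideal])

lemma to_O_hom: "(to_O Q :: 'a::field poly3 \<Rightarrow> _) \<in> ring_hom type_ring (O_ring Q)"
proof -
  have *: "(to_O Q :: 'a poly3 \<Rightarrow> _) = (+>\<^bsub>type_ring\<^esub>) (trunc_ideal (4 * Q))"
    by (simp add: to_O_def O_ideal_eq fun_eq_iff)
  show ?thesis
    unfolding O_ring_def O_ideal_eq * by (rule ideal.rcos_ring_hom[OF ideal_trunc_ideal])
qed

lemma to_O_mult: "to_O Q p \<otimes>\<^bsub>O_ring Q\<^esub> to_O Q q = to_O Q (p * q)"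
  using ring_hom_mult[OF to_O_hom, of p q] by (simp add: type_ring_simps)

lemma to_O_add: "to_O Q p \<oplus>\<^bsub>O_ring Q\<^esub> to_O Q q = to_O Q (p + q)"
  using ring_hom_add[OF to_O_hom, of p q] by (simp add: type_ring_simps)

lemma to_O_carrier: "to_O Q p \<in> carrier (O_ring Q)"
  using ring_hom_closed[OF to_O_hom, of p] by (simp add: type_ring_simps)

lemma to_O_0: "\<zero>\<^bsub>O_ring Q\<^esub> = to_O Q (0 :: 'a::field poly3)"
proof -
  have "to_O Q (\<zero>\<^bsub>type_ring\<^esub> :: 'a poly3) = \<zero>\<^bsub>O_ring Q\<^esub>"
    by (rule ring_hom_zero[OF to_O_hom ring_type_ring ring_O_ring])
  then show ?thesis by (simp add: type_ring_simps)
qed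

lemma to_O_eq_iff: "to_O Q p = to_O Q q \<longleftrightarrow> p - q \<in> trunc_ideal (4 * Q)"
proof -
  interpret ring "type_ring :: 'a poly3 ring" by (rule ring_type_ring)
  show ?thesis
    using quotient_eq_iff_same_a_r_cos[OF ideal_trunc_ideal, of p q "4 * Q"]
    by (simp add: to_O_def O_ideal_eq type_ring_simps a_minus_def type_ring_uminus)
qed

lemma to_O_eq_0_iff: "to_O Q p = to_O Q 0 \<longleftrightarrow> p \<in> trunc_ideal (4 * Q)"
  by (simp add: to_O_eq_iff)

text \<open>
  The form of degree \<open>d\<close> in \<open>x\<close> and \<open>y\<close> with value \<open>f\<close> at \<open>y = 1\<close>, for \<open>f\<close> of degree at most \<open>d\<close>.
\<close>

definition bihom :: "nat \<Rightarrow> 'a::field poly \<Rightarrow> 'a poly3" where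
  "bihom = homogenize const3 var_x var_y"

interpretation bihom: coefficient_hom "const3 :: 'a::field \<Rightarrow> _" var_x var_y
  by standard (simp_all add: const3_def single_add mult_single)

lemmas bihom_mult = bihom.homogenize_mult[folded bihom_def]
lemmas bihom_add = bihom.homogenize_add[folded bihom_def]
lemmas bihom_0 = bihom.homogenize_0[folded bihom_def]
lemmas bihom_sum = bihom.homogenize_sum[folded bihom_def]
lemmas bihom_smult = bihom.homogenize_smult[folded bihom_def]
lemmas bihom_monom = bihom.homogenize_monom[folded bihom_def]

lemma const3_1 [simp]: "const3 1 = 1"
  by (simp add: const3_def flip: zero_prod_def)

lemma bihom_tvar: "bihom 2 tvar = var_x * var_y"
  using bihom_monom[of 1 2 1] by (simp flip: tvar_power)

lemma bihom_1: "bihom d 1 = var_y ^ d"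
  using bihom_monom[of 0 d 1] by simp

lemma bihom_cub: "bihom 3 cub = var_x ^ 3 + var_y ^ 3"
  using bihom_monom[of 3 3 1] by (simp add: cub_def bihom_add bihom_1 tvar_power add.commute)

lemma bihom_power:
  assumes "degree f \<le> d"
  shows "bihom (n * d) (f ^ n) = bihom d f ^ n"
proof (induction n)
  case 0
  show ?case by (simp add: bihom_1)
next
  case (Suc n)
  have "degree (f ^ n) \<le> n * d"
    using degree_power_le[of f n] assms by (metis le_trans mult.commute mult_le_mono2)
  then show ?case using Suc bihom_mult[OF assms, of "f ^ n" "n * d"] by simp
qed

lemma lookup_bihom_mult_var_z:
  "Poly_Mapping.lookup (bihom d f * var_z ^ n) (a, b, c)
    = (if c = n \<and> a + b = d then coeff f a else 0)"
proof -
  have "bihom d f * var_z ^ n = (\<Sum>i\<le>d. Poly_Mapping.single (i, d - i, n) (coeff f i))"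
    unfolding bihom_def homogenize_def sum_distrib_right monomial_eq_single ..
  then have "Poly_Mapping.lookup (bihom d f * var_z ^ n) (a, b, c)
      = (\<Sum>i\<le>d. Poly_Mapping.lookup (Poly_Mapping.single (i, d - i, n) (coeff f i)) (a, b, c))"
    by (simp only: lookup_sum)
  also have "\<dots> = (\<Sum>i\<le>d. if i = a then (if c = n \<and> a + b = d then coeff f a else 0) else 0)"
  proof (rule sum.cong[OF refl])
    fix i assume "i \<in> {..d}"
    then show "Poly_Mapping.lookup (Poly_Mapping.single (i, d - i, n) (coeff f i)) (a, b, c)
      = (if i = a then (if c = n \<and> a + b = d then coeff f a else 0) else 0)"
      by (auto simp: lookup_single when_def)
  qed
  finally show ?thesis by auto
qed

lemma bihom_in_trunc_ideal_iff:
  assumes "N > 0"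
  shows "bihom d f \<in> trunc_ideal N \<longleftrightarrow> (\<forall>a\<le>d. a < N \<longrightarrow> d - a < N \<longrightarrow> coeff f a = 0)"
proof -
  have l: "Poly_Mapping.lookup (bihom d f) (a, b, c) = (if c = 0 \<and> a + b = d then coeff f a else 0)" for a b c
    using lookup_bihom_mult_var_z[of d f 0] by simp
  show ?thesis
  proof
    assume R: "bihom d f \<in> trunc_ideal N"
    show "\<forall>a\<le>d. a < N \<longrightarrow> d - a < N \<longrightarrow> coeff f a = 0"
    proof (intro allI impI)
      fix a assume "a \<le> d" "a < N" "d - a < N"
      then have "Poly_Mapping.lookup (bihom d f) (a, d - a, 0) = 0"
        using R assms unfolding trunc_ideal_def by blast
      then show "coeff f a = 0" using \<open>a \<le> d\<close> by (simp add: l)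
    qed
  next
    assume "\<forall>a\<le>d. a < N \<longrightarrow> d - a < N \<longrightarrow> coeff f a = 0"
    then show "bihom d f \<in> trunc_ideal N" by (auto simp: trunc_ideal_def l)
  qed
qed

definition z_degree_le :: "nat \<Rightarrow> 'a::field poly3 \<Rightarrow> bool" where
  "z_degree_le n p \<longleftrightarrow> (\<forall>a b c. c > n \<longrightarrow> Poly_Mapping.lookup p (a, b, c) = 0)"

lemma z_degree_le_add: "z_degree_le n p \<Longrightarrow> z_degree_le n q \<Longrightarrow> z_degree_le n (p + q)"
  by (simp add: z_degree_le_def lookup_add)

lemma z_degree_le_mono: "z_degree_le m p \<Longrightarrow> m \<le> n \<Longrightarrow> z_degree_le n p"
  by (simp add: z_degree_le_def)

lemma z_degree_le_mult:
  assumes "z_degree_le m p" "z_degree_le n q"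
  shows "z_degree_le (m + n) (p * q)"
  unfolding z_degree_le_def
proof (intro allI impI, rule ccontr)
  fix a b c assume c: "c > m + n" and "Poly_Mapping.lookup (p * q) (a, b, c) \<noteq> 0"
  then have "(a, b, c) \<in> Poly_Mapping.keys (p * q)" by (simp add: in_keys_iff)
  then obtain k l where kl: "k \<in> Poly_Mapping.keys p" "l \<in> Poly_Mapping.keys q" "(a, b, c) = k + l"
    using keys_mult[of p q] by fast
  obtain a1 b1 c1 where k: "k = (a1, b1, c1)" by (cases k)
  obtain a2 b2 c2 where l: "l = (a2, b2, c2)" by (cases l)
  have "c1 \<le> m" using kl(1) assms(1) unfolding k z_degree_le_def in_keys_iff by (meson not_le)
  moreover have "c2 \<le> n" using kl(2) assms(2) unfolding l z_degree_le_def in_keys_iff by (meson not_le)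
  moreover have "c = c1 + c2" using kl(3) by (simp add: k l)
  ultimately show False using c by simp
qed

lemma z_degree_le_bihom: "z_degree_le n (bihom d f * var_z ^ n)"
  by (simp add: z_degree_le_def lookup_bihom_mult_var_z)

lemma P_poly_power_leading:
  "k \<ge> 1 \<Longrightarrow> \<exists>r. (P_poly :: 'a::field poly3) ^ k = var_z ^ (4 * k) + r \<and> z_degree_le (4 * k - 1) r"
proof (induction k rule: nat_induct_at_least)
  define t where "t = var_x * var_y * var_z ^ 2 + (var_x ^ 3 + var_y ^ 3) * (var_z :: 'a poly3)"
  have P: "P_poly = var_z ^ 4 + t" by (simp add: P_poly_def t_def add.assoc)
  have t: "z_degree_le 3 t"
  proof -
    have "z_degree_le 3 (var_x * var_y * (var_z :: 'a poly3) ^ 2)"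
      using z_degree_le_bihom[of 2 2 "tvar :: 'a poly"] unfolding bihom_tvar
      by (rule z_degree_le_mono) simp
    moreover have "z_degree_le 3 ((var_x ^ 3 + var_y ^ 3) * (var_z :: 'a poly3))"
      using z_degree_le_bihom[of 1 3 "cub :: 'a poly"] unfolding bihom_cub power_one_right
      by (rule z_degree_le_mono) simp
    ultimately show ?thesis unfolding t_def by (rule z_degree_le_add)
  qed
  {
    case base
    show ?case using P t by auto
  next
    case (Suc k)
    then obtain r :: "'a poly3"
      where r: "P_poly ^ k = var_z ^ (4 * k) + r" "z_degree_le (4 * k - 1) r" by blast
    have z: "z_degree_le n (var_z ^ n :: 'a poly3)" for n
      by (simp add: z_degree_le_def var_z_power lookup_single)
    have "P_poly ^ Suc k = var_z ^ (4 * Suc k) + (var_z ^ 4 * r + t * var_z ^ (4 * k) + t * r)"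
      unfolding power_Suc r(1) unfolding P by (simp add: algebra_simps power_add)
    moreover have "z_degree_le (4 * Suc k - 1) (var_z ^ 4 * r + t * var_z ^ (4 * k) + t * r)"
      using z_degree_le_mult[OF z[of 4] r(2)] z_degree_le_mult[OF t z[of "4 * k"]] z_degree_le_mult[OF t r(2)] Suc(1)
      by (intro z_degree_le_add) (auto elim!: z_degree_le_mono)
    ultimately show ?case by blast
  }
qed

lemma lookup_bihom_P_power:
  assumes "c \<ge> 4 * k"
  shows "Poly_Mapping.lookup (bihom d f * P_poly ^ k) (a, b, c)
    = Poly_Mapping.lookup (bihom d f * var_z ^ (4 * k)) (a, b, c)"
proof (cases "k \<ge> 1")
  case True
  then obtain r where r: "(P_poly :: 'a poly3) ^ k = var_z ^ (4 * k) + r" "z_degree_le (4 * k - 1) r"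
    using P_poly_power_leading by blast
  have "z_degree_le (0 + (4 * k - 1)) (bihom d f * r)"
    using z_degree_le_bihom[of 0 d f] r(2) by (intro z_degree_le_mult) simp_all
  then have "Poly_Mapping.lookup (bihom d f * r) (a, b, c) = 0"
    using assms True by (simp add: z_degree_le_def)
  then show ?thesis by (simp add: r distrib_left lookup_add)
next
  case False
  then have "k = 0" by simp
  then show ?thesis by simp
qed

text \<open>
  \<open>P\<close> is monic of degree \<open>4\<close> in \<open>z\<close>. Hence the coefficient of the highest power of \<open>P\<close> is also the
  coefficient of the highest power of \<open>z\<close>, and the expansion can be peeled from the top.
\<close>

lemma P_adic_expansion_in_trunc_ideal:
  fixes f :: "nat \<Rightarrow> 'a::field poly"
  assumes "(\<Sum>k\<le>K. bihom (d k) (f k) * P_poly ^ k) + bihom e U * var_z + bihom e' V * var_z ^ 2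
      \<in> trunc_ideal N" and "4 * K < N" and "2 < N"
  shows "(\<forall>k\<le>K. bihom (d k) (f k) \<in> trunc_ideal N) \<and>
    bihom e U \<in> trunc_ideal N \<and> bihom e' V \<in> trunc_ideal N"
  using assms
proof (induction K)
  case 0
  let ?p = "bihom (d 0) (f 0) * var_z ^ 0 + bihom e U * var_z ^ 1 + bihom e' V * var_z ^ 2"
  have p: "?p \<in> trunc_ideal N" using 0 by simp
  have mem: "bihom x g \<in> trunc_ideal N"
    if "\<And>a b. a < N \<Longrightarrow> b < N \<Longrightarrow> a + b = x \<Longrightarrow> coeff g a = 0" for x and g :: "'a poly"
    using that 0 by (subst bihom_in_trunc_ideal_iff) auto
  have l: "(if c = 0 \<and> a + b = d 0 then coeff (f 0) a else 0) + (if c = 1 \<and> a + b = e then coeff U a else 0)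
    + (if c = 2 \<and> a + b = e' then coeff V a else 0) = 0" if "a < N" "b < N" "c \<in> {0, 1, 2}" for a b c :: nat
  proof -
    have "c < N" using that 0 by auto
    then have "Poly_Mapping.lookup ?p (a, b, c) = 0"
      using p that(1,2) unfolding trunc_ideal_def by blast
    then show ?thesis unfolding lookup_add lookup_bihom_mult_var_z .
  qed
  have "bihom (d 0) (f 0) \<in> trunc_ideal N"
  proof (rule mem)
    fix a b assume "a < N" "b < N" "a + b = d 0"
    then show "coeff (f 0) a = 0" using l[of a b 0] by simp
  qed
  moreover have "bihom e U \<in> trunc_ideal N"
  proof (rule mem)
    fix a b assume "a < N" "b < N" "a + b = e"
    then show "coeff U a = 0" using l[of a b 1] by simp
  qed
  moreover have "bihom e' V \<in> trunc_ideal N"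
  proof (rule mem)
    fix a b assume "a < N" "b < N" "a + b = e'"
    then show "coeff V a = 0" using l[of a b 2] by simp
  qed
  ultimately show ?case by simp
next
  case (Suc K)
  let ?r = "(\<Sum>k\<le>K. bihom (d k) (f k) * P_poly ^ k) + bihom e U * var_z + bihom e' V * var_z ^ 2"
  let ?t = "bihom (d (Suc K)) (f (Suc K))"
  have rt: "?t * P_poly ^ Suc K + ?r \<in> trunc_ideal N"
    using Suc(2) by (simp add: ac_simps)
  have "Poly_Mapping.lookup ?r (a, b, 4 * Suc K) = 0" for a b
  proof -
    have "Poly_Mapping.lookup (bihom (d k) (f k) * P_poly ^ k) (a, b, 4 * Suc K) = 0" if "k \<le> K" for k
      using that by (subst lookup_bihom_P_power) (simp_all add: lookup_bihom_mult_var_z)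
    then show ?thesis
      using lookup_bihom_mult_var_z[of e U 1 a b "4 * Suc K"] lookup_bihom_mult_var_z[of e' V 2 a b "4 * Suc K"]
      by (simp add: lookup_add lookup_sum)
  qed
  then have lk: "Poly_Mapping.lookup (?t * P_poly ^ Suc K + ?r) (a, b, 4 * Suc K)
      = (if a + b = d (Suc K) then coeff (f (Suc K)) a else 0)" for a b
    unfolding lookup_add by (subst lookup_bihom_P_power) (simp_all add: lookup_bihom_mult_var_z del: power_Suc)
  have "coeff (f (Suc K)) a = 0" if "a < N" "b < N" "a + b = d (Suc K)" for a b
  proof -
    have "Poly_Mapping.lookup (?t * P_poly ^ Suc K + ?r) (a, b, 4 * Suc K) = 0"
      using rt that(1,2) Suc(3) unfolding trunc_ideal_def by blast
    then show ?thesis unfolding lk using that(3) by simp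
  qed
  then have t: "?t \<in> trunc_ideal N"
    using Suc(3) by (subst bihom_in_trunc_ideal_iff) auto
  then have "P_poly ^ Suc K * ?t \<in> trunc_ideal N" by (rule trunc_ideal_mult)
  then have "(?t * P_poly ^ Suc K + ?r) - P_poly ^ Suc K * ?t \<in> trunc_ideal N"
    using rt by (intro trunc_ideal_diff)
  then have "?r \<in> trunc_ideal N" by (simp add: mult.commute del: power_Suc)
  then have "(\<forall>k\<le>K. bihom (d k) (f k) \<in> trunc_ideal N) \<and>
    bihom e U \<in> trunc_ideal N \<and> bihom e' V \<in> trunc_ideal N"
    using Suc(3,4) by (intro Suc(1)) auto
  then show ?case using t by (auto simp: le_Suc_eq)
qed

section \<open>Powers of \<open>z\<close> modulo \<open>P\<close> and the kernel of \<open>g\<^sub>\<alpha>\<close>\<close>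

lemma poly3_add_self:
  assumes "CHAR('a::field) = 2"
  shows "(p :: 'a poly3) + p = 0"
  by (rule poly_mapping_eqI) (simp only: lookup_add char2_add_self[OF assms] lookup_zero)

lemma degree_frob_rem: "degree (frob_rem n :: 'a::field poly) \<le> 2 ^ n - 2"
  using palindromic_frob_rem[of n, where 'a = 'a] by (simp add: palindromic_def)

text \<open>
  The coefficient of \<open>P ^ (2 ^ i)\<close> in the \<open>P\<close>-adic expansion of \<open>z ^ (2 ^ (m + 1))\<close>.
\<close>

definition frob_coeff :: "nat \<Rightarrow> nat \<Rightarrow> 'a::field poly" where
  "frob_coeff m i = frob_rem (m - i) ^ (2 ^ Suc i)"

text \<open>
  Let \<open>w (Y)\<close> be the sum of \<open>frob_coeff m i * Y ^ (2 ^ i)\<close> over \<open>i < m\<close>, and \<open>c = \<alpha> t\<^sup>2\<close>. This is the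
  coefficient of \<open>Y ^ k\<close> in \<open>(w (Y) + w (c)) / (Y + c)\<close>.
\<close>

definition cofactor_coeff :: "'a::field \<Rightarrow> nat \<Rightarrow> nat \<Rightarrow> 'a poly" where
  "cofactor_coeff \<alpha> m k =
    (\<Sum>i<m. if k < 2 ^ i then frob_coeff m i * smult \<alpha> (tvar ^ 2) ^ (2 ^ i - 1 - k) else 0)"

lemma palindromic_frob_coeff:
  assumes "i < m"
  shows "palindromic (2 ^ Suc m - 4 * 2 ^ i) (frob_coeff m i)"
proof -
  have "palindromic (2 ^ Suc i * (2 ^ (m - i) - 2)) (frob_coeff m i)"
    unfolding frob_coeff_def by (intro palindromic_power palindromic_frob_rem)
  moreover have "2 ^ Suc i * (2 ^ (m - i) - 2) = 2 ^ Suc m - 4 * (2::nat) ^ i"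
  proof -
    have "2 ^ i * 2 ^ (m - i) = (2::nat) ^ m" using assms by (simp flip: power_add)
    then show ?thesis by (simp add: diff_mult_distrib2)
  qed
  ultimately show ?thesis by simp
qed

lemma palindromic_smult_tvar_sq: "palindromic 4 (smult \<alpha> (tvar ^ 2))"
  using palindromic_power[OF palindromic_tvar, of 2] by (intro palindromic_smult) simp

lemma palindromic_cofactor_term:
  assumes "i < m" "k < 2 ^ i"
  shows "palindromic (2 ^ Suc m - 4 - 4 * k) (frob_coeff m i * smult \<alpha> (tvar ^ 2) ^ (2 ^ i - 1 - k))"
proof -
  have "palindromic ((2 ^ Suc m - 4 * 2 ^ i) + (2 ^ i - 1 - k) * 4)
      (frob_coeff m i * smult \<alpha> (tvar ^ 2) ^ (2 ^ i - 1 - k))"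
    using assms by (intro palindromic_mult palindromic_power palindromic_frob_coeff palindromic_smult_tvar_sq)
  moreover have "4 * 2 ^ i \<le> (2::nat) ^ Suc m"
  proof -
    have "(2::nat) ^ (2 + i) \<le> 2 ^ Suc m" using assms by (intro power_increasing) auto
    then show ?thesis by (simp add: power_add)
  qed
  then have "(2 ^ Suc m - 4 * 2 ^ i) + (2 ^ i - 1 - k) * 4 = 2 ^ Suc m - 4 - 4 * k"
    using assms(2) by linarith
  ultimately show ?thesis by simp
qed

lemma palindromic_cofactor_coeff: "palindromic (2 ^ Suc m - 4 - 4 * k) (cofactor_coeff \<alpha> m k)"
  unfolding cofactor_coeff_def
proof (rule palindromic_sum)
  fix i assume "i \<in> {..<m}"
  then show "palindromic (2 ^ Suc m - 4 - 4 * k)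
      (if k < 2 ^ i then frob_coeff m i * smult \<alpha> (tvar ^ 2) ^ (2 ^ i - 1 - k) else 0)"
    using palindromic_cofactor_term[of i m k \<alpha>] by (cases "k < 2 ^ i") (simp_all only: if_True if_False lessThan_iff palindromic_0)
qed

lemma cofactor_coeff_top:
  shows "cofactor_coeff \<alpha> (Suc j) (2 ^ j - 1) = 1"
proof -
  have "\<not> 2 ^ j - 1 < (2::nat) ^ i" if "i < j" for i
    using power_strict_increasing[OF that, of "2::nat"] by linarith
  then show ?thesis by (simp add: cofactor_coeff_def frob_coeff_def)
qed

lemma g_poly_eq: "g_poly (\<alpha> :: 'a::field) = P_poly + bihom 4 (smult \<alpha> (tvar ^ 2))"
proof -
  have "bihom (2 * 2) (tvar ^ 2) = (bihom 2 tvar :: 'a poly3)\<^sup>2"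
    by (rule bihom_power) simp
  then show ?thesis
    by (simp add: g_poly_def bihom_smult bihom_tvar power_mult_distrib mult.assoc)
qed

definition P_combination :: "nat \<Rightarrow> (nat \<Rightarrow> 'a::field poly) \<Rightarrow> 'a poly3" where
  "P_combination Q f = (\<Sum>k<Q. bihom (6 * Q - 5 - 4 * k) (f k) * P_poly ^ k)"

context
  fixes ty :: "'a::field itself"
  assumes char2: "CHAR('a) = 2"
begin

declare poly3_add_self [OF char2, simp]

lemma poly3_add_self_left [simp]: "(p :: 'a poly3) + (p + q) = q"
  by (simp flip: add.assoc)

lemma poly3_minus_eq_add: "(p :: 'a poly3) - q = p + q"
  by (metis add_diff_cancel_right' poly3_add_self_left add.commute)

lemma poly3_square_add: "((p :: 'a poly3) + q)\<^sup>2 = p\<^sup>2 + q\<^sup>2"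
  by (simp add: power2_eq_square algebra_simps)

lemma poly3_square_sum: "(sum f A :: 'a poly3)\<^sup>2 = (\<Sum>x\<in>A. (f x)\<^sup>2)"
  by (induction A rule: infinite_finite_induct) (simp_all add: poly3_square_add)

text \<open>
  Squaring is additive, and \<open>z\<^sup>4 = P + x y z\<^sup>2 + (x\<^sup>3 + y\<^sup>3) z\<close> removes the square of \<open>z\<^sup>2\<close>. So only the
  powers \<open>P ^ (2 ^ i)\<close> and a remainder in \<open>z\<close> and \<open>z\<^sup>2\<close> ever appear.
\<close>

lemma var_z_frobenius_power:
  "var_z ^ (2 ^ Suc n) = bihom (2 ^ Suc n - 2) (frob_rem (Suc n)) * var_z ^ 2
    + bihom (2 ^ Suc n - 1) (frob_rem n ^ 2 * cub) * var_z
    + (\<Sum>i<n. bihom (2 ^ Suc n - 2 ^ (i + 2)) (frob_rem (n - i) ^ (2 ^ Suc i)) * (P_poly :: 'a poly3) ^ (2 ^ i))"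
proof (induction n)
  case 0
  show ?case by (simp add: bihom_1 bihom_0)
next
  case (Suc n)
  define N where "N = (2::nat) ^ n"
  have N: "N \<ge> 1" by (simp add: N_def)
  have sq: "(bihom d f)\<^sup>2 = bihom (2 * d) (f\<^sup>2)" if "degree f \<le> d" for d and f :: "'a poly"
    using bihom_power[OF that, of 2] by simp
  have z4: "(var_z ^ 2)\<^sup>2 = P_poly + bihom 2 tvar * var_z ^ 2 + bihom 3 cub * (var_z :: 'a poly3)"
    unfolding bihom_tvar bihom_cub P_poly_def by (simp add: algebra_simps flip: power_mult)
  let ?A = "frob_rem (Suc n) :: 'a poly" and ?B = "frob_rem n :: 'a poly"
  have dA: "degree ?A \<le> 2 * N - 2" using degree_frob_rem[of "Suc n"] by (simp add: N_def)
  have dB: "degree (?B\<^sup>2 * cub) \<le> 2 * N - 1"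
  proof (cases "n = 0")
    case False
    have "degree (?B\<^sup>2) \<le> 2 * (N - 2)"
      using degree_power_le[of ?B 2] degree_frob_rem[of n, where 'a = 'a] unfolding N_def by simp
    moreover have "N \<ge> 2" using False unfolding N_def by (cases n) auto
    ultimately show ?thesis using degree_mult_le[of "?B\<^sup>2" cub] by simp
  qed simp
  have dA2: "degree (?A\<^sup>2) \<le> 4 * N - 4"
    using degree_power_le[of ?A 2] dA by simp
  have a1: "bihom (4 * N - 4) (?A\<^sup>2) * bihom 2 tvar = bihom (4 * N - 2) (?A\<^sup>2 * tvar)"
  proof -
    have "4 * N - 4 + 2 = 4 * N - 2" using N by simp
    then show ?thesis using bihom_mult[OF dA2, of tvar 2] by simp
  qed
  have a2: "bihom (4 * N - 4) (?A\<^sup>2) * bihom 3 cub = bihom (4 * N - 1) (?A\<^sup>2 * cub)"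
  proof -
    have "4 * N - 4 + 3 = 4 * N - 1" using N by simp
    then show ?thesis using bihom_mult[OF dA2, of cub 3] by simp
  qed
  have zz: "2 ^ Suc n = 2 * N" "2 ^ Suc (Suc n) = 4 * N" by (simp_all add: N_def)
  have sqterm: "(bihom (2 * N - 2 ^ (i + 2)) (frob_rem (n - i) ^ (2 ^ Suc i)) * (P_poly :: 'a poly3) ^ (2 ^ i))\<^sup>2
      = bihom (4 * N - 2 ^ (Suc i + 2)) (frob_rem (Suc n - Suc i) ^ (2 ^ Suc (Suc i))) * P_poly ^ (2 ^ Suc i)"
    if i: "i < n" for i
  proof -
    let ?R = "frob_rem (n - i) :: 'a poly"
    have "degree (?R ^ (2 ^ Suc i)) \<le> (2 ^ (n - i) - 2) * 2 ^ Suc i"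
      using degree_power_le[of ?R "2 ^ Suc i"] degree_frob_rem[of "n - i", where 'a = 'a]
      by (meson le_trans mult_le_mono1)
    also have "\<dots> = 2 * N - 2 ^ (i + 2)"
    proof -
      have "2 ^ (n - i) * 2 ^ i = N" using i by (simp add: N_def flip: power_add)
      then show ?thesis by (simp add: diff_mult_distrib mult.left_commute)
    qed
    finally have "(bihom (2 * N - 2 ^ (i + 2)) (?R ^ (2 ^ Suc i)))\<^sup>2
        = bihom (2 * (2 * N - 2 ^ (i + 2))) ((?R ^ (2 ^ Suc i))\<^sup>2)"
      by (rule sq)
    moreover have "2 * (2 * N - 2 ^ (i + 2)) = 4 * N - 2 ^ (Suc i + 2)" by simp
    moreover have "(?R ^ (2 ^ Suc i))\<^sup>2 = ?R ^ (2 ^ Suc (Suc i))"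
      by (simp add: mult.commute flip: power_mult)
    moreover have "(P_poly ^ (2 ^ i))\<^sup>2 = (P_poly :: 'a poly3) ^ (2 ^ Suc i)"
      by (simp add: mult.commute flip: power_mult)
    ultimately show ?thesis by (simp only: power_mult_distrib diff_Suc_Suc)
  qed
  have "var_z ^ (2 ^ Suc (Suc n)) = (var_z ^ (2 ^ Suc n) :: 'a poly3)\<^sup>2"
    by (simp add: mult.commute flip: power_mult)
  also have "\<dots> = (bihom (2 * N - 2) ?A)\<^sup>2 * (var_z ^ 2)\<^sup>2 + (bihom (2 * N - 1) (?B\<^sup>2 * cub))\<^sup>2 * var_z\<^sup>2
    + (\<Sum>i<n. (bihom (2 * N - 2 ^ (i + 2)) (frob_rem (n - i) ^ (2 ^ Suc i)) * P_poly ^ (2 ^ i))\<^sup>2)"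
    unfolding Suc unfolding zz poly3_square_add poly3_square_sum by (simp only: power_mult_distrib)
  also have "(bihom (2 * N - 2) ?A)\<^sup>2 = bihom (4 * N - 4) (?A\<^sup>2)"
    using sq[OF dA] by (simp add: diff_mult_distrib2)
  also have "(bihom (2 * N - 1) (?B\<^sup>2 * cub))\<^sup>2 = bihom (4 * N - 2) ((?B\<^sup>2 * cub)\<^sup>2)"
    using sq[OF dB] by (simp add: diff_mult_distrib2)
  also have "(\<Sum>i<n. (bihom (2 * N - 2 ^ (i + 2)) (frob_rem (n - i) ^ (2 ^ Suc i)) * P_poly ^ (2 ^ i))\<^sup>2)
     = (\<Sum>i<n. bihom (4 * N - 2 ^ (Suc i + 2)) (frob_rem (Suc n - Suc i) ^ (2 ^ Suc (Suc i))) * (P_poly :: 'a poly3) ^ (2 ^ Suc i))"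
    using sqterm by (intro sum.cong) auto
  also have "bihom (4 * N - 4) (?A\<^sup>2) * (var_z ^ 2)\<^sup>2 + bihom (4 * N - 2) ((?B\<^sup>2 * cub)\<^sup>2) * var_z\<^sup>2
      + (\<Sum>i<n. bihom (4 * N - 2 ^ (Suc i + 2)) (frob_rem (Suc n - Suc i) ^ (2 ^ Suc (Suc i))) * (P_poly :: 'a poly3) ^ (2 ^ Suc i))
    = (bihom (4 * N - 2) (?A\<^sup>2 * tvar) + bihom (4 * N - 2) ((?B\<^sup>2 * cub)\<^sup>2)) * var_z ^ 2
      + bihom (4 * N - 1) (?A\<^sup>2 * cub) * var_z
      + (bihom (4 * N - 4) (?A\<^sup>2) * P_poly + (\<Sum>i<n. bihom (4 * N - 2 ^ (Suc i + 2)) (frob_rem (Suc n - Suc i) ^ (2 ^ Suc (Suc i))) * (P_poly :: 'a poly3) ^ (2 ^ Suc i)))"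
    unfolding z4 a1[symmetric] a2[symmetric] by (simp only: distrib_left distrib_right ac_simps)
  also have "bihom (4 * N - 2) (?A\<^sup>2 * tvar) + bihom (4 * N - 2) ((?B\<^sup>2 * cub)\<^sup>2)
      = bihom (4 * N - 2) (frob_rem (Suc (Suc n)))"
    unfolding bihom_add[symmetric] by (simp add: power_mult_distrib mult.commute flip: power_mult)
  also have "bihom (4 * N - 4) (?A\<^sup>2) * P_poly + (\<Sum>i<n. bihom (4 * N - 2 ^ (Suc i + 2)) (frob_rem (Suc n - Suc i) ^ (2 ^ Suc (Suc i))) * (P_poly :: 'a poly3) ^ (2 ^ Suc i))
    = (\<Sum>i<Suc n. bihom (4 * N - 2 ^ (i + 2)) (frob_rem (Suc n - i) ^ (2 ^ Suc i)) * P_poly ^ (2 ^ i))"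
    by (simp add: sum.lessThan_Suc_shift del: sum.lessThan_Suc)
  finally show ?case unfolding zz .
qed

lemma at_square_frob_rem: "at_square (frob_rem n) = (frob_rem n :: 'a poly)\<^sup>2"
proof (induction n rule: frob_rem.induct)
  case (3 n)
  have d6: "at_square (cub :: 'a poly) = cub\<^sup>2"
    unfolding at_square_cub unfolding cub_def poly_power2_add[OF char2] by (simp flip: power_mult)
  show ?case
    by (simp only: frob_rem.simps at_square_add at_square_mult at_square_power at_square_tvar d6 3
        poly_power2_add[OF char2] power_mult_distrib) (simp flip: power_mult)
qed (simp_all add: at_square_1, simp add: at_square_def)

lemma at_square_smult: "at_square (smult a p) = smult a (at_square p)"
  by (simp add: at_square_def pcompose_smult)

lemma at_square_obstruction:
  "at_square (obstruction (\<alpha>::'a) m) = (\<Sum>i<m. frob_coeff m i * smult \<alpha> (tvar ^ 2) ^ (2 ^ i))"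
proof (induction m)
  case 0
  show ?case by (simp add: at_square_def)
next
  case (Suc m)
  have sq: "(\<Sum>i<m. F i)\<^sup>2 = (\<Sum>i<m. (F i)\<^sup>2)" for F :: "nat \<Rightarrow> 'a poly"
    by (induction m) (simp_all add: poly_power2_add[OF char2])
  have "at_square (obstruction \<alpha> (Suc m)) = smult \<alpha> (tvar ^ 2 * frob_rem (Suc m) ^ 2) + (at_square (obstruction \<alpha> m))\<^sup>2"
    by (simp add: at_square_add at_square_mult at_square_power at_square_tvar at_square_frob_rem at_square_smult
        del: frob_rem.simps)
  also have "smult \<alpha> (tvar ^ 2 * frob_rem (Suc m) ^ 2)
      = frob_coeff (Suc m) 0 * smult \<alpha> (tvar ^ 2) ^ (2 ^ 0)"
    by (simp add: frob_coeff_def power2_eq_square ac_simps del: frob_rem.simps)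
  also have "(at_square (obstruction \<alpha> m))\<^sup>2
      = (\<Sum>i<m. frob_coeff (Suc m) (Suc i) * smult \<alpha> (tvar ^ 2) ^ (2 ^ Suc i))"
    unfolding Suc sq frob_coeff_def power_mult_distrib
    by (intro sum.cong refl) (simp add: mult.commute flip: power_mult)
  finally show ?case
    by (simp only: sum.lessThan_Suc_shift)
qed

lemma geometric_sum_char2:
  "((x :: 'a poly3) + c) * (\<Sum>k<M. c ^ (M - 1 - k) * x ^ k) = x ^ M + c ^ M"
  using diff_power_eq_sum[of x "M - 1" c] power_diff_sumr2[of x M c]
  unfolding poly3_minus_eq_add by (simp add: mult.commute)

text \<open>
  In the notation of \<open>cofactor_coeff\<close>, \<open>g\<^sub>\<alpha> = P + c\<close> times the cofactor is \<open>w (P) + w (c)\<close>. The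
  expansion of \<open>z ^ (4 * Q)\<close> evaluates \<open>w (P)\<close>, and \<open>w (c)\<close> is the obstruction.
\<close>

lemma g_poly_mult_cofactor:
  fixes \<alpha> :: 'a
  assumes Q: "Q = 2 ^ j"
  shows "g_poly \<alpha> * (\<Sum>k<Q. bihom (4 * Q - 4 - 4 * k) (cofactor_coeff \<alpha> (Suc j) k) * P_poly ^ k)
    = var_z ^ (4 * Q) + bihom (4 * Q) (at_square (obstruction \<alpha> (Suc j)))
      + bihom (4 * Q - 1) (frob_rem (Suc j) ^ 2 * cub) * var_z
      + bihom (4 * Q - 2) (frob_rem (Suc (Suc j))) * var_z ^ 2"
proof -
  define c where "c = bihom 4 (smult \<alpha> (tvar ^ 2))"
  have Q4: "2 ^ Suc (Suc j) = 4 * Q" by (simp add: Q)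
  let ?C = "\<lambda>i. bihom (4 * Q - 4 * 2 ^ i) (frob_coeff (Suc j) i) :: 'a poly3"
  have pd: "degree p \<le> d" if "palindromic d p" for d and p :: "'a poly"
    using that by (simp add: palindromic_def)
  have cpow: "bihom (e * 4) (smult \<alpha> (tvar ^ 2) ^ e) = c ^ e" for e
    unfolding c_def by (rule bihom_power) (rule pd[OF palindromic_smult_tvar_sq])
  have iQ: "4 * 2 ^ i \<le> 4 * Q" if "i < Suc j" for i
    using that unfolding Q by (simp add: power_increasing)
  have Ccpow: "bihom ((4 * Q - 4 * 2 ^ i) + e * 4) (frob_coeff (Suc j) i * smult \<alpha> (tvar ^ 2) ^ e)
      = ?C i * c ^ e" if "i < Suc j" for i e
    unfolding cpow[symmetric]
    by (rule bihom_mult[OF pd[OF palindromic_frob_coeff[OF that, unfolded Q4]]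
          pd[OF palindromic_power[OF palindromic_smult_tvar_sq]]])
  have cofactor_coeff: "bihom (4 * Q - 4 - 4 * k) (cofactor_coeff \<alpha> (Suc j) k)
      = (\<Sum>i<Suc j. if k < 2 ^ i then ?C i * c ^ (2 ^ i - 1 - k) else 0)" for k
    unfolding cofactor_coeff_def bihom_sum
  proof (rule sum.cong[OF refl])
    fix i assume i: "i \<in> {..<Suc j}"
    have e: "(4 * Q - 4 * 2 ^ i) + (2 ^ i - 1 - k) * 4 = 4 * Q - 4 - 4 * k" if "k < 2 ^ i"
      using that iQ[of i] i by auto
    show "bihom (4 * Q - 4 - 4 * k) (if k < 2 ^ i then frob_coeff (Suc j) i * smult \<alpha> (tvar ^ 2) ^ (2 ^ i - 1 - k) else 0)
      = (if k < 2 ^ i then ?C i * c ^ (2 ^ i - 1 - k) else 0)"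
      using Ccpow[of i "2 ^ i - 1 - k"] i e
      by (cases "k < 2 ^ i") (simp_all only: if_True if_False bihom_0 lessThan_iff)
  qed
  have "(\<Sum>k<Q. bihom (4 * Q - 4 - 4 * k) (cofactor_coeff \<alpha> (Suc j) k) * P_poly ^ k)
    = (\<Sum>i<Suc j. \<Sum>k<Q. if k < 2 ^ i then ?C i * (c ^ (2 ^ i - 1 - k) * P_poly ^ k) else 0)"
    unfolding cofactor_coeff sum_distrib_right by (subst sum.swap) (intro sum.cong refl, simp add: mult.assoc)
  also have "\<dots> = (\<Sum>i<Suc j. ?C i * (\<Sum>k<2 ^ i. c ^ (2 ^ i - 1 - k) * P_poly ^ k))"
  proof (rule sum.cong[OF refl])
    fix i assume "i \<in> {..<Suc j}"
    then have "{k \<in> {..<Q}. k < 2 ^ i} = {..<2 ^ i}" using iQ[of i] by auto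
    then show "(\<Sum>k<Q. if k < 2 ^ i then ?C i * (c ^ (2 ^ i - 1 - k) * P_poly ^ k) else 0)
      = ?C i * (\<Sum>k<2 ^ i. c ^ (2 ^ i - 1 - k) * P_poly ^ k)"
      by (simp add: sum_distrib_left flip: sum.inter_filter)
  qed
  finally have "g_poly \<alpha> * (\<Sum>k<Q. bihom (4 * Q - 4 - 4 * k) (cofactor_coeff \<alpha> (Suc j) k) * P_poly ^ k)
      = (\<Sum>i<Suc j. ?C i * ((P_poly + c) * (\<Sum>k<2 ^ i. c ^ (2 ^ i - 1 - k) * P_poly ^ k)))"
    by (simp only: g_poly_eq c_def[symmetric] sum_distrib_left mult.left_commute)
  also have "\<dots> = (\<Sum>i<Suc j. ?C i * P_poly ^ (2 ^ i)) + (\<Sum>i<Suc j. ?C i * c ^ (2 ^ i))"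
    by (simp only: geometric_sum_char2 distrib_left sum.distrib)
  also have "(\<Sum>i<Suc j. ?C i * c ^ (2 ^ i)) = bihom (4 * Q) (at_square (obstruction \<alpha> (Suc j)))"
    unfolding at_square_obstruction bihom_sum
  proof (rule sum.cong[OF refl])
    fix i assume i: "i \<in> {..<Suc j}"
    then have "(4 * Q - 4 * 2 ^ i) + 2 ^ i * 4 = 4 * Q" using iQ[of i] by simp
    then show "?C i * c ^ (2 ^ i) = bihom (4 * Q) (frob_coeff (Suc j) i * smult \<alpha> (tvar ^ 2) ^ (2 ^ i))"
      using Ccpow[of i "2 ^ i"] i by simp
  qed
  also have "(\<Sum>i<Suc j. ?C i * P_poly ^ (2 ^ i)) = var_z ^ (4 * Q)
      + bihom (4 * Q - 1) (frob_rem (Suc j) ^ 2 * cub) * var_z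
      + bihom (4 * Q - 2) (frob_rem (Suc (Suc j))) * var_z ^ 2"
  proof -
    have "(\<Sum>i<Suc j. bihom (4 * Q - 2 ^ (i + 2)) (frob_rem (Suc j - i) ^ (2 ^ Suc i)) * P_poly ^ (2 ^ i))
      = (\<Sum>i<Suc j. ?C i * P_poly ^ (2 ^ i))"
      by (intro sum.cong refl) (simp add: frob_coeff_def mult.commute)
    then show ?thesis
      using var_z_frobenius_power[of "Suc j"] unfolding Q4 by (simp add: ac_simps)
  qed
  finally show ?thesis by (simp only: ac_simps)
qed

lemma P_combination_multiple_cofactor:
  assumes Q: "Q = 2 ^ j" and s: "degree s \<le> 2 * Q - 1"
  shows "P_combination Q (\<lambda>k. s * cofactor_coeff (\<alpha>::'a) (Suc j) k)
    = bihom (2 * Q - 1) s * (\<Sum>k<Q. bihom (4 * Q - 4 - 4 * k) (cofactor_coeff \<alpha> (Suc j) k) * P_poly ^ k)"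
  unfolding P_combination_def sum_distrib_left
proof (rule sum.cong[OF refl])
  fix k assume "k \<in> {..<Q}"
  then have "(2 * Q - 1) + (4 * Q - 4 - 4 * k) = 6 * Q - 5 - 4 * k" by auto
  moreover have "degree (cofactor_coeff \<alpha> (Suc j) k) \<le> 4 * Q - 4 - 4 * k"
    using palindromic_cofactor_coeff[of "Suc j" k \<alpha>] by (simp add: palindromic_def Q)
  ultimately show "bihom (6 * Q - 5 - 4 * k) (s * cofactor_coeff \<alpha> (Suc j) k) * P_poly ^ k
    = bihom (2 * Q - 1) s * (bihom (4 * Q - 4 - 4 * k) (cofactor_coeff \<alpha> (Suc j) k) * P_poly ^ k)"
    using bihom_mult[OF s, of "cofactor_coeff \<alpha> (Suc j) k" "4 * Q - 4 - 4 * k"] by (simp only: mult.assoc)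
qed

lemma g_poly_mult_P_combination_cofactor:
  assumes Q: "Q = 2 ^ j" and s: "degree s \<le> 2 * Q - 1"
  shows "g_poly \<alpha> * P_combination Q (\<lambda>k. s * cofactor_coeff (\<alpha>::'a) (Suc j) k)
    = bihom (2 * Q - 1) s * var_z ^ (4 * Q)
      + bihom (6 * Q - 1) (s * at_square (obstruction \<alpha> (Suc j)))
      + bihom (6 * Q - 2) (s * (frob_rem (Suc j) ^ 2 * cub)) * var_z
      + bihom (6 * Q - 3) (s * frob_rem (Suc (Suc j))) * var_z ^ 2"
proof -
  have Q1: "Q \<ge> 1" by (simp add: Q)
  have dE: "degree (at_square (obstruction \<alpha> (Suc j))) \<le> 4 * Q"
  proof (rule degree_le, intro allI impI)
    fix i assume i: "i > 4 * Q"
    have "degree (obstruction \<alpha> (Suc j)) \<le> 2 * Q"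
      using palindromic_obstruction[of "Suc j" \<alpha>] by (simp add: palindromic_def Q)
    then show "coeff (at_square (obstruction \<alpha> (Suc j))) i = 0"
      unfolding coeff_at_square using i by (auto intro: coeff_eq_0 elim!: evenE simp del: obstruction.simps)
  qed
  have dU: "degree (frob_rem (Suc j) ^ 2 * cub :: 'a poly) \<le> 4 * Q - 1"
  proof -
    have "degree (frob_rem (Suc j) ^ 2 :: 'a poly) \<le> 2 * (2 * Q - 2)"
      using degree_power_le[of "frob_rem (Suc j) :: 'a poly" 2]
        degree_frob_rem[of "Suc j", where 'a = 'a] by (simp add: Q del: frob_rem.simps)
    then show ?thesis
      using degree_mult_le[of "frob_rem (Suc j) ^ 2" "cub :: 'a poly"] Q1 by simp
  qed
  have dV: "degree (frob_rem (Suc (Suc j)) :: 'a poly) \<le> 4 * Q - 2"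
    using degree_frob_rem[of "Suc (Suc j)", where 'a = 'a] by (simp add: Q del: frob_rem.simps)
  have e: "(2 * Q - 1) + 4 * Q = 6 * Q - 1" "(2 * Q - 1) + (4 * Q - 1) = 6 * Q - 2"
    "(2 * Q - 1) + (4 * Q - 2) = 6 * Q - 3" using Q1 by auto
  show ?thesis
    unfolding P_combination_multiple_cofactor[OF Q s] mult.left_commute[of "g_poly \<alpha>"]
      g_poly_mult_cofactor[OF Q]
      bihom_mult[OF s dE, unfolded e] bihom_mult[OF s dU, unfolded e] bihom_mult[OF s dV, unfolded e]
    by (simp only: distrib_left mult.assoc)
qed

text \<open>
  A kernel element agrees in \<open>O\<close> with its top coefficient \<open>s\<close> times the cofactor, and \<open>s\<close> kills the
  three error terms of \<open>g_poly_mult_cofactor\<close>. Adding that multiple of the cofactor removes the top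
  coefficient; after this, multiplication by \<open>g\<^sub>\<alpha> = P + c\<close> no longer reaches \<open>P ^ Q\<close>, and the
  remaining coefficients vanish in \<open>O\<close> one after another, from the highest power of \<open>P\<close> downwards.
\<close>

lemma kernel_P_combination:
  fixes f :: "nat \<Rightarrow> 'a poly"
  assumes Q: "Q = 2 ^ j" and deg: "\<And>k. k < Q \<Longrightarrow> degree (f k) \<le> 6 * Q - 5 - 4 * k"
    and ker: "g_poly \<alpha> * P_combination Q f \<in> trunc_ideal (4 * Q)"
  defines "s \<equiv> f (Q - 1)"
  shows "\<And>k. k < Q \<Longrightarrow>
      bihom (6 * Q - 5 - 4 * k) (f k + s * cofactor_coeff \<alpha> (Suc j) k) \<in> trunc_ideal (4 * Q)"
    and "bihom (6 * Q - 1) (s * at_square (obstruction \<alpha> (Suc j))) \<in> trunc_ideal (4 * Q)"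
    and "bihom (6 * Q - 2) (s * (frob_rem (Suc j) ^ 2 * cub)) \<in> trunc_ideal (4 * Q)"
    and "bihom (6 * Q - 3) (s * frob_rem (Suc (Suc j))) \<in> trunc_ideal (4 * Q)"
proof -
  let ?J = "trunc_ideal (4 * Q) :: 'a poly3 set"
  have Q1: "Q \<ge> 1" by (simp add: Q)
  \<comment> \<open>The error terms: \<open>E\<close> is free of \<open>z\<close>, and \<open>U\<close> and \<open>V\<close> belong to \<open>z\<close> and \<open>z\<^sup>2\<close>. Below, \<open>h\<close> is \<open>f\<close> without its top term, and \<open>G\<close> collects the coefficients of \<open>P ^ k\<close>.\<close>
  define K where "K = Q - 1"
  have QK: "Q = Suc K" using Q1 by (simp add: K_def)
  have ds: "degree s \<le> 2 * Q - 1" using deg[of "Q - 1"] Q1 unfolding s_def by simp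
  define E where "E = s * at_square (obstruction \<alpha> (Suc j))"
  define U where "U = s * (frob_rem (Suc j) ^ 2 * cub)"
  define V where "V = s * frob_rem (Suc (Suc j))"
  define h where "h k = f k + s * cofactor_coeff \<alpha> (Suc j) k" for k
  define b where "b k = bihom (6 * Q - 5 - 4 * k) (h k)" for k
  define c where "c = smult \<alpha> (tvar ^ 2)"
  have hK: "h K = 0"
    unfolding h_def K_def s_def[symmetric] unfolding Q cofactor_coeff_top by (simp add: poly_add_self[OF char2])
  have dh: "degree (h k) \<le> 6 * Q - 5 - 4 * k" if k: "k < Q" for k
  proof -
    have "degree (cofactor_coeff \<alpha> (Suc j) k) \<le> 4 * Q - 4 - 4 * k"
      using palindromic_cofactor_coeff[of "Suc j" k \<alpha>] by (simp add: palindromic_def Q)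
    then have "degree (s * cofactor_coeff \<alpha> (Suc j) k) \<le> 6 * Q - 5 - 4 * k"
      using ds degree_mult_le[of s "cofactor_coeff \<alpha> (Suc j) k"] k by linarith
    then show ?thesis unfolding h_def using deg[OF k] by (intro degree_add_le)
  qed
  define G where "G k = (if k = 0 then E else h (k - 1)) + c * h k" for k
  have dc: "degree c \<le> 4" unfolding c_def by (rule order.trans[OF degree_smult_le]) simp
  have bG: "bihom (6 * Q - 1 - 4 * k) (G k)
      = (if k = 0 then bihom (6 * Q - 1) E else b (k - 1)) + bihom 4 c * b k" if k: "k \<le> K" for k
  proof -
    have "4 + (6 * Q - 5 - 4 * k) = 6 * Q - 1 - 4 * k" using k QK by simp
    then have "bihom 4 c * b k = bihom (6 * Q - 1 - 4 * k) (c * h k)"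
      using bihom_mult[OF dc dh[of k]] k QK by (simp add: b_def)
    moreover have "6 * Q - 5 - 4 * (k - 1) = 6 * Q - 1 - 4 * k" if "k \<noteq> 0" using that k QK by simp
    ultimately show ?thesis by (cases "k = 0") (simp_all add: G_def bihom_add b_def)
  qed
  have gh: "g_poly \<alpha> * P_combination Q h + bihom (6 * Q - 1) E
    = (\<Sum>k\<le>K. bihom (6 * Q - 1 - 4 * k) (G k) * P_poly ^ k)"
  proof -
    have bK: "b K = 0" by (simp add: b_def hK bihom_0)
    have C: "P_combination Q h = (\<Sum>k\<le>K. b k * P_poly ^ k)"
      by (simp only: P_combination_def b_def QK lessThan_Suc_atMost)
    have "(\<Sum>k\<le>K. bihom (6 * Q - 1 - 4 * k) (G k) * P_poly ^ k)
      = (\<Sum>k\<le>K. (if k = 0 then bihom (6 * Q - 1) E else b (k - 1)) * P_poly ^ k)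
        + (\<Sum>k\<le>K. bihom 4 c * b k * P_poly ^ k)"
      unfolding sum.distrib[symmetric]
      by (rule sum.cong[OF refl]) (simp only: bG atMost_iff distrib_right)
    also have "(\<Sum>k\<le>K. (if k = 0 then bihom (6 * Q - 1) E else b (k - 1)) * P_poly ^ k)
      = bihom (6 * Q - 1) E + (\<Sum>k<K. b k * P_poly ^ Suc k)"
      by (simp add: sum.atMost_shift)
    also have "(\<Sum>k<K. b k * P_poly ^ Suc k) = P_poly * (\<Sum>k\<le>K. b k * P_poly ^ k)"
      by (simp add: bK sum_distrib_left mult.left_commute flip: lessThan_Suc_atMost)
    also have "(\<Sum>k\<le>K. bihom 4 c * b k * P_poly ^ k) = bihom 4 c * (\<Sum>k\<le>K. b k * P_poly ^ k)"
      by (simp only: sum_distrib_left mult.assoc)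
    finally show ?thesis
      unfolding g_poly_eq c_def[symmetric] C by (simp only: distrib_right ac_simps)
  qed
  have ch: "P_combination Q h = P_combination Q f + P_combination Q (\<lambda>k. s * cofactor_coeff \<alpha> (Suc j) k)"
    by (simp only: P_combination_def h_def bihom_add distrib_right sum.distrib)
  have "(\<Sum>k\<le>K. bihom (6 * Q - 1 - 4 * k) (G k) * P_poly ^ k)
      + bihom (6 * Q - 2) U * var_z + bihom (6 * Q - 3) V * var_z ^ 2
    = g_poly \<alpha> * P_combination Q f + bihom (2 * Q - 1) s * var_z ^ (4 * Q)"
    unfolding gh[symmetric] ch distrib_left
      g_poly_mult_P_combination_cofactor[OF Q ds, of \<alpha>, folded E_def U_def V_def]
    by (simp add: ac_simps)
  also have "\<dots> \<in> ?J"
    by (intro trunc_ideal_add ker trunc_ideal_mult)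
      (simp add: trunc_ideal_def var_z_power lookup_single)
  finally have "(\<forall>k\<le>K. bihom (6 * Q - 1 - 4 * k) (G k) \<in> ?J) \<and>
      bihom (6 * Q - 2) U \<in> ?J \<and> bihom (6 * Q - 3) V \<in> ?J"
    by (rule P_adic_expansion_in_trunc_ideal) (use QK in auto)
  then have GJ: "\<And>k. k \<le> K \<Longrightarrow> bihom (6 * Q - 1 - 4 * k) (G k) \<in> ?J"
    and UV: "bihom (6 * Q - 2) U \<in> ?J" "bihom (6 * Q - 3) V \<in> ?J" by auto
  have cancel: "p \<in> ?J" if "p + q * r \<in> ?J" "r \<in> ?J" for p q r
    using trunc_ideal_diff[OF that(1) trunc_ideal_mult[OF that(2), of q]] by simp
  have bJ: "b k \<in> ?J" if "k \<le> K" for k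
    using that
  proof (induction rule: inc_induct)
    case base
    show ?case by (simp add: b_def hK bihom_0)
  next
    case (step n)
    have "b n + bihom 4 c * b (Suc n) \<in> ?J"
      using GJ[of "Suc n"] bG[of "Suc n"] step by simp
    then show ?case using step(3) by (rule cancel)
  qed
  show "bihom (6 * Q - 5 - 4 * k) (f k + s * cofactor_coeff \<alpha> (Suc j) k) \<in> ?J" if "k < Q" for k
    using bJ[of k] that by (simp add: b_def h_def QK)
  show "bihom (6 * Q - 1) E \<in> ?J"
    using GJ[of 0] bG[of 0] bJ[of 0] by (auto intro: cancel)
  show "bihom (6 * Q - 2) U \<in> ?J" "bihom (6 * Q - 3) V \<in> ?J" by (rule UV)+
qed

end

section \<open>The space \<open>X\<close> and the dimension of the intersection\<close>

lemma coeff_mult_tvar_power: "coeff (p * tvar ^ n) i = (if i < n then 0 else coeff p (i - n))"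
  by (subst mult.commute) (simp add: tvar_power coeff_monom_mult)

lemma sum_lessThan_double_fold: "(\<Sum>i<2 * h. g i) = (\<Sum>i<h. g i + g (2 * h - 1 - i))"
  for g :: "nat \<Rightarrow> 'b::comm_monoid_add"
proof -
  have "{..<2 * h} = {..<h} \<union> {h..<2 * h}" by auto
  then have "(\<Sum>i<2 * h. g i) = sum g ({..<h} \<union> {h..<2 * h})"
    by (rule arg_cong)
  also have "\<dots> = (\<Sum>i<h. g i) + (\<Sum>i\<in>{h..<2 * h}. g i)"
    by (rule sum.union_disjoint) auto
  also have "(\<Sum>i\<in>{h..<2 * h}. g i) = (\<Sum>i<h. g (2 * h - 1 - i))"
    by (rule sum.reindex_bij_witness[of _ "\<lambda>i. 2 * h - 1 - i" "\<lambda>i. 2 * h - 1 - i"]) auto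
  finally show ?thesis by (simp add: sum.distrib)
qed

lemma bihom_palindromic:
  assumes "palindromic d f" "d = 2 * h - 1" "h > 0"
  shows "bihom d f = (\<Sum>i<h. const3 (coeff f i) * sym_pair i (d - i))"
proof -
  have "{..d} = {..<2 * h}" using assms by auto
  then have "bihom d f = (\<Sum>i<2 * h. const3 (coeff f i) * var_x ^ i * var_y ^ (d - i))"
    by (simp add: bihom_def homogenize_def)
  also have "\<dots> = (\<Sum>i<h. const3 (coeff f i) * var_x ^ i * var_y ^ (d - i)
      + const3 (coeff f (2 * h - 1 - i)) * var_x ^ (2 * h - 1 - i) * var_y ^ (d - (2 * h - 1 - i)))"
    by (rule sum_lessThan_double_fold)
  also have "\<dots> = (\<Sum>i<h. const3 (coeff f i) * sym_pair i (d - i))"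
  proof (rule sum.cong[OF refl])
    fix i assume "i \<in> {..<h}"
    then have i: "i \<le> d" "d - (d - i) = i" using assms by auto
    have "coeff f (d - i) = coeff f i"
      using assms(1) i(1) unfolding palindromic_iff by metis
    then show "const3 (coeff f i) * var_x ^ i * var_y ^ (d - i)
      + const3 (coeff f (2 * h - 1 - i)) * var_x ^ (2 * h - 1 - i) * var_y ^ (d - (2 * h - 1 - i))
      = const3 (coeff f i) * sym_pair i (d - i)"
      unfolding assms(2)[symmetric] i(2) by (simp add: sym_pair_def distrib_left mult.assoc)
  qed
  finally show ?thesis .
qed

lemma sym_pair_eq_bihom: "sym_pair i j = bihom (i + j) (monom 1 i + monom 1 j)"
  by (simp add: bihom_add bihom_monom sym_pair_def)

lemma palindromic_monom_pair: "palindromic (i + j) (monom 1 i + monom 1 j)"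
proof -
  have "degree (monom 1 i + monom 1 j :: 'a poly) \<le> i + j"
    by (intro degree_add_le order.trans[OF degree_monom_le]) auto
  moreover have "coeff (monom 1 i + monom 1 j :: 'a poly) k = coeff (monom 1 i + monom 1 j) (i + j - k)"
    if "k \<le> i + j" for k
    using that by (auto simp: add.commute)
  ultimately show ?thesis unfolding palindromic_iff by blast
qed

lemma P_combination_add_term:
  assumes "k < Q"
  shows "P_combination Q (f(k := f k + g)) = P_combination Q f + bihom (6 * Q - 5 - 4 * k) g * P_poly ^ k"
proof -
  have "P_combination Q (f(k := f k + g)) = (\<Sum>l<Q. bihom (6 * Q - 5 - 4 * l) (f l) * P_poly ^ l
     + (if l = k then bihom (6 * Q - 5 - 4 * k) g * P_poly ^ k else 0))"
    unfolding P_combination_def by (intro sum.cong refl) (auto simp: bihom_add distrib_right)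
  also have "\<dots> = P_combination Q f + bihom (6 * Q - 5 - 4 * k) g * P_poly ^ k"
    unfolding sum.distrib P_combination_def using assms by simp
  finally show ?thesis .
qed

lemma homogeneous3_mult:
  assumes "p \<in> homogeneous3 m" "q \<in> homogeneous3 n"
  shows "p * q \<in> homogeneous3 (m + n)"
proof -
  have "a + b + c = m + n" if key: "(a, b, c) \<in> Poly_Mapping.keys (p * q)" for a b c
  proof -
    obtain k l where kl: "k \<in> Poly_Mapping.keys p" "l \<in> Poly_Mapping.keys q" "(a, b, c) = k + l"
      using keys_mult[of p q] key by fast
    obtain a1 b1 c1 where k: "k = (a1, b1, c1)" by (cases k)
    obtain a2 b2 c2 where l: "l = (a2, b2, c2)" by (cases l)
    have "a1 + b1 + c1 = m" "a2 + b2 + c2 = n" using assms kl by (auto simp: homogeneous3_def k l)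
    then show ?thesis using kl(3) by (simp add: k l)
  qed
  then show ?thesis by (auto simp: homogeneous3_def)
qed

lemma homogeneous3_add:
  assumes "p \<in> homogeneous3 m" "q \<in> homogeneous3 m"
  shows "p + q \<in> homogeneous3 m"
proof -
  note A = assms[unfolded homogeneous3_def mem_Collect_eq]
  show ?thesis
    unfolding homogeneous3_def mem_Collect_eq
  proof (rule ballI)
    fix k assume "k \<in> Poly_Mapping.keys (p + q)"
    then have "k \<in> Poly_Mapping.keys p \<or> k \<in> Poly_Mapping.keys q"
      using keys_add[of p q] by blast
    then show "case k of (a, b, c) \<Rightarrow> a + b + c = m"
      using bspec[OF A(1), of k] bspec[OF A(2), of k] by blast
  qed
qed

lemma homogeneous3_0: "0 \<in> homogeneous3 m"
  by (simp add: homogeneous3_def)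

lemma homogeneous3_sum: "(\<And>x. x \<in> A \<Longrightarrow> f x \<in> homogeneous3 m) \<Longrightarrow> sum f A \<in> homogeneous3 m"
  by (induction A rule: infinite_finite_induct)
    (simp_all add: homogeneous3_add homogeneous3_0)

lemma homogeneous3_single: "a + b + c = m \<Longrightarrow> Poly_Mapping.single (a, b, c) v \<in> homogeneous3 m"
  by (simp add: homogeneous3_def)

lemma homogeneous3_bihom: "bihom d f \<in> homogeneous3 d"
proof -
  have "bihom d f = (\<Sum>i\<le>d. Poly_Mapping.single (i, d - i, 0) (coeff f i))"
    by (simp only: bihom_def homogenize_def monomial_eq_single[of _ _ _ 0, unfolded power_0 mult_1_right])
  also have "\<dots> \<in> homogeneous3 d"
    by (intro homogeneous3_sum homogeneous3_single) simp
  finally show ?thesis .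
qed

lemma homogeneous3_P_power: "P_poly ^ k \<in> homogeneous3 (4 * k)"
proof (induction k)
  case 0
  show ?case by (simp add: homogeneous3_def zero_prod_def)
next
  case (Suc k)
  have z: "var_z ^ n \<in> homogeneous3 n" for n
    unfolding var_z_power by (rule homogeneous3_single) simp
  have "bihom 2 tvar * var_z ^ 2 \<in> homogeneous3 (2 + 2)" "bihom 3 cub * var_z ^ 1 \<in> homogeneous3 (3 + 1)"
    by (intro homogeneous3_mult homogeneous3_bihom z)+
  then have "P_poly \<in> homogeneous3 4"
    unfolding P_poly_def bihom_tvar bihom_cub using z[of 4] by (intro homogeneous3_add) simp_all
  from homogeneous3_mult[OF this Suc] show ?case by simp
qed

lemma homogeneous3_P_combination: "P_combination Q f \<in> homogeneous3 (6 * Q - 5)"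
  unfolding P_combination_def
proof (rule homogeneous3_sum)
  fix k assume "k \<in> {..<Q}"
  then have e: "(6 * Q - 5 - 4 * k) + 4 * k = 6 * Q - 5"
    unfolding lessThan_iff by linarith
  have "bihom (6 * Q - 5 - 4 * k) (f k) * P_poly ^ k \<in> homogeneous3 ((6 * Q - 5 - 4 * k) + 4 * k)"
    by (intro homogeneous3_mult homogeneous3_bihom homogeneous3_P_power)
  then show "bihom (6 * Q - 5 - 4 * k) (f k) * P_poly ^ k \<in> homogeneous3 (6 * Q - 5)"
    unfolding e .
qed

lemma zero_in_X_space: "to_O Q 0 \<in> (X_space Q :: 'a::field poly3 set set)"
proof -
  interpret R: ring "O_ring Q :: 'a poly3 set ring" by (rule ring_O_ring)
  have "to_O Q 0 \<in> R.Span (O_scalars Q) []" by (simp add: to_O_0)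
  then show ?thesis unfolding X_space_def by (intro UN_I[of "[]"]) auto
qed

lemma X_space_extend:
  assumes "to_O Q p \<in> X_generators Q" "to_O Q q \<in> (X_space Q :: 'a::field poly3 set set)"
  shows "to_O Q (const3 a * p + q) \<in> X_space Q"
proof -
  interpret R: ring "O_ring Q :: 'a poly3 set ring" by (rule ring_O_ring)
  obtain us where us: "us \<in> lists (X_generators Q)" "to_O Q q \<in> R.Span (O_scalars Q) us"
    using assms(2) unfolding X_space_def by blast
  have "to_O Q (const3 a) \<in> O_scalars Q" by (simp add: O_scalars_def)
  then have "to_O Q (const3 a * p + q) \<in> R.Span (O_scalars Q) (to_O Q p # us)"
    using us(2) unfolding R.Span.simps foldr_Cons o_apply R.line_extension_mem_iff
    by (metis to_O_add to_O_mult)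
  then show ?thesis
    unfolding X_space_def using us(1) assms(1) by (intro UN_I[of "to_O Q p # us"]) auto
qed

text \<open>
  In odd degree the symbols \<open>[i, j]\<close> span the palindromic forms, so an element of \<open>X\<close> is a
  combination of powers of \<open>P\<close> with arbitrary palindromic coefficients.
\<close>

lemma X_space_eq:
  "(X_space Q :: 'a::field poly3 set set)
    = to_O Q ` {P_combination Q f | f. \<forall>k<Q. palindromic (6 * Q - 5 - 4 * k) (f k)}" (is "_ = ?S")
proof
  interpret R: ring "O_ring Q :: 'a poly3 set ring" by (rule ring_O_ring)
  have "v \<in> ?S" if "us \<in> lists (X_generators Q)" "v \<in> R.Span (O_scalars Q) us" for us v
    using that
  proof (induction us arbitrary: v rule: lists.induct)
    case Nil
    have "P_combination Q (\<lambda>k. 0) = (0 :: 'a poly3)" by (simp add: P_combination_def bihom_0)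
    moreover have "v = to_O Q 0" using Nil by (simp add: to_O_0)
    ultimately show ?case by (auto intro!: image_eqI exI[of _ "\<lambda>k. 0"])
  next
    case (Cons u us)
    then obtain a w where aw: "v = to_O Q (const3 a) \<otimes>\<^bsub>O_ring Q\<^esub> u \<oplus>\<^bsub>O_ring Q\<^esub> w"
      "w \<in> R.Span (O_scalars Q) us"
      unfolding R.Span.simps foldr_Cons o_apply R.line_extension_mem_iff O_scalars_def by blast
    obtain f where f: "w = to_O Q (P_combination Q f)" "\<forall>k<Q. palindromic (6 * Q - 5 - 4 * k) (f k)"
      using Cons(3)[OF aw(2)] by blast
    obtain i j k where ijk: "u = to_O Q (sym_pair i j * P_poly ^ k)" "i + j + 4 * k = 6 * Q - 5" "k < Q"
      using Cons(1) unfolding X_generators_def by blast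
    have ij: "6 * Q - 5 - 4 * k = i + j" using ijk(2) by simp
    define g where "g = smult a (monom 1 i + monom 1 j)"
    have "v = to_O Q (P_combination Q (f(k := f k + g)))"
      unfolding P_combination_add_term[OF ijk(3)] aw(1) f(1) ijk(1) to_O_mult to_O_add ij g_def
        bihom_smult sym_pair_eq_bihom
      by (simp add: ac_simps)
    moreover have *: "palindromic (i + j) g"
      unfolding g_def by (intro palindromic_smult palindromic_monom_pair)
    have "palindromic (6 * Q - 5 - 4 * k) (f k)"
      using f(2) ijk(3) by blast
    then have "palindromic (6 * Q - 5 - 4 * k) (f k + g)"
      using * unfolding ij by (rule palindromic_add)
    then have "\<forall>l<Q. palindromic (6 * Q - 5 - 4 * l) ((f(k := f k + g)) l)"
      using f(2) unfolding fun_upd_def by presburger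
    ultimately show ?case by blast
  qed
  then show "X_space Q \<subseteq> ?S" unfolding X_space_def by blast
next
  show "?S \<subseteq> X_space Q"
  proof clarify
    fix f :: "nat \<Rightarrow> 'a poly" assume f: "\<forall>k<Q. palindromic (6 * Q - 5 - 4 * k) (f k)"
    define h where "h k = 3 * Q - 2 - 2 * k" for k
    define F where "F = (\<lambda>(k, i). const3 (coeff (f k) i) * (sym_pair i (6 * Q - 5 - 4 * k - i) * P_poly ^ k))"
    have gen: "to_O Q (sym_pair i (6 * Q - 5 - 4 * k - i) * P_poly ^ k) \<in> X_generators Q"
      if "k < Q" "i < h k" for k i
    proof -
      have "i + (6 * Q - 5 - 4 * k - i) + 4 * k = 6 * Q - 5" using that by (simp add: h_def)
      with that show ?thesis unfolding X_generators_def by blast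
    qed
    have "to_O Q (sum F I) \<in> X_space Q" if "finite I" "I \<subseteq> (SIGMA k:{..<Q}. {..<h k})" for I
      using that
    proof (induction I rule: finite_induct)
      case empty
      then show ?case by (simp add: zero_in_X_space)
    next
      case (insert x I)
      obtain k i where x: "x = (k, i)" by (cases x)
      have "to_O Q (const3 (coeff (f k) i) * (sym_pair i (6 * Q - 5 - 4 * k - i) * P_poly ^ k) + sum F I) \<in> X_space Q"
        using insert by (intro X_space_extend gen) (auto simp: x)
      then show ?case using insert by (simp add: x F_def)
    qed
    then have "to_O Q (\<Sum>(k, i)\<in>(SIGMA k:{..<Q}. {..<h k}). F (k, i)) \<in> X_space Q"
      by simp
    also have "(\<Sum>(k, i)\<in>(SIGMA k:{..<Q}. {..<h k}). F (k, i)) = (\<Sum>k<Q. \<Sum>i<h k. F (k, i))"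
      by (rule sum.Sigma[symmetric]) auto
    also have "\<dots> = P_combination Q f"
      unfolding P_combination_def
    proof (rule sum.cong[OF refl])
      fix k assume k: "k \<in> {..<Q}"
      have "6 * Q - 5 - 4 * k = 2 * h k - 1" "h k > 0" using k by (auto simp: h_def)
      then have "bihom (6 * Q - 5 - 4 * k) (f k)
          = (\<Sum>i<h k. const3 (coeff (f k) i) * sym_pair i (6 * Q - 5 - 4 * k - i))"
        using f k by (intro bihom_palindromic) auto
      then show "(\<Sum>i<h k. F (k, i)) = bihom (6 * Q - 5 - 4 * k) (f k) * P_poly ^ k"
        by (simp add: F_def sum_distrib_right mult.assoc)
    qed
    finally show "to_O Q (P_combination Q f) \<in> X_space Q" .
  qed
qed

context
  fixes ty :: "'a::field itself"
  assumes char2: "CHAR('a) = 2"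
begin

declare char2_cancel [OF char2, simp]

text \<open>
  At \<open>y = 1\<close>, multiples of \<open>x ^ (4 * Q)\<close> and \<open>y ^ (4 * Q)\<close> leave a middle range of coefficients that
  must vanish. For \<open>frob_rem\<close> the closed form \<open>cub * frob_rem n = t ^ a + t ^ b\<close> shows that the middle
  range of \<open>s * frob_rem n\<close> vanishes exactly if the power series \<open>s / cub\<close> is a polynomial.
\<close>

lemma coefficient_conditions:
  fixes s f :: "'a poly"
  assumes Q: "Q = 2 ^ j" "j \<ge> 1" and s: "degree s \<le> 2 * Q - 1"
  shows "bihom (6 * Q - 1) f \<in> trunc_ideal (4 * Q) \<longleftrightarrow>
      (\<forall>c. 2 * Q \<le> c \<and> c < 4 * Q \<longrightarrow> coeff f c = 0)"
    and "bihom (6 * Q - 3) (s * frob_rem (Suc (Suc j))) \<in> trunc_ideal (4 * Q) \<Longrightarrow> cub dvd s"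
    and "cub dvd s \<Longrightarrow> bihom (6 * Q - 3) (s * frob_rem (Suc (Suc j))) \<in> trunc_ideal (4 * Q)"
    and "cub dvd s \<Longrightarrow>
      bihom (6 * Q - 2) (s * (frob_rem (Suc j) ^ 2 * cub)) \<in> trunc_ideal (4 * Q)"
proof -
  have Q2: "Q \<ge> 2" unfolding Q(1) using Q(2) by (cases j) auto
  have tr: "bihom d f \<in> trunc_ideal (4 * Q) \<longleftrightarrow>
      (\<forall>c. d + 1 - 4 * Q \<le> c \<and> c < 4 * Q \<longrightarrow> coeff f c = 0)"
    if "d < 8 * Q" "4 * Q \<le> d" for d and f :: "'a poly"
    using that Q2 by (subst bihom_in_trunc_ideal_iff) (auto simp: less_diff_conv2 le_diff_conv)
  show "bihom (6 * Q - 1) f \<in> trunc_ideal (4 * Q) \<longleftrightarrow>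
      (\<forall>c. 2 * Q \<le> c \<and> c < 4 * Q \<longrightarrow> coeff f c = 0)"
  proof -
    have "6 * Q - 1 + 1 - 4 * Q = 2 * Q" using Q2 by simp
    then show ?thesis using tr[of "6 * Q - 1" f] Q2 by simp
  qed
  have e3: "6 * Q - 3 + 1 - 4 * Q = 2 * Q - 2" "6 * Q - 2 + 1 - 4 * Q = 2 * Q - 1" using Q2 by auto
  note tr3 = tr[of "6 * Q - 3", unfolded e3] and tr2 = tr[of "6 * Q - 2", unfolded e3]
  \<comment> \<open>The two closed forms of \<open>cub * frob_rem n\<close> according to parity, with exponents \<open>4 Q + \<mu>\<close> and \<open>\<epsilon>\<close> at level \<open>j + 2\<close>.\<close>
  define \<epsilon> where "\<epsilon> = (if even j then 1 else 0 :: nat)"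
  define \<mu> where "\<mu> = (if even j then 0 else 1 :: nat)"
  have Q4: "2 ^ Suc (Suc j) = 4 * Q" by (simp add: Q)
  have cA: "cub * frob_rem (Suc (Suc j)) = tvar ^ (4 * Q + \<mu>) + (tvar ^ \<epsilon> :: 'a poly)"
    unfolding cub_mult_frob_rem[OF char2] Q4 by (simp add: \<epsilon>_def \<mu>_def)
  have cB: "(cub * frob_rem (Suc j))\<^sup>2 = tvar ^ (4 * Q + 2 * \<epsilon>) + (tvar ^ (2 * \<mu>) :: 'a poly)"
  proof -
    have "cub * frob_rem (Suc j) = tvar ^ (2 * Q + \<epsilon>) + (tvar ^ \<mu> :: 'a poly)"
      unfolding cub_mult_frob_rem[OF char2] by (simp add: \<epsilon>_def \<mu>_def Q)
    then show ?thesis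
      by (simp only: poly_power2_add[OF char2]) (simp add: algebra_simps flip: power_mult)
  qed
  have low_coeffs: "coeff (d * (tvar ^ (4 * Q + x) + tvar ^ y)) c = 0"
    if "degree d + y < c" "c < 4 * Q" for d :: "'a poly" and x y c
    using that by (simp add: distrib_left coeff_mult_tvar_power coeff_eq_0)
  {
    assume "cub dvd s"
    then obtain d where d: "s = cub * d" ..
    have dd: "d = 0 \<or> degree d + 3 \<le> 2 * Q - 1"
      using s unfolding d by (cases "d = 0") (simp_all add: degree_mult_eq)
    have low_d: "coeff (d * (tvar ^ (4 * Q + x) + tvar ^ y)) c = 0"
      if "2 * Q + y \<le> e + 3" "e \<le> c" "c < 4 * Q" for x y c e
    proof (cases "d = 0")
      case False
      then have "degree d + y < c" using dd that Q2 by linarith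
      then show ?thesis using low_coeffs that by blast
    qed simp
    have "s * frob_rem (Suc (Suc j)) = d * (tvar ^ (4 * Q + \<mu>) + tvar ^ \<epsilon>)"
      unfolding d cA[symmetric] by (simp only: ac_simps)
    then show "bihom (6 * Q - 3) (s * frob_rem (Suc (Suc j))) \<in> trunc_ideal (4 * Q)"
      using tr3 low_d[of \<epsilon> "2 * Q - 2"] Q2 by (simp add: \<epsilon>_def del: frob_rem.simps)
    have "s * (frob_rem (Suc j) ^ 2 * cub) = d * (tvar ^ (4 * Q + 2 * \<epsilon>) + tvar ^ (2 * \<mu>))"
      unfolding d cB[symmetric] by (simp only: power2_eq_square ac_simps)
    then show "bihom (6 * Q - 2) (s * (frob_rem (Suc j) ^ 2 * cub)) \<in> trunc_ideal (4 * Q)"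
      using tr2 low_d[of "2 * \<mu>" "2 * Q - 1"] Q2 by (simp add: \<mu>_def del: frob_rem.simps)
  }
  assume "bihom (6 * Q - 3) (s * frob_rem (Suc (Suc j))) \<in> trunc_ideal (4 * Q)"
  then have z: "coeff (s * frob_rem (Suc (Suc j))) c = 0" if "2 * Q - 2 \<le> c" "c < 4 * Q" for c
    using that Q2 by (subst (asm) tr3) auto
  define f where "f = s * frob_rem (Suc (Suc j))"
  \<comment> \<open>The polynomial part: \<open>low\<close> turns out to be \<open>t ^ \<epsilon> s / cub\<close>.\<close>
  define low where "low = (\<Sum>i<2 * Q - 2. monom (coeff f i) i)"
  have low: "coeff low i = (if i < 2 * Q - 2 then coeff f i else 0)" for i
    by (simp add: low_def coeff_sum)
  have "tvar ^ (4 * Q) dvd f + low"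
    unfolding tvar_power monom_1_dvd_iff'
    using z[folded f_def] by (auto simp: low fld_add_self[OF char2])
  then have "tvar ^ (4 * Q) dvd cub * (f + low) + tvar ^ (4 * Q) * (tvar ^ \<mu> * s)"
    by (rule dvd_add[OF dvd_mult dvd_triv_left])
  also have "cub * (f + low) + tvar ^ (4 * Q) * (tvar ^ \<mu> * s)
      = s * (cub * frob_rem (Suc (Suc j))) + cub * low + tvar ^ (4 * Q) * (tvar ^ \<mu> * s)"
    unfolding f_def by (simp only: distrib_left ac_simps)
  also have "\<dots> = cub * low + tvar ^ \<epsilon> * s"
    unfolding cA by (simp add: power_add algebra_simps)
  finally have dv: "tvar ^ (4 * Q) dvd cub * low + tvar ^ \<epsilon> * s" .
  have "degree low \<le> 2 * Q - 3"
    by (rule degree_le) (auto simp: low)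
  then have "degree (cub * low) \<le> 2 * Q"
    using degree_mult_le[of cub low] Q2 by simp
  moreover have "degree (tvar ^ \<epsilon> * s) \<le> 2 * Q"
    using degree_mult_le[of "tvar ^ \<epsilon>" s] s Q2 by (simp add: \<epsilon>_def split: if_splits)
  ultimately have "degree (cub * low + tvar ^ \<epsilon> * s) \<le> 2 * Q" by (rule degree_add_le)
  then have "cub * low + tvar ^ \<epsilon> * s = 0"
    using dvd_imp_degree_le[OF dv] Q2 by (cases "cub * low + tvar ^ \<epsilon> * s = 0") auto
  then have "tvar ^ \<epsilon> * s = cub * low"
    by (metis poly_eq_iff_add[OF char2])
  then have "cub dvd tvar ^ \<epsilon> * s" by simp
  then show "cub dvd s" by (rule cub_dvd_tvar_power_mult[OF char2])
qed

lemma dimension_N_cap_X: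
  assumes j: "j \<ge> 1" and T: "\<And>i. 1 \<le> i \<Longrightarrow> i \<le> j \<Longrightarrow> trace_sum (\<alpha>::'a) i \<noteq> 0"
    and T0: "trace_sum \<alpha> (Suc j) = 0" and Q: "Q = 2 ^ j"
  shows "ring.dimension (O_ring Q) 1 (O_scalars Q) (N_space \<alpha> Q \<inter> X_space Q)"
proof -
  interpret R: ring "O_ring Q :: 'a poly3 set ring" by (rule ring_O_ring)
  let ?J = "trunc_ideal (4 * Q) :: 'a poly3 set"
  have Q1: "Q \<ge> 1" by (simp add: Q)
  define solution where "solution s \<longleftrightarrow> palindromic (2 * Q - 1) s \<and> cub dvd s \<and>
    (\<forall>c. 2 * Q \<le> c \<and> c < 4 * Q \<longrightarrow> coeff (s * at_square (obstruction \<alpha> (Suc j))) c = 0)" for s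
  obtain s0 where s0: "s0 \<noteq> 0" "solution s0" "\<And>s. solution s \<Longrightarrow> \<exists>a. s = smult a s0"
    unfolding solution_def using unique_palindromic_solution[OF char2 j T T0 Q] by blast
  have ds: "degree s \<le> 2 * Q - 1" if "palindromic (2 * Q - 1) s" for s :: "'a poly"
    using that by (simp add: palindromic_def)
  define w where "w s = P_combination Q (\<lambda>k. s * cofactor_coeff \<alpha> (Suc j) k)" for s
  have w_smult: "w (smult a s) = const3 a * w s" for a s
    by (simp add: w_def P_combination_def bihom_smult sum_distrib_left mult.assoc)
  have solution_in: "to_O Q (w s) \<in> N_space \<alpha> Q \<inter> X_space Q" if s: "solution s" for s
  proof -
    have p: "palindromic (2 * Q - 1) s" using s by (simp add: solution_def)
    have "g_poly \<alpha> * w s \<in> ?J"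
      unfolding w_def g_poly_mult_P_combination_cofactor[OF char2 Q ds[OF p]]
    proof (intro trunc_ideal_add)
      show "bihom (2 * Q - 1) s * var_z ^ (4 * Q) \<in> ?J"
        by (rule trunc_ideal_mult) (simp add: trunc_ideal_def var_z_power lookup_single)
      have s: "cub dvd s" "\<forall>c. 2 * Q \<le> c \<and> c < 4 * Q \<longrightarrow> coeff (s * at_square (obstruction \<alpha> (Suc j))) c = 0"
        using s by (simp_all add: solution_def)
      show "bihom (6 * Q - 1) (s * at_square (obstruction \<alpha> (Suc j))) \<in> ?J"
        using s(2) coefficient_conditions(1)[OF Q j ds[OF p]] by blast
      show "bihom (6 * Q - 2) (s * (frob_rem (Suc j) ^ 2 * cub)) * var_z \<in> ?J"
        by (intro trunc_ideal_mult_right coefficient_conditions(4)[OF Q j ds[OF p]] s)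
      show "bihom (6 * Q - 3) (s * frob_rem (Suc (Suc j))) * var_z ^ 2 \<in> ?J"
        by (intro trunc_ideal_mult_right coefficient_conditions(3)[OF Q j ds[OF p]] s)
    qed
    then have "to_O Q (g_poly \<alpha>) \<otimes>\<^bsub>O_ring Q\<^esub> to_O Q (w s) = \<zero>\<^bsub>O_ring Q\<^esub>"
      unfolding to_O_mult to_O_0 to_O_eq_0_iff .
    moreover have "to_O Q (w s) \<in> O_component Q (6 * Q - 5)"
      unfolding O_component_def w_def using homogeneous3_P_combination by blast
    moreover have "palindromic (6 * Q - 5 - 4 * k) (s * cofactor_coeff \<alpha> (Suc j) k)" if "k < Q" for k
    proof -
      have "(2 * Q - 1) + (2 ^ Suc (Suc j) - 4 - 4 * k) = 6 * Q - 5 - 4 * k"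
        using that by (simp add: Q)
      then show ?thesis using palindromic_mult[OF p palindromic_cofactor_coeff[of "Suc j" k \<alpha>]] by simp
    qed
    then have "to_O Q (w s) \<in> X_space Q"
      unfolding X_space_eq w_def by blast
    ultimately show ?thesis by (simp add: N_space_def)
  qed
  have in_solution: "\<exists>s. solution s \<and> u = to_O Q (w s)" if u: "u \<in> N_space \<alpha> Q \<inter> X_space Q" for u
  proof -
    obtain f where f: "u = to_O Q (P_combination Q f)"
      "\<forall>k<Q. palindromic (6 * Q - 5 - 4 * k) (f k)"
      using u unfolding X_space_eq by blast
    have "g_poly \<alpha> * P_combination Q f \<in> ?J"
      using u by (simp add: N_space_def f(1) to_O_mult to_O_0 to_O_eq_0_iff)
    moreover have "degree (f k) \<le> 6 * Q - 5 - 4 * k" if "k < Q" for k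
      using f(2) that by (simp add: palindromic_def)
    ultimately have ker:
      "\<And>k. k < Q \<Longrightarrow> bihom (6 * Q - 5 - 4 * k) (f k + f (Q - 1) * cofactor_coeff \<alpha> (Suc j) k) \<in> ?J"
      "bihom (6 * Q - 1) (f (Q - 1) * at_square (obstruction \<alpha> (Suc j))) \<in> ?J"
      "bihom (6 * Q - 3) (f (Q - 1) * frob_rem (Suc (Suc j))) \<in> ?J"
      using kernel_P_combination[OF char2 Q, of f \<alpha>] by blast+
    have p: "palindromic (2 * Q - 1) (f (Q - 1))"
    proof -
      have "6 * Q - 5 - 4 * (Q - 1) = 2 * Q - 1" "Q - 1 < Q" using Q1 by auto
      then show ?thesis using f(2) by metis
    qed
    have "solution (f (Q - 1))"
      unfolding solution_def using p ker coefficient_conditions[OF Q j ds[OF p]] by blast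
    moreover have "u = to_O Q (w (f (Q - 1)))"
      unfolding f(1) to_O_eq_iff poly3_minus_eq_add[OF char2] w_def P_combination_def
        sum.distrib[symmetric] distrib_right[symmetric] bihom_add[symmetric]
    proof -
      have sumJ: "sum F A \<in> ?J" if "\<And>x. x \<in> A \<Longrightarrow> F x \<in> ?J" for F :: "nat \<Rightarrow> 'a poly3" and A
        using that by (induction A rule: infinite_finite_induct) (auto intro: trunc_ideal_add)
      show "(\<Sum>k<Q. bihom (6 * Q - 5 - 4 * k) (f k + f (Q - 1) * cofactor_coeff \<alpha> (Suc j) k) * P_poly ^ k) \<in> ?J"
        using ker(1) by (intro sumJ trunc_ideal_mult_right) auto
    qed
    ultimately show ?thesis by blast
  qed
  have nz: "to_O Q (w s0) \<noteq> \<zero>\<^bsub>O_ring Q\<^esub>"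
  proof
    assume "to_O Q (w s0) = \<zero>\<^bsub>O_ring Q\<^esub>"
    then have "w s0 \<in> ?J" unfolding to_O_0 to_O_eq_0_iff .
    define K where "K = Q - 1"
    have QK: "Q = Suc K" using Q1 by (simp add: K_def)
    have "(\<Sum>k\<le>K. bihom (6 * Q - 5 - 4 * k) (s0 * cofactor_coeff \<alpha> (Suc j) k) * P_poly ^ k)
        + bihom 0 0 * var_z + bihom 0 0 * var_z ^ 2 \<in> ?J"
      using \<open>w s0 \<in> ?J\<close> unfolding w_def P_combination_def QK lessThan_Suc_atMost by (simp add: bihom_0)
    then have "bihom (6 * Q - 5 - 4 * K) (s0 * cofactor_coeff \<alpha> (Suc j) K) \<in> ?J"
      using P_adic_expansion_in_trunc_ideal[of "\<lambda>k. 6 * Q - 5 - 4 * k" "\<lambda>k. s0 * cofactor_coeff \<alpha> (Suc j) k" K 0 0 0 0 "4 * Q"] QK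
      by auto
    moreover have "cofactor_coeff \<alpha> (Suc j) K = 1" unfolding K_def Q by (rule cofactor_coeff_top)
    moreover have "6 * Q - 5 - 4 * K = 2 * Q - 1" using QK by simp
    ultimately have "bihom (2 * Q - 1) s0 \<in> ?J" by simp
    then have "coeff s0 a = 0" if "a \<le> 2 * Q - 1" for a
      using that Q1 by (subst (asm) bihom_in_trunc_ideal_iff) auto
    moreover have "coeff s0 a = 0" if "\<not> a \<le> 2 * Q - 1" for a
      using that s0(2) ds[of s0] by (intro coeff_eq_0) (auto simp: solution_def)
    ultimately have "s0 = 0" by (metis coeff_0 poly_eqI)
    with s0(1) show False by simp
  qed
  have solution_smult: "solution (smult a s0)" for a
    using s0(2) unfolding solution_def by (auto intro: palindromic_smult dvd_smult)
  have "N_space \<alpha> Q \<inter> X_space Q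
      = R.line_extension (O_scalars Q) (to_O Q (w s0)) {\<zero>\<^bsub>O_ring Q\<^esub>}"
  proof (rule Set.set_eqI)
    fix u
    have "u \<in> R.line_extension (O_scalars Q) (to_O Q (w s0)) {\<zero>\<^bsub>O_ring Q\<^esub>}
      \<longleftrightarrow> (\<exists>a. u = to_O Q (w (smult a s0)))"
      unfolding R.line_extension_mem_iff O_scalars_def w_smult
      by (auto simp: to_O_mult to_O_0 to_O_add)
    also have "\<dots> \<longleftrightarrow> u \<in> N_space \<alpha> Q \<inter> X_space Q"
      using solution_in[OF solution_smult] in_solution[of u] s0(3) by blast
    finally show "u \<in> N_space \<alpha> Q \<inter> X_space Q
      \<longleftrightarrow> u \<in> R.line_extension (O_scalars Q) (to_O Q (w s0)) {\<zero>\<^bsub>O_ring Q\<^esub>}" ..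
  qed
  then show ?thesis
    using R.Suc_dim[OF to_O_carrier _ R.zero_dim, of "w s0" "O_scalars Q"] nz by simp
qed

end

section \<open>Trace sums and the degree of \<open>\<lambda>\<close>\<close>

lemma field_type_ring: "field (type_ring :: 'b::field ring)"
  by (rule field_from_type_algebra)

lemma type_ring_nat_pow: "x [^]\<^bsub>type_ring\<^esub> (n::nat) = (x :: 'b::field) ^ n"
proof -
  interpret R: field "type_ring :: 'b ring" by (rule field_type_ring)
  show ?thesis by (induction n) (simp_all add: type_ring_simps mult.commute)
qed

lemma eval_type_ring: "ring.eval type_ring l (x :: 'b::field) = poly (Poly (rev l)) x"
proof -
  interpret R: field "type_ring :: 'b ring" by (rule field_type_ring)
  show ?thesis
    by (induction l)
      (simp_all add: type_ring_simps type_ring_nat_pow Poly_append poly_monom mult.commute add.commute)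
qed

lemma prime_subfield:
  assumes "CHAR('b::field) = 2"
  shows "subfield {0, 1} (type_ring :: 'b ring)"
proof -
  interpret R: field "type_ring :: 'b ring" by (rule field_type_ring)
  have [simp]: "(2::'b) = 0" "- (1::'b) = 1"
    using char2_add_self[OF assms, of 1] uminus_CHAR_2[OF assms] by auto
  show ?thesis
  proof (rule R.subfieldI')
    show "subring {0, 1} (type_ring :: 'b ring)"
      by (rule R.subringI) (auto simp: type_ring_simps type_ring_uminus)
    have "inv\<^bsub>type_ring\<^esub> (1::'b) = 1"
      using R.inv_one by (simp add: type_ring_simps)
    then show "inv\<^bsub>type_ring\<^esub> k \<in> {0, 1}" if "k \<in> {0, 1} - {\<zero>\<^bsub>type_ring\<^esub>}" for k :: 'b
      using that by (auto simp: type_ring_simps)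
  qed
qed

text \<open>
  The polynomials over the prime field, if the characteristic is \<open>2\<close>.
\<close>

definition binary_poly :: "'b::field poly \<Rightarrow> bool" where
  "binary_poly p \<longleftrightarrow> (\<forall>i. coeff p i \<in> {0, 1})"

text \<open>
  The list-based minimal polynomial over the prime field, restated for the type of polynomials:
  some binary polynomial of degree \<open>degree_over_F2 x\<close> annihilates \<open>x\<close>, and none of smaller degree.
\<close>

lemma minimal_binary_poly:
  fixes x :: "'b::field"
  assumes char2: "CHAR('b) = 2" and r: "binary_poly r" "r \<noteq> 0" "poly r x = 0"
  obtains q where "binary_poly q" "q \<noteq> 0" "degree q = degree_over_F2 x" "poly q x = 0"
    "\<And>p. binary_poly p \<Longrightarrow> p \<noteq> 0 \<Longrightarrow> poly p x = 0 \<Longrightarrow> degree_over_F2 x \<le> degree p"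
proof -
  interpret R: field "type_ring :: 'b ring" by (rule field_type_ring)
  let ?K = "{0, 1} :: 'b set"
  have K: "subfield ?K type_ring" by (rule prime_subfield[OF char2])
  have list: "rev (coeffs p) \<in> carrier (?K[X]\<^bsub>type_ring\<^esub>)" "rev (coeffs p) \<noteq> []"
      "R.eval (rev (coeffs p)) x = poly p x" "Polynomials.degree (rev (coeffs p)) = degree p"
    if p: "binary_poly p" "p \<noteq> 0" for p
  proof -
    have "set (coeffs p) \<subseteq> ?K" using p(1) range_coeff[of p] by (auto simp: binary_poly_def)
    then show "rev (coeffs p) \<in> carrier (?K[X]\<^bsub>type_ring\<^esub>)"
      using p(2) unfolding univ_poly_carrier[symmetric] polynomial_def
      by (simp add: hd_rev last_coeffs_eq_coeff_degree type_ring_simps)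
    show "rev (coeffs p) \<noteq> []" using p(2) by simp
    show "R.eval (rev (coeffs p)) x = poly p x" by (simp add: eval_type_ring)
    show "Polynomials.degree (rev (coeffs p)) = degree p"
      by (simp add: degree_eq_length_coeffs)
  qed
  have alg: "(R.algebraic over ?K) x"
    using list[OF r(1,2)] r(3) by (intro R.algebraicI[of "rev (coeffs r)"]) (simp_all add: type_ring_simps)
  have xc: "x \<in> carrier type_ring" by (simp add: type_ring_simps)
  note I = R.IrrE[OF K xc alg]
  define l where "l = R.Irr ?K x"
  have l: "l \<in> carrier (?K[X]\<^bsub>type_ring\<^esub>)" "R.eval l x = 0" "hd l = 1"
    using I by (simp_all add: l_def type_ring_simps)
  have m: "degree_over_F2 x = Polynomials.degree l"
    by (simp add: degree_over_F2_def l_def)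
  have "l \<noteq> []"
    using I(2) R.pirreducibleE(1)[OF subfieldE(1)[OF K] I(1)] by (auto simp: l_def)
  then obtain a l' where al: "l = a # l'" by (cases l) auto
  have sl: "set l \<subseteq> ?K" using l(1) unfolding univ_poly_carrier[symmetric] polynomial_def by auto
  define q where "q = Poly (rev l)"
  have cq: "coeff q i = (if i < length l then rev l ! i else 0)" for i
    by (simp add: q_def coeff_Poly_eq nth_default_def)
  have "binary_poly q"
    unfolding binary_poly_def cq using sl by (auto simp: rev_nth) (metis insertE nth_mem singletonD subsetD diff_less_Suc diff_Suc_less length_greater_0_conv list.size(3) not_less0 zero_less_Suc)
  moreover have top: "coeff q (length l') = 1"
    using l(3) unfolding cq by (simp add: al nth_append)
  then have "q \<noteq> 0" by auto
  moreover have "degree q = degree_over_F2 x"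
  proof -
    have "degree q \<le> length l'" by (rule degree_le) (simp add: cq al)
    moreover have "length l' \<le> degree q" using top by (intro le_degree) simp
    ultimately show ?thesis by (simp add: m al)
  qed
  moreover have "poly q x = 0" using l(2) by (simp add: eval_type_ring q_def)
  moreover have "degree_over_F2 x \<le> degree p" if p: "binary_poly p" "p \<noteq> 0" "poly p x = 0" for p
  proof -
    have "l pdivides\<^bsub>type_ring\<^esub> rev (coeffs p)"
      unfolding l_def using list[OF p(1,2)] p(3)
      by (intro R.Irr_minimal[OF K xc alg]) (simp_all add: type_ring_simps)
    then have "Polynomials.degree l \<le> Polynomials.degree (rev (coeffs p))"
      by (intro R.pdivides_imp_degree_le[OF subfieldE(1)[OF K] l(1)] list p)
    then show ?thesis using list[OF p(1,2)] m by simp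
  qed
  ultimately show ?thesis by (rule that)
qed

lemma finite_frobenius_fixed:
  assumes "d \<ge> 1"
  shows "finite {y :: 'b::field. y ^ (2 ^ d) = y} \<and> card {y :: 'b. y ^ (2 ^ d) = y} \<le> 2 ^ d"
proof -
  let ?p = "monom 1 (2 ^ d) - monom 1 1 :: 'b poly"
  have "(1::nat) < 2 ^ d" using assms by (intro one_less_power) auto
  then have "coeff ?p (2 ^ d) = 1" by auto
  then have "?p \<noteq> 0" by (metis coeff_0 zero_neq_one)
  moreover have "degree ?p \<le> 2 ^ d"
    by (intro degree_diff_le order.trans[OF degree_monom_le]) auto
  moreover have "{y. poly ?p y = 0} = {y :: 'b. y ^ (2 ^ d) = y}"
    by (simp add: poly_monom)
  ultimately show ?thesis
    using poly_roots_finite[of ?p] card_poly_roots_bound[of ?p] by auto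
qed

context
  fixes ty :: "'b::field itself"
  assumes char2: "CHAR('b) = 2"
begin

lemma binary_poly_add:
  assumes "binary_poly (p :: 'b poly)" "binary_poly q"
  shows "binary_poly (p + q)"
proof -
  have "coeff p i + coeff q i \<in> {0, 1}" for i
    using assms char2_add_self[OF char2, of 1] unfolding binary_poly_def
    by (metis add.right_neutral add_0 insert_iff singletonD)
  then show ?thesis by (simp add: binary_poly_def)
qed

lemma frobenius_inj: "(y :: 'b) ^ (2 ^ n) = z ^ (2 ^ n) \<Longrightarrow> y = z"
proof -
  assume "y ^ (2 ^ n) = z ^ (2 ^ n)"
  then have "(y + z) ^ (2 ^ n) = 0"
    by (simp add: char2_power_add[OF char2] char2_add_self[OF char2])
  then have "y + z = 0" by simp
  then show ?thesis using uminus_CHAR_2[OF char2] by (metis add_eq_0_iff)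
qed

lemma poly_binary_frobenius:
  assumes "binary_poly (p :: 'b poly)"
  shows "poly p (y ^ (2 ^ n)) = poly p y ^ (2 ^ n)"
proof -
  have c: "coeff p i ^ (2 ^ n) = coeff p i" for i
    using assms unfolding binary_poly_def by (cases "coeff p i = 0") (auto simp: zero_power)
  have "poly p y ^ (2 ^ n) = (\<Sum>i\<le>degree p. (coeff p i * y ^ i) ^ (2 ^ n))"
    unfolding poly_altdef
    by (rule freshmans_dream_sum') (simp_all add: char2)
  also have "\<dots> = poly p (y ^ (2 ^ n))"
    unfolding poly_altdef power_mult_distrib c by (simp add: mult.commute flip: power_mult)
  finally show ?thesis by simp
qed

text \<open>
  Let \<open>d\<close> be the least positive period of \<open>x\<close> under Frobenius. The \<open>d\<close> conjugates of \<open>x\<close> are distinct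
  roots of its minimal polynomial, so \<open>d \<le> m\<close>. The \<open>2 ^ m\<close> binary polynomials of degree less than
  \<open>m\<close> take distinct values at \<open>x\<close>, and these lie in the fixed field of the \<open>d\<close>-th power of Frobenius,
  so \<open>m \<le> d\<close>.
\<close>

lemma degree_over_F2_frobenius:
  fixes x :: 'b
  assumes N: "N \<ge> 1" "x ^ (2 ^ N) = x"
  defines "m \<equiv> degree_over_F2 x"
  shows "m \<ge> 1" "x ^ (2 ^ m) = x" "\<And>i. 1 \<le> i \<Longrightarrow> i < m \<Longrightarrow> x ^ (2 ^ i) \<noteq> x"
proof -
  define d where "d = (LEAST d. d \<ge> 1 \<and> x ^ (2 ^ d) = x)"
  have d: "d \<ge> 1 \<and> x ^ (2 ^ d) = x"
    unfolding d_def by (rule LeastI[of _ N]) (use N in simp)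
  have dmin: "d \<le> i" if "i \<ge> 1" "x ^ (2 ^ i) = x" for i
    unfolding d_def by (rule Least_le) (use that in simp)
  have "(1::nat) < 2 ^ d" using d by (intro one_less_power) auto
  define r :: "'b poly" where "r = monom 1 (2 ^ d) + monom 1 1"
  have "binary_poly r" "r \<noteq> 0"
  proof -
    have "coeff r i = (if i = 2 ^ d \<or> i = 1 then 1 else 0)" for i
      using \<open>1 < 2 ^ d\<close> by (auto simp: r_def)
    then show "binary_poly r" "r \<noteq> 0" by (auto simp: binary_poly_def poly_eq_iff)
  qed
  moreover have "poly r x = 0"
    using d by (simp add: r_def poly_monom char2_add_self[OF char2])
  ultimately obtain q where q: "binary_poly q" "q \<noteq> 0" "degree q = m" "poly q x = 0"
    and min: "\<And>p. binary_poly p \<Longrightarrow> p \<noteq> 0 \<Longrightarrow> poly p x = 0 \<Longrightarrow> m \<le> degree p"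
    unfolding m_def using minimal_binary_poly[OF char2] by metis
  have "d \<le> m"
  proof -
    have "inj_on (\<lambda>i. x ^ (2 ^ i)) {..<d}"
    proof (rule linorder_inj_onI)
      fix i k assume ik: "i < k" "i \<in> {..<d}" "k \<in> {..<d}"
      show "x ^ (2 ^ i) \<noteq> x ^ (2 ^ k)"
      proof
        assume "x ^ (2 ^ i) = x ^ (2 ^ k)"
        also have "x ^ (2 ^ k) = (x ^ (2 ^ (k - i))) ^ (2 ^ i)"
          using ik by (simp flip: power_mult power_add)
        finally have "x = x ^ (2 ^ (k - i))" by (rule frobenius_inj)
        then have "d \<le> k - i" using ik by (intro dmin) auto
        then show False using ik by simp
      qed
    qed auto
    then have "d = card ((\<lambda>i. x ^ (2 ^ i)) ` {..<d})" by (simp add: card_image)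
    also have "\<dots> \<le> card {y. poly q y = 0}"
      using q poly_binary_frobenius[OF q(1), of x] by (intro card_mono poly_roots_finite) auto
    also have "\<dots> \<le> m" using card_poly_roots_bound[OF q(2)] q(3) by simp
    finally show ?thesis .
  qed
  moreover have "m \<le> d"
  proof -
    define E :: "nat set \<Rightarrow> 'b poly" where "E A = (\<Sum>i\<in>A. monom 1 i)" for A
    have cE: "coeff (E A) i = (if i \<in> A then 1 else 0)" if "finite A" for A i
      using that by (simp add: E_def coeff_sum)
    let ?S = "Pow {..<m}"
    have fin: "finite A" if "A \<in> ?S" for A using that finite_subset by auto
    have bE: "binary_poly (E A)" if "A \<in> ?S" for A
      by (simp add: binary_poly_def cE[OF fin[OF that]])
    have "inj_on (\<lambda>A. poly (E A) x) ?S"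
    proof (rule inj_onI)
      fix A B assume AB: "A \<in> ?S" "B \<in> ?S" "poly (E A) x = poly (E B) x"
      have "E A + E B = 0"
      proof (rule ccontr)
        assume "E A + E B \<noteq> 0"
        moreover have "poly (E A + E B) x = 0" using AB(3) by (simp add: char2_add_self[OF char2])
        ultimately have "m \<le> degree (E A + E B)"
          using AB bE by (intro min binary_poly_add) auto
        moreover have "coeff (E A + E B) i = 0" if "i \<ge> m" for i
          using that AB(1,2) by (auto simp: cE fin)
        then have "degree (E A + E B) < m"
          using \<open>E A + E B \<noteq> 0\<close> by (metis leading_coeff_0_iff not_le)
        ultimately show False by simp
      qed
      then have "coeff (E A) i + coeff (E B) i = 0" for i by (metis coeff_0 coeff_add)
      then have "i \<in> A \<longleftrightarrow> i \<in> B" for i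
        using AB(1,2) cE[OF fin, of A i] cE[OF fin, of B i]
        by (metis add.left_neutral add.right_neutral zero_neq_one)
      then show "A = B" by blast
    qed
    then have "2 ^ m = card ((\<lambda>A. poly (E A) x) ` ?S)" by (simp add: card_image card_Pow)
    also have "\<dots> \<le> card {y :: 'b. y ^ (2 ^ d) = y}"
      using finite_frobenius_fixed[of d] d bE poly_binary_frobenius[of _ x d]
      by (intro card_mono) auto
    also have "\<dots> \<le> 2 ^ d" using finite_frobenius_fixed[of d] d by blast
    finally show ?thesis by simp
  qed
  ultimately have "d = m" by simp
  then show "m \<ge> 1" "x ^ (2 ^ m) = x" using d by auto
  show "x ^ (2 ^ i) \<noteq> x" if "1 \<le> i" "i < m" for i
    using dmin[of i] that \<open>d = m\<close> by auto
qed

end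

text \<open>
  The conjugates \<open>a ^ (2 ^ n)\<close> are roots of one binary polynomial, so two of them coincide.
\<close>

lemma algebraic_over_F2_frobenius_periodic:
  fixes a :: "'b::field"
  assumes char2: "CHAR('b) = 2" and alg: "algebraic_over_F2 a"
  obtains n where "n \<ge> 1" "a ^ (2 ^ n) = a"
proof -
  interpret R: field "type_ring :: 'b ring" by (rule field_type_ring)
  let ?K = "{0, 1} :: 'b set"
  have K: "subfield ?K type_ring" by (rule prime_subfield[OF char2])
  obtain l where l: "l \<in> carrier (?K[X]\<^bsub>type_ring\<^esub>)" "l \<noteq> []" "R.eval l a = \<zero>\<^bsub>type_ring\<^esub>"
    using R.algebraicE[OF subfieldE(1)[OF K], of a] alg unfolding algebraic_over_F2_def
    by (auto simp: type_ring_simps)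
  define q where "q = Poly (rev l)"
  have sl: "set l \<subseteq> ?K" "hd l \<noteq> 0"
    using l(1,2) unfolding univ_poly_carrier[symmetric] polynomial_def by (auto simp: type_ring_simps)
  have cq: "coeff q i = (if i < length l then rev l ! i else 0)" for i
    by (simp add: q_def coeff_Poly_eq nth_default_def)
  have "binary_poly q"
    unfolding binary_poly_def cq using sl(1) nth_mem[of _ "rev l"] by auto
  have "coeff q (length l - 1) \<noteq> 0"
    using l(2) sl(2) unfolding cq by (cases l) (simp_all add: nth_append)
  then have "q \<noteq> 0" by auto
  have "poly q a = 0" using l(3) by (simp add: eval_type_ring q_def type_ring_simps)
  then have "(\<lambda>n. a ^ (2 ^ n)) ` UNIV \<subseteq> {y. poly q y = 0}"
    using poly_binary_frobenius[OF char2 \<open>binary_poly q\<close>, of a] by auto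
  then have "finite (range (\<lambda>n. a ^ (2 ^ n)))"
    using poly_roots_finite[OF \<open>q \<noteq> 0\<close>] finite_subset by blast
  then have "\<not> inj (\<lambda>n :: nat. a ^ (2 ^ n))"
    using finite_imageD infinite_UNIV_nat by blast
  then obtain i k :: nat where ik: "i < k" "a ^ (2 ^ i) = a ^ (2 ^ k)"
    unfolding inj_def by (metis linorder_neqE_nat)
  have "a ^ (2 ^ k) = (a ^ (2 ^ (k - i))) ^ (2 ^ i)"
    using ik(1) by (simp flip: power_mult power_add)
  with ik(2) have "a ^ (2 ^ i) = (a ^ (2 ^ (k - i))) ^ (2 ^ i)" by (rule trans)
  then have "a = a ^ (2 ^ (k - i))" by (rule frobenius_inj[OF char2])
  then show ?thesis using that[of "k - i"] ik(1) by (metis Suc_leI One_nat_def zero_less_diff)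
qed

lemma trace_sum_artin_schreier:
  fixes l :: "'b::field"
  assumes char2: "CHAR('b) = 2"
  shows "trace_sum (l\<^sup>2 + l) n = l ^ (2 ^ n) + l"
proof (induction n)
  case 0
  show ?case by (simp add: trace_sum_def char2_add_self[OF char2])
next
  case (Suc n)
  have "trace_sum (l\<^sup>2 + l) (Suc n) = l\<^sup>2 + l + ((l ^ (2 ^ n))\<^sup>2 + l\<^sup>2)"
    unfolding trace_sum_Suc[OF char2] Suc char2_power2_add[OF char2] ..
  also have "(l ^ (2 ^ n))\<^sup>2 = l ^ (2 ^ Suc n)"
    by (simp add: mult.commute flip: power_mult)
  also have "l\<^sup>2 + l + (l ^ (2 ^ Suc n) + l\<^sup>2) = l ^ (2 ^ Suc n) + l"
    using char2_add_self[OF char2, of "l\<^sup>2"] by (metis add.commute add.left_commute add_0)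
  finally show ?case .
qed

text \<open>
  The trace sums of \<open>\<alpha>\<close> are \<open>\<lambda> ^ (2 ^ n) + \<lambda>\<close>, and the degree of \<open>\<lambda>\<close> is its period under Frobenius.
  That \<open>\<lambda>\<close> is periodic at all follows from \<open>\<alpha>\<close>: if \<open>\<alpha>\<close> has period \<open>n\<close>, then \<open>\<lambda> ^ (2 ^ n) + \<lambda>\<close> is
  \<open>0\<close> or \<open>1\<close>, and \<open>\<lambda>\<close> has period \<open>2 n\<close>.
\<close>

lemma trace_sum_degree:
  fixes \<alpha> :: "'a::field" and lam :: "'a alg_closure"
  assumes char2: "CHAR('a) = 2" and alg: "algebraic_over_F2 \<alpha>"
    and lam: "to_ac \<alpha> = lam ^ 2 + lam" and m: "m = degree_over_F2 lam"
  shows "m \<ge> 1" "trace_sum \<alpha> m = 0" "\<And>i. 1 \<le> i \<Longrightarrow> i < m \<Longrightarrow> trace_sum \<alpha> i \<noteq> 0"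
proof -
  have c2: "CHAR('a alg_closure) = 2" using char2 by simp
  have T: "to_ac (trace_sum \<alpha> n) = lam ^ (2 ^ n) + lam" for n
  proof -
    have "to_ac (trace_sum \<alpha> n) = trace_sum (to_ac \<alpha>) n"
      by (simp add: trace_sum_def to_ac_sum)
    then show ?thesis unfolding lam trace_sum_artin_schreier[OF c2] .
  qed
  have zero_iff: "trace_sum \<alpha> n = 0 \<longleftrightarrow> lam ^ (2 ^ n) = lam" for n
    using T[of n] fld_eq_iff_add[OF c2, of "lam ^ (2 ^ n)" lam] by (metis to_ac_eq_0_iff)
  obtain n where n: "n \<ge> 1" "\<alpha> ^ (2 ^ n) = \<alpha>"
    using algebraic_over_F2_frobenius_periodic[OF char2 alg] by blast
  \<comment> \<open>By additivity of Frobenius, \<open>t\<^sup>2 + t = \<alpha> ^ (2 ^ n) + \<alpha> = 0\<close>.\<close>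
  define t where "t = lam ^ (2 ^ n) + lam"
  have "t\<^sup>2 + t = to_ac \<alpha> ^ (2 ^ n) + to_ac \<alpha>"
    unfolding t_def lam char2_power_add[OF c2] char2_power2_add[OF c2]
    by (simp add: ac_simps flip: power_mult)
  also have "\<dots> = 0"
    using n(2) by (metis char2_add_self[OF c2] to_ac_power)
  finally have "t * (t + 1) = 0" by (simp add: power2_eq_square algebra_simps)
  then have "t = 0 \<or> t = 1"
    using fld_eq_iff_add[OF c2, of t 1] by auto
  then have t: "t ^ (2 ^ n) = t" by (auto simp: zero_power)
  have "lam ^ (2 ^ (n + n)) = (lam ^ (2 ^ n)) ^ (2 ^ n)"
    by (simp add: power_add power_mult)
  also have "lam ^ (2 ^ n) = t + lam"
    unfolding t_def by (simp add: add.assoc char2_add_self[OF c2])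
  also have "(t + lam) ^ (2 ^ n) = t + (t + lam)"
    unfolding char2_power_add[OF c2] t \<open>lam ^ (2 ^ n) = t + lam\<close> ..
  also have "\<dots> = lam" by (simp add: char2_add_self[OF c2] flip: add.assoc)
  finally have "n + n \<ge> 1" "lam ^ (2 ^ (n + n)) = lam" using n(1) by auto
  note D = degree_over_F2_frobenius[OF c2 this, folded m]
  show "m \<ge> 1" by (rule D(1))
  show "trace_sum \<alpha> m = 0" unfolding zero_iff by (rule D(2))
  show "trace_sum \<alpha> i \<noteq> 0" if "1 \<le> i" "i < m" for i
    unfolding zero_iff by (rule D(3)[OF that])
qed

theorem corollary4p6:
  fixes \<alpha> :: "'a::field" and lam :: "'a alg_closure" and m Q :: nat
  assumes "CHAR('a) = 2"
    and "\<alpha> \<noteq> 0"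
    and "algebraic_over_F2 \<alpha>"
    and "to_ac \<alpha> = lam ^ 2 + lam"
    and "m = degree_over_F2 lam"
    and "Q = 2 ^ (m - 1)"
  shows "ring.dimension (O_ring Q) 1 (O_scalars Q) (N_space \<alpha> Q \<inter> X_space Q)"
proof -
  note T = trace_sum_degree[OF assms(1,3,4,5)]
  have "m \<noteq> 1" using T(2) assms(2) by (auto simp: trace_sum_def)
  with T(1) have m: "m = Suc (m - 1)" "m - 1 \<ge> 1" by auto
  show ?thesis
  proof (rule dimension_N_cap_X[OF assms(1) m(2) _ _ assms(6)])
    show "trace_sum \<alpha> (Suc (m - 1)) = 0" using T(2) m(1) by simp
    show "trace_sum \<alpha> i \<noteq> 0" if "1 \<le> i" "i \<le> m - 1" for i
      using that m by (intro T(3)) auto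
  qed
qed

end
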